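(* Let $V$ be a finite-dimensional real normed space and let $\gamma:[0,T]\to V$ be a continuous tree-reduced bounded-variation path, translated so that $\gamma_0=0$. Set $g=S(\gamma)$ and assume $v=S_1(\gamma)=\gamma_T\ne0$. The following are equivalent. (a) There is $a\in\mathscr S(V)$ such that $g=ae^va^{-1}$. (b) There is $t_0\in[0,T]$ such that, for $\beta=\gamma|_{[0,t_0]}$, $$\gamma\sim_{\mathrm{rep}}\beta*\lambda_v*\overleftarrow\beta.$$ Under (a), equip $V$ with an auxiliary Euclidean norm and let $p$ be the gate (metric projection in $(\mathscr S(V),d_\infty)$) from $1$ to the axis $\mathcal A=\{ae^{tv}:t\in\mathbb R\}$. One may choose $\beta$ in (b) with $S(\beta)=p$, and this prefix signature is independent of the auxiliary Euclidean norm.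
   Context: Signature: for a continuous bounded-variation path $\gamma:[0,T]\to V$, $S(\gamma)=\sum_{n\ge0}S_n(\gamma)\in\prod_{n\ge0}V^{\otimes n}$, $S_0=1$, $S_n(\gamma)=\int_{0<t_1<\cdots<t_n<T}d\gamma_{t_1}\otimes\cdots\otimes d\gamma_{t_n}$. $e^{v}=\sum_n v^{\otimes n}/n!$. $\mathscr S(V)$ is the group (under the tensor concatenation product) of all signatures of continuous bounded-variation $V$-valued paths. Paths: a path is based if it starts at $0$; $*$ is translated concatenation; $\overleftarrow\alpha_s=\alpha_{A-s}-\alpha_A$ is the based reverse of $\alpha:[0,A]\to V$; $\lambda_v(t)=tv$, $0\le t\le1$. $\eta\sim_{\mathrm{rep}}\tilde\eta$ for continuous paths on $[0,A]$, $[0,B]$ means there are continuous nondecreasing surjections $\sigma:[0,1]\to[0,A]$, $\tilde\sigma:[0,1]\to[0,B]$ with $\eta\circ\sigma=\tilde\eta\circ\tilde\sigma$. A continuous bounded-variation path $\gamma$ is tree-reduced if every restriction $\gamma|_{[s,t]}$ with trivial signature is constant. Signature tree: for an auxiliary Euclidean norm on $V$, let $\pi_N$ be truncation to tensor degrees $\le N$, $G_N(V)$ the free step-$N$ nilpotent group, and $d_N$ its left-invariant Carnot–Carathéodory metric ($d_N(x,y)$ is the infimum of Euclidean lengths of bounded-variation paths $\eta$ with $\pi_NS(\eta)=x^{-1}y$). Put $d_\infty(g,h)=\sup_{N\ge1}d_N(\pi_Ng,\pi_Nh)$. By Le Donne–Züst, $(\mathscr S(V),d_\infty)$ is a complete metric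 tree with left-invariant metric. Under (a), $\mathcal A$ is a closed convex geodesic line in this tree, so the metric projection of $1$ onto it exists and is unique. *)

theory Defs
  imports "HOL-Analysis.Analysis" "HOL-Algebra.Group"
begin

section \<open>Continuous paths of bounded variation\<close>

text \<open>
  A path on \<open>[a,b]\<close> is a function on the reals whose values outside \<open>[a,b]\<close> are ignored; the
  restriction of \<open>\<gamma>\<close> to a subinterval is again \<open>\<gamma>\<close>, with other endpoints.  Variation is taken with
  respect to an arbitrary norm \<open>E\<close>, since lengths are measured in an auxiliary Euclidean norm.
\<close>

definition variation_sums :: "('v::real_normed_vector \<Rightarrow> real) \<Rightarrow> real \<Rightarrow> real \<Rightarrow> (real \<Rightarrow> 'v) \<Rightarrow> real set"
  where "variation_sums E a b \<gamma> = (\<lambda>d. \<Sum>K\<in>d. E (\<gamma> (Sup K) - \<gamma> (Inf K))) ` {d. d division_of {a..b}}"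

definition path_length :: "('v::real_normed_vector \<Rightarrow> real) \<Rightarrow> real \<Rightarrow> real \<Rightarrow> (real \<Rightarrow> 'v) \<Rightarrow> real"
  where "path_length E a b \<gamma> = Sup (variation_sums E a b \<gamma>)"

definition bv_path :: "real \<Rightarrow> (real \<Rightarrow> 'v::real_normed_vector) \<Rightarrow> bool"
  where "bv_path A \<gamma> \<longleftrightarrow>
    0 \<le> A \<and> continuous_on {0..A} \<gamma> \<and> bdd_above (variation_sums norm 0 A \<gamma>)"

definition path_concat :: "real \<Rightarrow> (real \<Rightarrow> 'v::real_normed_vector) \<Rightarrow> (real \<Rightarrow> 'v) \<Rightarrow> real \<Rightarrow> 'v"
  where "path_concat A \<alpha> \<beta> t = (if t \<le> A then \<alpha> t else \<alpha> A + (\<beta> (t - A) - \<beta> 0))"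

definition path_reverse :: "real \<Rightarrow> (real \<Rightarrow> 'v::real_normed_vector) \<Rightarrow> real \<Rightarrow> 'v"
  where "path_reverse A \<alpha> s = \<alpha> (A - s) - \<alpha> A"

definition rep_equiv ::
    "real \<Rightarrow> (real \<Rightarrow> 'v::real_normed_vector) \<Rightarrow> real \<Rightarrow> (real \<Rightarrow> 'v) \<Rightarrow> bool"
  where "rep_equiv A \<eta> B \<eta>' \<longleftrightarrow>
    (\<exists>\<sigma> \<sigma>' :: real \<Rightarrow> real.
       continuous_on {0..1} \<sigma> \<and> mono_on {0..1} \<sigma> \<and> \<sigma> ` {0..1} = {0..A} \<and>
       continuous_on {0..1} \<sigma>' \<and> mono_on {0..1} \<sigma>' \<and> \<sigma>' ` {0..1} = {0..B} \<and>
       (\<forall>u\<in>{0..1}. \<eta> (\<sigma> u) = \<eta>' (\<sigma>' u)))"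


section \<open>Tensor series and signatures\<close>

text \<open>
  For finite-dimensional \<open>V\<close>, an element of \<open>V\<^sup>\<otimes>\<^sup>n\<close> is identified with the \<open>n\<close>-linear form it induces
  on the dual space, \<open>v\<^sub>1 \<otimes> \<dots> \<otimes> v\<^sub>n\<close> being sent to \<open>(\<phi>\<^sub>1,\<dots>,\<phi>\<^sub>n) \<mapsto> \<phi>\<^sub>1 v\<^sub>1 \<cdots> \<phi>\<^sub>n v\<^sub>n\<close>.  An element of
  the product of all \<open>V\<^sup>\<otimes>\<^sup>n\<close> is therefore a function on lists of functionals, whose degree \<open>n\<close>
  component is its restriction to lists of length \<open>n\<close>.
\<close>

type_synonym 'v tensor_series = "('v \<Rightarrow>\<^sub>L real) list \<Rightarrow> real"

definition tensor_one :: "'v::real_normed_vector tensor_series"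
  where "tensor_one \<phi>s = (if \<phi>s = [] then 1 else 0)"

definition tensor_mult ::
    "'v::real_normed_vector tensor_series \<Rightarrow> 'v tensor_series \<Rightarrow> 'v tensor_series"
  where "tensor_mult x y \<phi>s = (\<Sum>k\<le>length \<phi>s. x (take k \<phi>s) * y (drop k \<phi>s))"

definition tensor_exp :: "'v::real_normed_vector \<Rightarrow> 'v tensor_series"
  where "tensor_exp v \<phi>s = (\<Prod>\<phi>\<leftarrow>\<phi>s. blinfun_apply \<phi> v) / fact (length \<phi>s)"

text \<open>Riemann--Stieltjes integral of \<open>f\<close> with respect to \<open>h\<close>, as a limit of Riemann sums as the
  mesh tends to zero.\<close>

definition has_rs_integral ::
    "(real \<Rightarrow> real) \<Rightarrow> (real \<Rightarrow> real) \<Rightarrow> real \<Rightarrow> real \<Rightarrow> real \<Rightarrow> bool"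
  where "has_rs_integral f h a b I \<longleftrightarrow>
    (\<forall>e>0. \<exists>\<delta>>0. \<forall>p. p tagged_division_of {a..b} \<and> (\<lambda>x. ball x \<delta>) fine p \<longrightarrow>
       \<bar>(\<Sum>(x,K)\<in>p. f x * (h (Sup K) - h (Inf K))) - I\<bar> < e)"

definition rs_integral :: "(real \<Rightarrow> real) \<Rightarrow> (real \<Rightarrow> real) \<Rightarrow> real \<Rightarrow> real \<Rightarrow> real"
  where "rs_integral f h a b = (THE I. has_rs_integral f h a b I)"

text \<open>Signature of \<open>\<gamma>\<close> restricted to \<open>[a,b]\<close>: the integral over \<open>a < t\<^sub>1 < \<dots> < t\<^sub>n < b\<close> is evaluated
  as an iterated integral, the outermost variable being \<open>t\<^sub>1\<close>.\<close>

fun signature :: "real \<Rightarrow> real \<Rightarrow> (real \<Rightarrow> 'v::real_normed_vector) \<Rightarrow> 'v tensor_series"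
  where
    "signature a b \<gamma> [] = 1"
  | "signature a b \<gamma> (\<phi> # \<phi>s) =
       rs_integral (\<lambda>t. signature t b \<gamma> \<phi>s) (\<lambda>t. blinfun_apply \<phi> (\<gamma> t)) a b"

definition sig_group :: "'v::real_normed_vector tensor_series monoid"
  where "sig_group =
    \<lparr>carrier = {signature 0 A \<eta> |A \<eta>. bv_path A \<eta>}, mult = tensor_mult, one = tensor_one\<rparr>"

definition tree_reduced :: "real \<Rightarrow> (real \<Rightarrow> 'v::real_normed_vector) \<Rightarrow> bool"
  where "tree_reduced T \<gamma> \<longleftrightarrow>
    (\<forall>s t. 0 \<le> s \<and> s \<le> t \<and> t \<le> T \<and> signature s t \<gamma> = tensor_one \<longrightarrow> \<gamma> constant_on {s..t})"


section \<open>The signature tree\<close>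

definition euclidean_norm :: "('v::real_normed_vector \<Rightarrow> real) \<Rightarrow> bool"
  where "euclidean_norm E \<longleftrightarrow>
    (\<exists>B. bilinear B \<and> (\<forall>x y. B x y = B y x) \<and> (\<forall>x. x \<noteq> 0 \<longrightarrow> B x x > 0) \<and>
         (\<forall>x. E x = sqrt (B x x)))"

definition tensor_trunc :: "nat \<Rightarrow> 'v::real_normed_vector tensor_series \<Rightarrow> 'v tensor_series"
  where "tensor_trunc N x \<phi>s = (if length \<phi>s \<le> N then x \<phi>s else 0)"

text \<open>The free step-\<open>N\<close> nilpotent group, realised as the group of truncated signatures.\<close>

definition nilp_group :: "nat \<Rightarrow> 'v::real_normed_vector tensor_series monoid"
  where "nilp_group N =
    \<lparr>carrier = tensor_trunc N ` carrier sig_group,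
     mult = (\<lambda>x y. tensor_trunc N (tensor_mult x y)),
     one = tensor_one\<rparr>"

text \<open>The infimum and the supremum below are taken in the reals: on \<open>nilp_group N\<close> the set of lengths
  is nonempty, and for signatures \<open>g\<close>, \<open>h\<close> every \<open>cc_dist\<close> is at most the length of a path with
  signature \<open>g\<^sup>-\<^sup>1h\<close>.\<close>

definition cc_dist ::
    "('v::real_normed_vector \<Rightarrow> real) \<Rightarrow> nat \<Rightarrow> 'v tensor_series \<Rightarrow> 'v tensor_series \<Rightarrow> real"
  where "cc_dist E N x y =
    Inf {path_length E 0 A \<eta> |A \<eta>.
           bv_path A \<eta> \<and>
           tensor_trunc N (signature 0 A \<eta>) = inv\<^bsub>nilp_group N\<^esub> x \<otimes>\<^bsub>nilp_group N\<^esub> y}"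

definition sig_dist ::
    "('v::real_normed_vector \<Rightarrow> real) \<Rightarrow> 'v tensor_series \<Rightarrow> 'v tensor_series \<Rightarrow> real"
  where "sig_dist E g h = (SUP N\<in>{1..}. cc_dist E N (tensor_trunc N g) (tensor_trunc N h))"

definition sig_axis :: "'v::real_normed_vector tensor_series \<Rightarrow> 'v \<Rightarrow> 'v tensor_series set"
  where "sig_axis a v = {a \<otimes>\<^bsub>sig_group\<^esub> tensor_exp (t *\<^sub>R v) |t::real. True}"

text \<open>The set of all nearest points, so that \<open>metric_projection E x M = {p}\<close> expresses that the
  projection exists, is unique, and equals \<open>p\<close>.\<close>

definition metric_projection ::
    "('v::real_normed_vector \<Rightarrow> real) \<Rightarrow> 'v tensor_series \<Rightarrow> 'v tensor_series set \<Rightarrow> 'v tensor_series set"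
  where "metric_projection E x M = {p\<in>M. \<forall>q\<in>M. sig_dist E x p \<le> sig_dist E x q}"


section \<open>The palindromic form\<close>

text \<open>\<open>\<gamma>\<close> on \<open>[0,T]\<close> is, up to reparametrisation, \<open>\<beta> * \<lambda>\<^sub>v * reverse \<beta>\<close> for \<open>\<beta> = \<gamma>\<close> on \<open>[0,t\<^sub>0]\<close>.\<close>

definition palindromic_at :: "real \<Rightarrow> (real \<Rightarrow> 'v::real_normed_vector) \<Rightarrow> 'v \<Rightarrow> real \<Rightarrow> bool"
  where "palindromic_at T \<gamma> v t\<^sub>0 \<longleftrightarrow>
    rep_equiv T \<gamma> (t\<^sub>0 + 1 + t\<^sub>0)
      (path_concat (t\<^sub>0 + 1) (path_concat t\<^sub>0 \<gamma> (\<lambda>t. t *\<^sub>R v)) (path_reverse t\<^sub>0 \<gamma>))"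


section \<open>The degree-one component of the signature is the increment\<close>

lemma has_rs_integral_one:
  assumes "a \<le> b"
  shows "has_rs_integral (\<lambda>t. 1) h a b (h b - h a)"
proof -
  have "(\<Sum>(x,K)\<in>p. 1 * (h (Sup K) - h (Inf K))) = h b - h a" if "p tagged_division_of {a..b}" for p
    using additive_tagged_division_1[OF assms that, of h] by simp
  then show ?thesis
    unfolding has_rs_integral_def by (auto intro!: exI[of _ "1::real"])
qed

lemma has_rs_integral_unique:
  assumes "has_rs_integral f h a b I" "has_rs_integral f h a b J"
  shows "I = J"
proof (rule ccontr)
  assume "I \<noteq> J"
  then have e: "\<bar>I - J\<bar> / 2 > 0" by simp
  obtain d where d: "d > 0" "\<And>p. p tagged_division_of {a..b} \<and> (\<lambda>x. ball x d) fine p \<Longrightarrow>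
       \<bar>(\<Sum>(x,K)\<in>p. f x * (h (Sup K) - h (Inf K))) - I\<bar> < \<bar>I - J\<bar> / 2"
    using assms(1) e unfolding has_rs_integral_def by meson
  obtain d' where d': "d' > 0" "\<And>p. p tagged_division_of {a..b} \<and> (\<lambda>x. ball x d') fine p \<Longrightarrow>
       \<bar>(\<Sum>(x,K)\<in>p. f x * (h (Sup K) - h (Inf K))) - J\<bar> < \<bar>I - J\<bar> / 2"
    using assms(2) e unfolding has_rs_integral_def by meson
  have "gauge (\<lambda>x::real. ball x (min d d'))"
    using d(1) d'(1) by (intro gauge_ball) simp
  then obtain p where p: "p tagged_division_of {a..b}" "(\<lambda>x. ball x (min d d')) fine p"
    using fine_division_exists[of "\<lambda>x::real. ball x (min d d')" a b] by auto
  have "(\<lambda>x. ball x d) fine p" "(\<lambda>x. ball x d') fine p"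
    using p(2) by (auto simp: fine_def subset_iff)
  then have "\<bar>(\<Sum>(x,K)\<in>p. f x * (h (Sup K) - h (Inf K))) - I\<bar> < \<bar>I - J\<bar> / 2"
    "\<bar>(\<Sum>(x,K)\<in>p. f x * (h (Sup K) - h (Inf K))) - J\<bar> < \<bar>I - J\<bar> / 2"
    using p(1) d(2)[of p] d'(2)[of p] by blast+
  then show False by argo
qed

lemma signature_degree_one:
  assumes "a \<le> b"
  shows "signature a b \<gamma> [\<phi>] = blinfun_apply \<phi> (\<gamma> b - \<gamma> a)"
proof -
  have "rs_integral (\<lambda>t. 1) (\<lambda>t. blinfun_apply \<phi> (\<gamma> t)) a b = blinfun_apply \<phi> (\<gamma> b) - blinfun_apply \<phi> (\<gamma> a)"
    unfolding rs_integral_def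
    by (intro the_equality has_rs_integral_one[OF assms])
       (rule has_rs_integral_unique[OF _ has_rs_integral_one[OF assms]])
  then show ?thesis by (simp add: blinfun.diff_right)
qed

end

(*
  A linear functional of the signature, evaluated along the prefixes (or the tails) of a path, is a polynomial
  function of the point reached in the signature group; by the shuffle identity these functions form an
  algebra.  Integrating such a function f against d(phi o eta) gives again a functional of the signature,
  one with no constant term, so that the integral vanishes if eta is a loop, i.e. has trivial signature.
  By Stone--Weierstrass f may approximate the indicator of an arc that the rest of the loop does not meet,
  whence the end points of eta over this arc agree.  Everything follows from this:

  - if two paths have the same signature and one of them is tree-reduced, then the other one passes through all
    of its prefix signatures.  For two tree-reduced paths this makes the arc lengths correspond, and they are
    reparametrisations of each other;

  - let alpha be a path from 1 that meets the axis {p exp(tv)} only at its end point p.  The middle segment of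
    alpha * lambda_v * reverse(alpha) meets the two other pieces at its end points only, so the whole is
    tree-reduced if alpha is, and any path from 1 to p exp(v) p^-1 must run into the axis.  Applied to gamma, up
    to its first hit of the axis, uniqueness turns the conjugacy into the palindromic form;

  - the first hit p is the gate: a point p exp(tv) with nonzero t is the end point of the tree-reduced path
    alpha * lambda_tv, and d_infinity(1, .) is the length of a tree-reduced path.  The lower bound integrates
    a polynomial one-form of norm at most 1, which nearly norms the path, over any competitor with the same
    truncated signature.
*)
theory Submission
  imports Defs
begin

section \<open>Arc length with respect to a general norm\<close>

section \<open>Variation\<close>

text \<open>Paths of bounded variation need not be differentiable, so every integral is handled
  through a continuous strictly increasing control \<open>\<omega>\<close>: an antiderivative is a
  function whose increments on short intervals agree with those of the integral up to
  \<open>\<epsilon>\<close> times the increment of \<open>\<omega>\<close>. Product rule, uniqueness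
  and bounds then work as in calculus. The recursion of \<open>signature\<close> has the first
  variable outermost, so the differential equation lives in the left end point and functionals are
  evaluated along tails, although the geometry is about prefixes; cancellation in Chen's identity
  translates between the two. Signatures of reversed, reparametrised and straight paths are not
  integrated: a multiplicative family with the right growth is determined by its degree-one part
  (uniqueness in Lyons' extension theorem). Tensor series form an infinite product, so compactness
  comes from Tychonoff's theorem and a geometric bound on coordinates; this is why competing paths
  are limited in length before a polynomial one-form is chosen.\<close>

lemma sum_division_increments:
  fixes f :: "real \<Rightarrow> 'b::real_normed_vector"
  assumes "a \<le> b" "d division_of {a..b}"
  shows "(\<Sum>K\<in>d. f (Sup K) - f (Inf K)) = f b - f a"
proof -
  \<comment> \<open>Any tag would do; the left end point of each piece makes the telescoping
    identity for tagged divisions applicable.\<close>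
  let ?p = "(\<lambda>K. (Inf K, K)) ` d"
  have nb: "K \<noteq> {}" "\<exists>c e. K = {c..e}" if "K \<in> d" for K
    using division_ofD(3,4)[OF assms(2) that] by (auto simp: cbox_interval)
  have "?p tagged_division_of {a..b}"
    unfolding tagged_division_of
  proof (intro conjI allI impI)
    show "finite ?p" using assms(2) by auto
    show "\<Union> {K. \<exists>x. (x, K) \<in> ?p} = {a..b}"
      using division_ofD(6)[OF assms(2)] by (auto simp: image_iff)
  next
    fix x K assume "(x, K) \<in> ?p"
    then have K: "K \<in> d" "x = Inf K" by auto
    show "x \<in> K" using nb[OF K(1)] K(2) by auto
    show "K \<subseteq> {a..b}" using division_ofD(2)[OF assms(2) K(1)] .
    show "\<exists>a b. K = cbox a b" using division_ofD(4)[OF assms(2) K(1)] .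
  next
    fix x1 K1 x2 K2 assume h: "(x1, K1) \<in> ?p \<and> (x2, K2) \<in> ?p \<and> (x1, K1) \<noteq> (x2, K2)"
    then have "K1 \<in> d" "K2 \<in> d" "K1 \<noteq> K2" by auto
    then show "interior K1 \<inter> interior K2 = {}" using division_ofD(5)[OF assms(2)] by blast
  qed
  from additive_tagged_division_1[OF assms(1) this, of f]
  show ?thesis by (subst (asm) sum.reindex) (auto simp: inj_on_def)
qed

lemma division_interval_bounds:
  fixes K :: "real set"
  assumes "d division_of {a..b}" "K \<in> d"
  shows "a \<le> Inf K" "Inf K \<le> Sup K" "Sup K \<le> b" "K = {Inf K..Sup K}"
proof -
  obtain c e where K: "K = {c..e}" "c \<le> e"
    using division_ofD(3,4)[OF assms] by (auto simp: cbox_interval)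
  have "K \<subseteq> {a..b}" using division_ofD(2)[OF assms] .
  then show "a \<le> Inf K" "Inf K \<le> Sup K" "Sup K \<le> b" "K = {Inf K..Sup K}" using K by auto
qed

text \<open>Local to global: there is a tagged division into pieces shorter than
  \<open>\<delta>\<close>, over which the local inequality telescopes. The bounds for
  \<open>has_differential\<close> rest on this.\<close>

lemma increments_le_by_local:
  fixes D \<Omega> :: "real \<Rightarrow> real"
  assumes "a \<le> b" "\<delta> > 0"
    and loc: "\<And>s t. a \<le> s \<Longrightarrow> s \<le> t \<Longrightarrow> t \<le> b \<Longrightarrow> t - s < \<delta> \<Longrightarrow> D t - D s \<le> \<Omega> t - \<Omega> s"
  shows "D b - D a \<le> \<Omega> b - \<Omega> a"
proof -
  have "gauge (\<lambda>x::real. ball x (\<delta>/2))" using assms by (intro gauge_ball) simp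
  then obtain p where p: "p tagged_division_of {a..b}" "(\<lambda>x. ball x (\<delta>/2)) fine p"
    using fine_division_exists[of "\<lambda>x::real. ball x (\<delta>/2)" a b] by auto
  have "D (Sup K) - D (Inf K) \<le> \<Omega> (Sup K) - \<Omega> (Inf K)" if "(x,K) \<in> p" for x K
  proof -
    have "x \<in> K" "K \<subseteq> {a..b}" "\<exists>c e. K = cbox c e"
      using tagged_division_ofD(2,3,4)[OF p(1)] that by blast+
    then obtain c e where K: "K = {c..e}" "c \<le> e" "K \<subseteq> {a..b}"
      by (auto simp: cbox_interval)
    have "{c,e} \<subseteq> ball x (\<delta>/2)" using p(2) that K unfolding fine_def by fastforce
    then have "\<bar>x - c\<bar> < \<delta>/2" "\<bar>x - e\<bar> < \<delta>/2" by (auto simp: dist_real_def)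
    then have "e - c < \<delta>" by linarith
    then show ?thesis using loc[of c e] K by auto
  qed
  then have "(\<Sum>(x,K)\<in>p. D (Sup K) - D (Inf K)) \<le> (\<Sum>(x,K)\<in>p. \<Omega> (Sup K) - \<Omega> (Inf K))"
    by (intro sum_mono) auto
  then show ?thesis
    using additive_tagged_division_1[OF assms(1) p(1), of D] additive_tagged_division_1[OF assms(1) p(1), of \<Omega>]
    by simp
qed

text \<open>Lengths are needed for the given norm, in the uniqueness of tree-reduced paths, and for
  the auxiliary Euclidean norm, in the metric; this covers both.\<close>

definition norm_like :: "('v::real_vector \<Rightarrow> real) \<Rightarrow> bool"
  where "norm_like E \<longleftrightarrow> (\<forall>x y. E (x + y) \<le> E x + E y) \<and> (\<forall>c x. E (c *\<^sub>R x) = \<bar>c\<bar> * E x) \<and>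
    (\<forall>x. x \<noteq> 0 \<longrightarrow> 0 < E x)"

lemma norm_like_norm: "norm_like norm"
  by (auto simp: norm_like_def norm_triangle_ineq)

lemma norm_likeD:
  assumes "norm_like E"
  shows "E (x + y) \<le> E x + E y" "E (c *\<^sub>R x) = \<bar>c\<bar> * E x" "E 0 = 0" "0 \<le> E x" "x \<noteq> 0 \<Longrightarrow> 0 < E x"
    "E (- x) = E x" "E (x - y) = E (y - x)"
proof -
  show "E (x + y) \<le> E x + E y" "E (c *\<^sub>R x) = \<bar>c\<bar> * E x" "x \<noteq> 0 \<Longrightarrow> 0 < E x" for x y c
    using assms by (auto simp: norm_like_def)
  note h = this
  show z: "E 0 = 0" using h(2)[of 0 0] by simp
  show "0 \<le> E x" using h(3)[of x] z by (cases "x = 0") auto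
  show m: "E (- x) = E x" for x using h(2)[of "-1" x] by simp
  show "E (x - y) = E (y - x)" using m[of "x - y"] by simp
qed

text \<open>The bound by \<open>C\<close> transfers bounded variation from the norm to
  \<open>E\<close>. The sign of \<open>C\<close> is left open, so estimates pass to its absolute
  value.\<close>

locale length_bounded =
  fixes E :: "'v::real_normed_vector \<Rightarrow> real" and C :: real and A :: real and \<gamma> :: "real \<Rightarrow> 'v"
  assumes E: "norm_like E" and EC: "\<And>x. E x \<le> C * norm x" and path: "bv_path A \<gamma>"
begin

lemma A: "0 \<le> A" and continuous_path: "continuous_on {0..A} \<gamma>"
  using path by (auto simp: bv_path_def)

lemma bdd: assumes "0 \<le> t" "t \<le> A" shows "bdd_above (variation_sums E 0 t \<gamma>)"
proof -
  obtain M where M: "\<And>d. d division_of {0..A} \<Longrightarrow> (\<Sum>K\<in>d. norm (\<gamma> (Sup K) - \<gamma> (Inf K))) \<le> M"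
    using path by (auto simp: bv_path_def variation_sums_def bdd_above_def)
  have "(\<Sum>K\<in>d. E (\<gamma> (Sup K) - \<gamma> (Inf K))) \<le> \<bar>C\<bar> * M" if d: "d division_of {0..t}" for d
  proof -
    have fin: "finite d" using d by auto
    obtain d' where d': "d' division_of {0..A}" "d \<subseteq> d'"
      using partial_division_extend_interval[of d 0 A] d assms
      by (metis atLeastatMost_subset_iff cbox_interval division_ofD(6) division_of_union_self order_refl)
    have fin': "finite d'" using d' by auto
    have "(\<Sum>K\<in>d. E (\<gamma> (Sup K) - \<gamma> (Inf K))) \<le> (\<Sum>K\<in>d. \<bar>C\<bar> * norm (\<gamma> (Sup K) - \<gamma> (Inf K)))"
      by (intro sum_mono order_trans[OF EC] mult_right_mono) auto
    also have "\<dots> \<le> (\<Sum>K\<in>d'. \<bar>C\<bar> * norm (\<gamma> (Sup K) - \<gamma> (Inf K)))"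
      by (intro sum_mono2 fin' d') auto
    also have "\<dots> \<le> \<bar>C\<bar> * M"
      unfolding sum_distrib_left[symmetric] by (intro mult_left_mono M d') auto
    finally show ?thesis .
  qed
  then show ?thesis unfolding variation_sums_def bdd_above_def by blast
qed

lemma sum_le_length:
  assumes "0 \<le> t" "t \<le> A" "d division_of {0..t}"
  shows "(\<Sum>K\<in>d. E (\<gamma> (Sup K) - \<gamma> (Inf K))) \<le> path_length E 0 t \<gamma>"
  unfolding path_length_def
  by (intro cSup_upper bdd assms) (use assms in \<open>auto simp: variation_sums_def\<close>)

lemma nonempty: assumes "0 \<le> t" shows "variation_sums E 0 t \<gamma> \<noteq> {}"
proof -
  have "{{0..t}} division_of {0..t}" using division_of_self[of 0 t] assms by simp
  then show ?thesis unfolding variation_sums_def by blast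
qed

lemma length_leI:
  assumes "0 \<le> t" "\<And>d. d division_of {0..t} \<Longrightarrow> (\<Sum>K\<in>d. E (\<gamma> (Sup K) - \<gamma> (Inf K))) \<le> M"
  shows "path_length E 0 t \<gamma> \<le> M"
  unfolding path_length_def
  by (intro cSup_least nonempty assms) (use assms in \<open>auto simp: variation_sums_def\<close>)

lemma length_nonneg: assumes "0 \<le> t" "t \<le> A" shows "0 \<le> path_length E 0 t \<gamma>"
proof -
  have "{{0..t}} division_of {0..t}" using division_of_self[of 0 t] assms by simp
  from sum_le_length[OF assms this] show ?thesis using norm_likeD(4)[OF E] by (meson order_trans sum_nonneg)
qed

lemma length_increment:
  assumes "0 \<le> s" "s \<le> t" "t \<le> A"
  shows "E (\<gamma> t - \<gamma> s) \<le> path_length E 0 t \<gamma> - path_length E 0 s \<gamma>"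
proof (cases "s = t")
  case True then show ?thesis using norm_likeD(3)[OF E] by simp
next
  case False
  then have st: "s < t" using assms by simp
  have "path_length E 0 s \<gamma> \<le> path_length E 0 t \<gamma> - E (\<gamma> t - \<gamma> s)"
  proof (rule length_leI)
    fix d assume d: "d division_of {0..s}"
    have "{{s..t}} division_of {s..t}" using division_of_self[of s t] assms by simp
    then have "d \<union> {{s..t}} division_of {0..s} \<union> {s..t}"
      by (intro division_disjoint_union d) (auto simp: interior_atLeastAtMost_real)
    then have D: "d \<union> {{s..t}} division_of {0..t}" using assms by (simp add: ivl_disj_un)
    \<comment> \<open>Needed to split the sum over the union. It can fail only for a degenerate
      interval, which is why \<open>s = t\<close> was treated apart.\<close>
    have "{s..t} \<notin> d"
    proof
      assume "{s..t} \<in> d"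
      then have "{s..t} \<subseteq> {0..s}" using division_ofD(2)[OF d] by blast
      then show False using st by auto
    qed
    then show "(\<Sum>K\<in>d. E (\<gamma> (Sup K) - \<gamma> (Inf K))) \<le> path_length E 0 t \<gamma> - E (\<gamma> t - \<gamma> s)"
      using sum_le_length[OF _ _ D] assms division_of_finite[OF d] st by simp
  qed (use assms in simp)
  then show ?thesis by simp
qed

lemma length_mono:
  assumes "0 \<le> s" "s \<le> t" "t \<le> A"
  shows "path_length E 0 s \<gamma> \<le> path_length E 0 t \<gamma>"
  using length_increment[OF assms] norm_likeD(4)[OF E, of "\<gamma> t - \<gamma> s"] by simp

lemma continuous_E: "continuous_on S E"
proof -
  have "\<bar>E x - E y\<bar> \<le> C * norm (x - y)" for x y
    using norm_likeD(1)[OF E, of "x - y" y] norm_likeD(1)[OF E, of "y - x" x] norm_likeD(7)[OF E, of x y]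
      EC[of "x - y"] by simp
  then have "\<bar>E x - E y\<bar> \<le> \<bar>C\<bar> * norm (x - y)" for x y
    by (meson abs_ge_self dual_order.trans mult_right_mono norm_ge_zero)
  then have "lipschitz_on \<bar>C\<bar> S E"
    by (intro lipschitz_onI) (auto simp: dist_norm)
  then show ?thesis by (rule lipschitz_on_continuous_on)
qed

text \<open>The sum \<open>P t\<close> of a division nearly realising the length, stopped at \<open>t\<close>, is a minorant of the
  length up to \<open>t\<close>; as the sum over the stopped complement is one for the rest, \<open>P\<close> is uniformly close.\<close>

lemma length_approx:
  assumes "e > 0"
  obtains d where "d division_of {0..A}"
    "\<And>t. t \<in> {0..A} \<Longrightarrow>
      \<bar>path_length E 0 t \<gamma> - (\<Sum>K\<in>d. E (\<gamma> (min (Sup K) t) - \<gamma> (min (Inf K) t)))\<bar> \<le> e"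
proof -
  let ?W = "\<lambda>t. path_length E 0 t \<gamma>"
  have W0: "?W A - e < Sup (variation_sums E 0 A \<gamma>)" using assms by (simp add: path_length_def)
  obtain y where "y \<in> variation_sums E 0 A \<gamma>" "?W A - e < y"
    using less_cSupD[OF nonempty[OF A] W0] by blast
  then obtain d where d: "d division_of {0..A}" "?W A - e < (\<Sum>K\<in>d. E (\<gamma> (Sup K) - \<gamma> (Inf K)))"
    by (auto simp: variation_sums_def)
  note b = division_interval_bounds[OF d(1)]
  show ?thesis
  proof (rule that[OF d(1)])
    fix t assume t: "t \<in> {0..A}"
    define P where "P = (\<Sum>K\<in>d. E (\<gamma> (min (Sup K) t) - \<gamma> (min (Inf K) t)))"
    define Q where "Q = (\<Sum>K\<in>d. E (\<gamma> (max (Sup K) t) - \<gamma> (max (Inf K) t)))"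
    have "P \<le> (\<Sum>K\<in>d. ?W (min (Sup K) t) - ?W (min (Inf K) t))"
      unfolding P_def by (intro sum_mono length_increment) (use b t in \<open>auto simp: min_def\<close>, (meson order_trans)+)
    also have "\<dots> = ?W t - ?W 0"
      using sum_division_increments[OF A d(1), of "\<lambda>u. ?W (min u t)"] t by simp
    also have "\<dots> \<le> ?W t" using length_nonneg[of 0] A by simp
    finally have P: "P \<le> ?W t" .
    have "Q \<le> (\<Sum>K\<in>d. ?W (max (Sup K) t) - ?W (max (Inf K) t))"
      unfolding Q_def by (intro sum_mono length_increment) (use b t in \<open>auto simp: max_def\<close>, (meson order_trans)+)
    also have "\<dots> = ?W A - ?W t"
      using sum_division_increments[OF A d(1), of "\<lambda>u. ?W (max u t)"] t by (simp add: max_absorb1 max_absorb2)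
    finally have Q: "Q \<le> ?W A - ?W t" .
    \<comment> \<open>Only a piece with \<open>t\<close> inside is affected by stopping, and the
      triangle inequality splits it at \<open>t\<close>; any other piece contributes to just one of
      the two sums.\<close>
    have "(\<Sum>K\<in>d. E (\<gamma> (Sup K) - \<gamma> (Inf K))) \<le> P + Q"
      unfolding P_def Q_def sum.distrib[symmetric]
    proof (rule sum_mono)
      fix K assume "K \<in> d"
      have "E (\<gamma> (Sup K) - \<gamma> (Inf K)) \<le> E (\<gamma> (Sup K) - \<gamma> t) + E (\<gamma> t - \<gamma> (Inf K))"
        using norm_likeD(1)[OF E, of "\<gamma> (Sup K) - \<gamma> t" "\<gamma> t - \<gamma> (Inf K)"] by simp
      then show "E (\<gamma> (Sup K) - \<gamma> (Inf K)) \<le> E (\<gamma> (min (Sup K) t) - \<gamma> (min (Inf K) t)) +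
          E (\<gamma> (max (Sup K) t) - \<gamma> (max (Inf K) t))"
        using b(2)[OF \<open>K \<in> d\<close>] norm_likeD(3)[OF E] by (auto simp: min_def max_def)
    qed
    then show "\<bar>path_length E 0 t \<gamma> - (\<Sum>K\<in>d. E (\<gamma> (min (Sup K) t) - \<gamma> (min (Inf K) t)))\<bar> \<le> e"
      using P Q d(2) unfolding P_def[symmetric] by simp
  qed
qed

text \<open>The stopped sums of \<open>length_approx\<close> are continuous in \<open>t\<close> and
  uniformly close to the length, which is therefore a uniform limit of continuous functions.\<close>

lemma continuous_length: "continuous_on {0..A} (\<lambda>t. path_length E 0 t \<gamma>)"
  unfolding continuous_on_iff
proof (intro ballI allI impI)
  fix x e :: real assume x: "x \<in> {0..A}" and e: "0 < e"
  obtain d where d: "d division_of {0..A}"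
    "\<And>t. t \<in> {0..A} \<Longrightarrow> \<bar>path_length E 0 t \<gamma> - (\<Sum>K\<in>d. E (\<gamma> (min (Sup K) t) - \<gamma> (min (Inf K) t)))\<bar> \<le> e/3"
    using length_approx[of "e/3"] e by auto
  note b = division_interval_bounds[OF d(1)]
  have "continuous_on {0..A} (\<lambda>t. \<Sum>K\<in>d. E (\<gamma> (min (Sup K) t) - \<gamma> (min (Inf K) t)))"
  proof (intro continuous_on_sum)
    fix K assume K: "K \<in> d"
    have m: "continuous_on {0..A} (\<lambda>t. \<gamma> (min c t))" if "0 \<le> c" for c
      by (rule continuous_on_compose2[OF continuous_path]) (use that in \<open>auto intro!: continuous_intros\<close>)
    have "0 \<le> Inf K" "0 \<le> Sup K" using b[OF K] by auto
    then show "continuous_on {0..A} (\<lambda>t. E (\<gamma> (min (Sup K) t) - \<gamma> (min (Inf K) t)))"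
      by (intro continuous_on_compose2[OF continuous_E[of UNIV]] continuous_on_diff m) auto
  qed
  moreover have "e / 3 > 0" using e by simp
  ultimately obtain r where r: "r > 0" "\<And>y. y \<in> {0..A} \<Longrightarrow> dist y x < r \<Longrightarrow>
     dist (\<Sum>K\<in>d. E (\<gamma> (min (Sup K) y) - \<gamma> (min (Inf K) y))) (\<Sum>K\<in>d. E (\<gamma> (min (Sup K) x) - \<gamma> (min (Inf K) x))) < e/3"
    using x unfolding continuous_on_iff by blast
  show "\<exists>r>0. \<forall>y\<in>{0..A}. dist y x < r \<longrightarrow> dist (path_length E 0 y \<gamma>) (path_length E 0 x \<gamma>) < e"
  proof (intro exI[of _ r] conjI r(1) ballI impI)
    fix y assume y: "y \<in> {0..A}" "dist y x < r"
    show "dist (path_length E 0 y \<gamma>) (path_length E 0 x \<gamma>) < e"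
      using r(2)[OF y] d(2)[OF y(1)] d(2)[OF x] unfolding dist_real_def by argo
  qed
qed

lemma length_eq_if_constant:
  assumes "0 \<le> s" "s \<le> t" "t \<le> A" "\<gamma> constant_on {s..t}"
  shows "path_length E 0 s \<gamma> = path_length E 0 t \<gamma>"
proof -
  have "\<bar>path_length E 0 s \<gamma> - path_length E 0 t \<gamma>\<bar> \<le> 0 + e" if e: "e > 0" for e
  proof -
    obtain d where d: "d division_of {0..A}"
      "\<And>t. t \<in> {0..A} \<Longrightarrow> \<bar>path_length E 0 t \<gamma> - (\<Sum>K\<in>d. E (\<gamma> (min (Sup K) t) - \<gamma> (min (Inf K) t)))\<bar> \<le> e/2"
      using length_approx[of "e/2"] e by auto
    obtain c where c: "\<And>u. s \<le> u \<Longrightarrow> u \<le> t \<Longrightarrow> \<gamma> u = c"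
      using assms(4) by (auto simp: constant_on_def)
    \<comment> \<open>Stopping at \<open>s\<close> or at \<open>t\<close> gives the same sums,
      because the path rests in between.\<close>
    have "\<gamma> (min x s) = \<gamma> (min x t)" for x
      using c[of x] c[of s] c[of t] assms by (auto simp: min_def)
    then show ?thesis using d(2)[of s] d(2)[of t] assms(1,2,3) unfolding abs_le_iff by simp
  qed
  then have "\<bar>path_length E 0 s \<gamma> - path_length E 0 t \<gamma>\<bar> \<le> 0" by (rule field_le_epsilon)
  then show ?thesis by simp
qed

end

section \<open>Paths dominated by a continuous strictly increasing control\<close>

definition controlled :: "real \<Rightarrow> real \<Rightarrow> (real \<Rightarrow> real) \<Rightarrow> (real \<Rightarrow> 'v::real_normed_vector) \<Rightarrow> bool"
  where "controlled a b \<omega> \<gamma> \<longleftrightarrow> continuous_on {a..b} \<omega> \<and> strict_mono_on {a..b} \<omega> \<and>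
    (\<forall>s t. a \<le> s \<and> s \<le> t \<and> t \<le> b \<longrightarrow> norm (\<gamma> t - \<gamma> s) \<le> \<omega> t - \<omega> s)"

lemma controlled_subinterval:
  assumes "controlled a b \<omega> \<gamma>" "a \<le> c" "d \<le> b"
  shows "controlled c d \<omega> \<gamma>"
proof -
  have "{c..d} \<subseteq> {a..b}" using assms by auto
  then show ?thesis using assms unfolding controlled_def
    by (meson continuous_on_subset order_trans monotone_on_subset)
qed

lemma controlled_mono:
  assumes "controlled a b \<omega> \<gamma>" "a \<le> s" "s \<le> t" "t \<le> b"
  shows "\<omega> s \<le> \<omega> t"
  using assms unfolding controlled_def by (meson diff_ge_0_iff_ge norm_ge_zero order_trans)

lemma controlled_increment:
  assumes "controlled a b \<omega> \<gamma>" "a \<le> s" "s \<le> t" "t \<le> b"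
  shows "norm (\<gamma> t - \<gamma> s) \<le> \<omega> t - \<omega> s"
  using assms unfolding controlled_def by blast

lemma controlled_imp_continuous:
  assumes "controlled a b \<omega> \<gamma>"
  shows "continuous_on {a..b} \<gamma>"
  unfolding continuous_on_iff
proof (intro ballI allI impI)
  fix x e :: real assume x: "x \<in> {a..b}" and e: "0 < e"
  have "continuous_on {a..b} \<omega>" using assms by (simp add: controlled_def)
  then obtain r where r: "r > 0" "\<And>y. y \<in> {a..b} \<Longrightarrow> dist y x < r \<Longrightarrow> dist (\<omega> y) (\<omega> x) < e"
    using x e unfolding continuous_on_iff by meson
  have "dist (\<gamma> y) (\<gamma> x) < e" if y: "y \<in> {a..b}" "dist y x < r" for y
    using r(2)[OF y] controlled_increment[OF assms, of x y] controlled_increment[OF assms, of y x] x y(1)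
    by (cases "x \<le> y") (auto simp: dist_norm norm_minus_commute)
  then show "\<exists>r>0. \<forall>y\<in>{a..b}. dist y x < r \<longrightarrow> dist (\<gamma> y) (\<gamma> x) < e" using r(1) by blast
qed

lemma bv_path_iff_controlled: "bv_path A \<gamma> \<longleftrightarrow> 0 \<le> A \<and> (\<exists>\<omega>. controlled 0 A \<omega> \<gamma>)"
proof
  assume p: "bv_path A \<gamma>"
  interpret length_bounded norm 1 A \<gamma> by unfold_locales (use p norm_like_norm in auto)
  \<comment> \<open>The summand \<open>t\<close> makes the arc length strictly increasing also where
    the path rests.\<close>
  have "controlled 0 A (\<lambda>t. path_length norm 0 t \<gamma> + t) \<gamma>"
    unfolding controlled_def
  proof (intro conjI allI impI strict_mono_onI)
    show "continuous_on {0..A} (\<lambda>t. path_length norm 0 t \<gamma> + t)"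
      by (intro continuous_intros continuous_length)
  next
    fix r s assume "r \<in> {0..A}" "s \<in> {0..A}" "r < s"
    then show "path_length norm 0 r \<gamma> + r < path_length norm 0 s \<gamma> + s" using length_mono[of r s] by simp
  next
    fix s t assume "0 \<le> s \<and> s \<le> t \<and> t \<le> A"
    then show "norm (\<gamma> t - \<gamma> s) \<le> path_length norm 0 t \<gamma> + t - (path_length norm 0 s \<gamma> + s)"
      using length_increment[of s t] by simp
  qed
  then show "0 \<le> A \<and> (\<exists>\<omega>. controlled 0 A \<omega> \<gamma>)" using A by blast
next
  assume "0 \<le> A \<and> (\<exists>\<omega>. controlled 0 A \<omega> \<gamma>)"
  then obtain \<omega> where A: "0 \<le> A" and c: "controlled 0 A \<omega> \<gamma>" by blast
  have "(\<Sum>K\<in>d. norm (\<gamma> (Sup K) - \<gamma> (Inf K))) \<le> \<omega> A - \<omega> 0" if d: "d division_of {0..A}" for d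
    unfolding sum_division_increments[OF A d, symmetric]
    by (intro sum_mono controlled_increment[OF c] division_interval_bounds[OF d])
  then show "bv_path A \<gamma>"
    unfolding bv_path_def variation_sums_def bdd_above_def using A controlled_imp_continuous[OF c] by blast
qed

section \<open>Riemann--Stieltjes integrals\<close>

text \<open>Continuity makes increments over short intervals small; strictness makes
  \<open>\<omega>\<close> invertible, so that it can serve as a new variable of integration.\<close>

definition control :: "real \<Rightarrow> real \<Rightarrow> (real \<Rightarrow> real) \<Rightarrow> bool"
  where "control a b \<omega> \<longleftrightarrow> continuous_on {a..b} \<omega> \<and> strict_mono_on {a..b} \<omega>"

lemma controlD:
  assumes "control a b \<omega>"
  shows "continuous_on {a..b} \<omega>" "a \<le> s \<Longrightarrow> s < t \<Longrightarrow> t \<le> b \<Longrightarrow> \<omega> s < \<omega> t"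
    "a \<le> s \<Longrightarrow> s \<le> t \<Longrightarrow> t \<le> b \<Longrightarrow> \<omega> s \<le> \<omega> t"
proof -
  show "continuous_on {a..b} \<omega>" using assms by (simp add: control_def)
  show st: "\<omega> s < \<omega> t" if "a \<le> s" "s < t" "t \<le> b" for s t
    using assms that strict_mono_onD[of "{a..b}" \<omega> s t] by (simp add: control_def)
  show "a \<le> s \<Longrightarrow> s \<le> t \<Longrightarrow> t \<le> b \<Longrightarrow> \<omega> s \<le> \<omega> t"
    using st[of s t] by (cases "s = t") auto
qed

lemma control_subinterval: "control a b \<omega> \<Longrightarrow> a \<le> c \<Longrightarrow> d \<le> b \<Longrightarrow> control c d \<omega>"
  unfolding control_def by (meson atLeastatMost_subset_iff continuous_on_subset monotone_on_subset)

lemma controlled_imp_control: "controlled a b \<omega> \<gamma> \<Longrightarrow> control a b \<omega>"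
  by (simp add: controlled_def control_def)

lemma control_uniform:
  assumes "control a b \<omega>" "e > 0"
  obtains \<delta> where "\<delta> > 0" "\<And>s t. a \<le> s \<Longrightarrow> s \<le> t \<Longrightarrow> t \<le> b \<Longrightarrow> t - s < \<delta> \<Longrightarrow> \<omega> t - \<omega> s < e"
proof -
  have "uniformly_continuous_on {a..b} \<omega>"
    by (rule compact_uniformly_continuous[OF controlD(1)[OF assms(1)]]) simp
  then obtain d where d: "d > 0" "\<And>x y. x \<in> {a..b} \<Longrightarrow> y \<in> {a..b} \<Longrightarrow> dist y x < d \<Longrightarrow> dist (\<omega> y) (\<omega> x) < e"
    using assms(2) unfolding uniformly_continuous_on_def by meson
  show ?thesis
  proof (rule that[OF d(1)])
    fix s t assume "a \<le> s" "s \<le> t" "t \<le> b" "t - s < d"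
    then show "\<omega> t - \<omega> s < e" using d(2)[of s t] by (auto simp: dist_real_def)
  qed
qed

text \<open>For \<open>L x s t = f x (h t - h s)\<close> this makes \<open>F\<close> an indefinite Riemann--Stieltjes integral of \<open>f\<close>
  with respect to \<open>h\<close>, in a form that needs no divisions.\<close>

definition has_differential ::
    "real \<Rightarrow> real \<Rightarrow> (real \<Rightarrow> real) \<Rightarrow> (real \<Rightarrow> real \<Rightarrow> real \<Rightarrow> real) \<Rightarrow> (real \<Rightarrow> real) \<Rightarrow> bool"
  where "has_differential a b \<omega> L F \<longleftrightarrow> (\<forall>\<epsilon>>0. \<exists>\<delta>>0. \<forall>s x t.
    a \<le> s \<and> s \<le> x \<and> x \<le> t \<and> t \<le> b \<and> t - s < \<delta> \<longrightarrow> \<bar>F t - F s - L x s t\<bar> \<le> \<epsilon> * (\<omega> t - \<omega> s))"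

lemma has_differentialE:
  assumes "has_differential a b \<omega> L F" "\<epsilon> > 0"
  obtains \<delta> where "\<delta> > 0" "\<And>s x t. a \<le> s \<Longrightarrow> s \<le> x \<Longrightarrow> x \<le> t \<Longrightarrow> t \<le> b \<Longrightarrow> t - s < \<delta> \<Longrightarrow>
    \<bar>F t - F s - L x s t\<bar> \<le> \<epsilon> * (\<omega> t - \<omega> s)"
  using assms unfolding has_differential_def by meson

text \<open>Lets a constant \<open>K\<close> accumulate in an estimate. The rescaling uses
  \<open>K + 1\<close>, so that \<open>K = 0\<close> is covered.\<close>

lemma has_differentialI:
  assumes "K \<ge> 0" "\<And>\<epsilon>. \<epsilon> > 0 \<Longrightarrow> \<exists>\<delta>>0. \<forall>s x t. a \<le> s \<longrightarrow> s \<le> x \<longrightarrow> x \<le> t \<longrightarrow> t \<le> b \<longrightarrow> t - s < \<delta> \<longrightarrow>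
      \<bar>F t - F s - L x s t\<bar> \<le> \<epsilon> * (K * (\<omega> t - \<omega> s))"
    and "control a b \<omega>"
  shows "has_differential a b \<omega> L F"
  unfolding has_differential_def
proof (intro allI impI)
  fix \<epsilon> :: real assume e: "\<epsilon> > 0"
  then have "\<epsilon> / (K + 1) > 0" using assms(1) by simp
  from assms(2)[OF this] obtain \<delta> where d: "\<delta> > 0" "\<And>s x t. a \<le> s \<Longrightarrow> s \<le> x \<Longrightarrow> x \<le> t \<Longrightarrow> t \<le> b \<Longrightarrow> t - s < \<delta> \<Longrightarrow>
      \<bar>F t - F s - L x s t\<bar> \<le> \<epsilon> / (K + 1) * (K * (\<omega> t - \<omega> s))" by blast
  show "\<exists>\<delta>>0. \<forall>s x t. a \<le> s \<and> s \<le> x \<and> x \<le> t \<and> t \<le> b \<and> t - s < \<delta> \<longrightarrow> \<bar>F t - F s - L x s t\<bar> \<le> \<epsilon> * (\<omega> t - \<omega> s)"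
  proof (intro exI[of _ \<delta>] conjI d(1) allI impI)
    fix s x t assume h: "a \<le> s \<and> s \<le> x \<and> x \<le> t \<and> t \<le> b \<and> t - s < \<delta>"
    then have w: "\<omega> t - \<omega> s \<ge> 0" using controlD(3)[OF assms(3), of s t] by simp
    have "\<epsilon> / (K + 1) * K \<le> \<epsilon>" using e assms(1) by (simp add: field_simps)
    then have "\<epsilon> / (K + 1) * K * (\<omega> t - \<omega> s) \<le> \<epsilon> * (\<omega> t - \<omega> s)" using w by (rule mult_right_mono)
    then show "\<bar>F t - F s - L x s t\<bar> \<le> \<epsilon> * (\<omega> t - \<omega> s)"
      using d(2)[of s x t] h by (simp add: mult.assoc)
  qed
qed

lemma has_differential_subinterval:
  assumes "has_differential a b \<omega> L F" "a \<le> c" "d \<le> b"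
  shows "has_differential c d \<omega> L F"
  unfolding has_differential_def
proof (intro allI impI)
  fix \<epsilon> :: real assume "\<epsilon> > 0"
  with assms(1) obtain \<delta> where d: "\<delta> > 0" "\<And>s x t. a \<le> s \<Longrightarrow> s \<le> x \<Longrightarrow> x \<le> t \<Longrightarrow> t \<le> b \<Longrightarrow> t - s < \<delta> \<Longrightarrow>
    \<bar>F t - F s - L x s t\<bar> \<le> \<epsilon> * (\<omega> t - \<omega> s)" using has_differentialE by blast
  then show "\<exists>\<delta>>0. \<forall>s x t. c \<le> s \<and> s \<le> x \<and> x \<le> t \<and> t \<le> d \<and> t - s < \<delta> \<longrightarrow> \<bar>F t - F s - L x s t\<bar> \<le> \<epsilon> * (\<omega> t - \<omega> s)"
    using assms(2,3) by (intro exI[of _ \<delta>]) auto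
qed

lemma has_differential_cong:
  assumes "has_differential a b \<omega> L F" "\<And>s x t. a \<le> s \<Longrightarrow> s \<le> x \<Longrightarrow> x \<le> t \<Longrightarrow> t \<le> b \<Longrightarrow>  L x s t = L' x s t"
    "\<And>s t. a \<le> s \<Longrightarrow> s \<le> t \<Longrightarrow> t \<le> b \<Longrightarrow> F t - F s = F' t - F' s"
  shows "has_differential a b \<omega> L' F'"
proof -
  have "\<bar>F' t - F' s - L' x s t\<bar> = \<bar>F t - F s - L x s t\<bar>" if "a \<le> s" "s \<le> x" "x \<le> t" "t \<le> b" for s x t
    using assms(2)[OF that] assms(3)[of s t] that by simp
  then have "(\<forall>s x t. a \<le> s \<and> s \<le> x \<and> x \<le> t \<and> t \<le> b \<and> t - s < \<delta> \<longrightarrow> \<bar>F' t - F' s - L' x s t\<bar> \<le> c * (\<omega> t - \<omega> s)) \<longleftrightarrow>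
      (\<forall>s x t. a \<le> s \<and> s \<le> x \<and> x \<le> t \<and> t \<le> b \<and> t - s < \<delta> \<longrightarrow> \<bar>F t - F s - L x s t\<bar> \<le> c * (\<omega> t - \<omega> s))" for c \<delta>
    by auto
  then show ?thesis using assms(1) unfolding has_differential_def by simp
qed

lemma has_differential_add:
  assumes "has_differential a b \<omega> L F" "has_differential a b \<omega> L' F'" "control a b \<omega>"
  shows "has_differential a b \<omega> (\<lambda>x s t. L x s t + L' x s t) (\<lambda>t. F t + F' t)"
proof (rule has_differentialI[of 2])
  fix \<epsilon> :: real assume e: "\<epsilon> > 0"
  obtain d where d: "d > 0" "\<And>s x t. a \<le> s \<Longrightarrow> s \<le> x \<Longrightarrow> x \<le> t \<Longrightarrow> t \<le> b \<Longrightarrow> t - s < d \<Longrightarrow>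
    \<bar>F t - F s - L x s t\<bar> \<le> \<epsilon> * (\<omega> t - \<omega> s)" using has_differentialE[OF assms(1) e] by blast
  obtain d' where d': "d' > 0" "\<And>s x t. a \<le> s \<Longrightarrow> s \<le> x \<Longrightarrow> x \<le> t \<Longrightarrow> t \<le> b \<Longrightarrow> t - s < d' \<Longrightarrow>
    \<bar>F' t - F' s - L' x s t\<bar> \<le> \<epsilon> * (\<omega> t - \<omega> s)" using has_differentialE[OF assms(2) e] by blast
  show "\<exists>\<delta>>0. \<forall>s x t. a \<le> s \<longrightarrow> s \<le> x \<longrightarrow> x \<le> t \<longrightarrow> t \<le> b \<longrightarrow> t - s < \<delta> \<longrightarrow>
      \<bar>F t + F' t - (F s + F' s) - (L x s t + L' x s t)\<bar> \<le> \<epsilon> * (2 * (\<omega> t - \<omega> s))"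
  proof (intro exI[of _ "min d d'"] conjI allI impI)
    show "0 < min d d'" using d(1) d'(1) by simp
    fix s x t assume h: "a \<le> s" "s \<le> x" "x \<le> t" "t \<le> b" "t - s < min d d'"
    have "\<bar>F t + F' t - (F s + F' s) - (L x s t + L' x s t)\<bar> \<le> \<bar>F t - F s - L x s t\<bar> + \<bar>F' t - F' s - L' x s t\<bar>"
      by arith
    then show "\<bar>F t + F' t - (F s + F' s) - (L x s t + L' x s t)\<bar> \<le> \<epsilon> * (2 * (\<omega> t - \<omega> s))"
      using d(2)[OF h(1-4)] d'(2)[OF h(1-4)] h(5) by (simp add: algebra_simps)
  qed
qed (use assms in auto)

lemma has_differential_cmult:
  assumes "has_differential a b \<omega> L F" "control a b \<omega>"
  shows "has_differential a b \<omega> (\<lambda>x s t. c * L x s t) (\<lambda>t. c * F t)"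
proof (rule has_differentialI[of "\<bar>c\<bar>"])
  fix \<epsilon> :: real assume e: "\<epsilon> > 0"
  obtain d where d: "d > 0" "\<And>s x t. a \<le> s \<Longrightarrow> s \<le> x \<Longrightarrow> x \<le> t \<Longrightarrow> t \<le> b \<Longrightarrow> t - s < d \<Longrightarrow>
    \<bar>F t - F s - L x s t\<bar> \<le> \<epsilon> * (\<omega> t - \<omega> s)" using has_differentialE[OF assms(1) e] by blast
  show "\<exists>\<delta>>0. \<forall>s x t. a \<le> s \<longrightarrow> s \<le> x \<longrightarrow> x \<le> t \<longrightarrow> t \<le> b \<longrightarrow> t - s < \<delta> \<longrightarrow>
      \<bar>c * F t - c * F s - c * L x s t\<bar> \<le> \<epsilon> * (\<bar>c\<bar> * (\<omega> t - \<omega> s))"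
  proof (intro exI[of _ d] conjI allI impI d(1))
    fix s x t assume h: "a \<le> s" "s \<le> x" "x \<le> t" "t \<le> b" "t - s < d"
    have "\<bar>c * F t - c * F s - c * L x s t\<bar> = \<bar>c\<bar> * \<bar>F t - F s - L x s t\<bar>"
      by (simp add: abs_mult[symmetric] algebra_simps)
    also have "\<dots> \<le> \<bar>c\<bar> * (\<epsilon> * (\<omega> t - \<omega> s))" by (intro mult_left_mono d(2) h) auto
    finally show "\<bar>c * F t - c * F s - c * L x s t\<bar> \<le> \<epsilon> * (\<bar>c\<bar> * (\<omega> t - \<omega> s))" by (simp add: mult.left_commute)
  qed
qed (use assms in auto)

lemma has_differential_const: "control a b \<omega> \<Longrightarrow> has_differential a b \<omega> (\<lambda>x s t. 0) (\<lambda>t. c)"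
  by (rule has_differentialI[of 0]) (auto intro: exI[of _ "1::real"])

lemma has_differential_sum:
  assumes "control a b \<omega>" "\<And>i. i \<in> I \<Longrightarrow> has_differential a b \<omega> (L i) (F i)"
  shows "has_differential a b \<omega> (\<lambda>x s t. \<Sum>i\<in>I. L i x s t) (\<lambda>t. \<Sum>i\<in>I. F i t)"
  using assms(2)
proof (induction I rule: infinite_finite_induct)
  case (insert i I)
  then show ?case using has_differential_add[of a b \<omega> "L i" "F i"] assms(1) by simp
qed (use has_differential_const[OF assms(1)] in simp_all)

lemma has_differential_sum_list:
  assumes "control a b \<omega>" "\<And>i. i \<in> set is \<Longrightarrow> has_differential a b \<omega> (L i) (F i)"
  shows "has_differential a b \<omega> (\<lambda>x s t. \<Sum>i\<leftarrow>is. L i x s t) (\<lambda>t. \<Sum>i\<leftarrow>is. F i t)"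
  using assms(2)
proof (induction "is")
  case (Cons i "is")
  then show ?case using has_differential_add[of a b \<omega> "L i" "F i"] assms(1) by simp
qed (use has_differential_const[OF assms(1)] in simp_all)

text \<open>The approximation of \<open>F\<close> by \<open>L\<close> holds at every point of a
  short interval, so one good point per interval is enough. \<open>length_lower_bound\<close> uses
  this freedom: there the good point depends on the interval.\<close>

lemma has_differential_upper:
  assumes "has_differential a b \<omega> L F" "a \<le> b" "control a b \<omega>"
    and bd: "\<exists>\<delta>>0. \<forall>s t. a \<le> s \<and> s \<le> t \<and> t \<le> b \<and> t - s < \<delta> \<longrightarrow>
      (\<exists>x. s \<le> x \<and> x \<le> t \<and> L x s t \<le> \<Omega> t - \<Omega> s)"
  shows "F b - F a \<le> \<Omega> b - \<Omega> a"
proof -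
  have w: "\<omega> b - \<omega> a \<ge> 0" using controlD(3)[OF assms(3), of a b] assms(2) by simp
  have "F b - F a \<le> \<Omega> b - \<Omega> a + \<epsilon> * (\<omega> b - \<omega> a)" if e: "\<epsilon> > 0" for \<epsilon>
  proof -
    obtain d where d: "d > 0" "\<And>s x t. a \<le> s \<Longrightarrow> s \<le> x \<Longrightarrow> x \<le> t \<Longrightarrow> t \<le> b \<Longrightarrow> t - s < d \<Longrightarrow>
      \<bar>F t - F s - L x s t\<bar> \<le> \<epsilon> * (\<omega> t - \<omega> s)" using has_differentialE[OF assms(1) e] by blast
    obtain d' where d': "d' > 0" "\<And>s t. a \<le> s \<Longrightarrow> s \<le> t \<Longrightarrow> t \<le> b \<Longrightarrow> t - s < d' \<Longrightarrow>
      (\<exists>x. s \<le> x \<and> x \<le> t \<and> L x s t \<le> \<Omega> t - \<Omega> s)" using bd by blast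
    have "F b - F a \<le> (\<Omega> b + \<epsilon> * \<omega> b) - (\<Omega> a + \<epsilon> * \<omega> a)"
    proof (rule increments_le_by_local[OF assms(2), of "min d d'"])
      fix s t assume h: "a \<le> s" "s \<le> t" "t \<le> b" "t - s < min d d'"
      obtain x where x: "s \<le> x" "x \<le> t" "L x s t \<le> \<Omega> t - \<Omega> s" using d'(2)[of s t] h by auto
      show "F t - F s \<le> (\<Omega> t + \<epsilon> * \<omega> t) - (\<Omega> s + \<epsilon> * \<omega> s)"
        using d(2)[of s x t] h x by (simp add: algebra_simps abs_le_iff)
    qed (use d d' in simp)
    then show ?thesis by (simp add: algebra_simps)
  qed
  then have "F b - F a \<le> \<Omega> b - \<Omega> a + e" if e: "e > 0" for e
  proof -
    have "e / (\<omega> b - \<omega> a + 1) > 0" using e w by simp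
    then have "F b - F a \<le> \<Omega> b - \<Omega> a + e / (\<omega> b - \<omega> a + 1) * (\<omega> b - \<omega> a)"
      using \<open>\<And>\<epsilon>. \<epsilon> > 0 \<Longrightarrow> F b - F a \<le> \<Omega> b - \<Omega> a + \<epsilon> * (\<omega> b - \<omega> a)\<close> by blast
    also have "e / (\<omega> b - \<omega> a + 1) * (\<omega> b - \<omega> a) \<le> e" using e w by (simp add: field_simps)
    finally show ?thesis by simp
  qed
  then show ?thesis by (rule field_le_epsilon)
qed

lemma has_differential_bound:
  assumes "has_differential a b \<omega> L F" "control a b \<omega>" "a \<le> s" "s \<le> t" "t \<le> b"
    and bd: "\<And>p x q. s \<le> p \<Longrightarrow> p \<le> x \<Longrightarrow> x \<le> q \<Longrightarrow> q \<le> t \<Longrightarrow> \<bar>L x p q\<bar> \<le> \<Omega> q - \<Omega> p"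
  shows "\<bar>F t - F s\<bar> \<le> \<Omega> t - \<Omega> s"
proof -
  note c = control_subinterval[OF assms(2,3,5)]
  note h = has_differential_subinterval[OF assms(1,3,5)]
  have "F t - F s \<le> \<Omega> t - \<Omega> s"
  proof (rule has_differential_upper[where \<Omega> = \<Omega>, OF h assms(4) c], rule exI[of _ "1::real"], intro conjI allI impI)
    fix p q assume "s \<le> p \<and> p \<le> q \<and> q \<le> t \<and> q - p < 1"
    then show "\<exists>x\<ge>p. x \<le> q \<and> L x p q \<le> \<Omega> q - \<Omega> p" using bd[of p p q] by (intro exI[of _ p]) auto
  qed simp
  moreover have neg: "has_differential s t \<omega> (\<lambda>x p q. - L x p q) (\<lambda>u. - F u)"
    using has_differential_cmult[OF h c, of "- 1"] by simp
  have "- F t - - F s \<le> \<Omega> t - \<Omega> s"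
  proof (rule has_differential_upper[where \<Omega> = \<Omega>, OF neg assms(4) c], rule exI[of _ "1::real"], intro conjI allI impI)
    fix p q assume "s \<le> p \<and> p \<le> q \<and> q \<le> t \<and> q - p < 1"
    then show "\<exists>x\<ge>p. x \<le> q \<and> - L x p q \<le> \<Omega> q - \<Omega> p" using bd[of p p q] by (intro exI[of _ p]) auto
  qed simp
  ultimately show ?thesis by simp
qed

lemma has_differential_unique:
  assumes "has_differential a b \<omega> L F" "has_differential a b \<omega> L G" "control a b \<omega>" "a \<le> s" "s \<le> t" "t \<le> b"
  shows "F t - F s = G t - G s"
proof -
  have "has_differential a b \<omega> (\<lambda>x s t. L x s t + - 1 * L x s t) (\<lambda>t. F t + - 1 * G t)"
    by (intro has_differential_add has_differential_cmult assms)
  from has_differential_bound[OF this assms(3-6), of "\<lambda>_. 0"] show ?thesis by simp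
qed

text \<open>The bridge to the integral as a limit of Riemann sums: the errors on the pieces of a
  fine tagged division add up to \<open>\<epsilon>\<close> times the total increment of
  \<open>\<omega>\<close>.\<close>

lemma has_differential_imp_rs_integral:
  assumes "has_differential a b \<omega> (\<lambda>x s t. f x * (h t - h s)) F" "control a b \<omega>" "a \<le> s" "s \<le> t" "t \<le> b"
  shows "has_rs_integral f h s t (F t - F s)"
  unfolding has_rs_integral_def
proof (intro allI impI)
  fix e :: real assume e: "e > 0"
  have w: "\<omega> t - \<omega> s \<ge> 0" using controlD(3)[OF assms(2)] assms by simp
  define \<epsilon> where "\<epsilon> = e / (\<omega> t - \<omega> s + 1)"
  have eps: "\<epsilon> > 0" using e w by (simp add: \<epsilon>_def)
  have less: "\<epsilon> * (\<omega> t - \<omega> s) < e" using e w by (simp add: \<epsilon>_def field_simps)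
  obtain d where d: "d > 0" "\<And>s x t. a \<le> s \<Longrightarrow> s \<le> x \<Longrightarrow> x \<le> t \<Longrightarrow> t \<le> b \<Longrightarrow> t - s < d \<Longrightarrow>
      \<bar>F t - F s - f x * (h t - h s)\<bar> \<le> \<epsilon> * (\<omega> t - \<omega> s)" using has_differentialE[OF assms(1) eps] by blast
  show "\<exists>\<delta>>0. \<forall>p. p tagged_division_of {s..t} \<and> (\<lambda>x. ball x \<delta>) fine p \<longrightarrow>
     \<bar>(\<Sum>(x, K)\<in>p. f x * (h (Sup K) - h (Inf K))) - (F t - F s)\<bar> < e"
  proof (intro exI[of _ "d/2"] conjI allI impI)
    fix p assume p: "p tagged_division_of {s..t} \<and> (\<lambda>x. ball x (d/2)) fine p"
    have loc: "\<bar>(F (Sup K) - F (Inf K)) - f x * (h (Sup K) - h (Inf K))\<bar> \<le> \<epsilon> * (\<omega> (Sup K) - \<omega> (Inf K))"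
      if "(x,K) \<in> p" for x K
    proof -
      have K0: "x \<in> K" "K \<subseteq> {s..t}" "\<exists>c e. K = cbox c e"
        using tagged_division_ofD(2,3,4) p that by blast+
      then obtain c e where K: "K = {c..e}" "c \<le> e" by (auto simp: cbox_interval)
      have "{c,e} \<subseteq> ball x (d/2)" using p that K unfolding fine_def by fastforce
      then have "\<bar>x - c\<bar> < d/2" "\<bar>x - e\<bar> < d/2" by (auto simp: dist_real_def)
      then have "e - c < d" by linarith
      then show ?thesis using d(2)[of c x e] K K0 assms by auto
    qed
    have "\<bar>(\<Sum>(x, K)\<in>p. f x * (h (Sup K) - h (Inf K))) - (F t - F s)\<bar> =
        \<bar>\<Sum>(x, K)\<in>p. (F (Sup K) - F (Inf K)) - f x * (h (Sup K) - h (Inf K))\<bar>"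
      using additive_tagged_division_1[OF assms(4) conjunct1[OF p], of F]
      by (simp add: case_prod_unfold sum_subtractf)
    also have "\<dots> \<le> (\<Sum>(x, K)\<in>p. \<epsilon> * (\<omega> (Sup K) - \<omega> (Inf K)))"
      by (rule order_trans[OF sum_abs]) (use loc in \<open>auto intro!: sum_mono\<close>)
    also have "\<dots> = \<epsilon> * (\<Sum>(x, K)\<in>p. \<omega> (Sup K) - \<omega> (Inf K))"
      by (simp add: case_prod_unfold sum_distrib_left)
    also have "\<dots> = \<epsilon> * (\<omega> t - \<omega> s)"
      using additive_tagged_division_1[OF assms(4) conjunct1[OF p], of \<omega>] by simp
    finally show "\<bar>(\<Sum>(x, K)\<in>p. f x * (h (Sup K) - h (Inf K))) - (F t - F s)\<bar> < e" using less by simp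
  qed (use d in simp)
qed

lemma rs_integral_eqI: "has_rs_integral f h a b I \<Longrightarrow> rs_integral f h a b = I"
  unfolding rs_integral_def by (rule the_equality) (auto intro: has_rs_integral_unique)

text \<open>The substitution \<open>y = W x\<close> turns the integral against \<open>W\<close> into an ordinary one.\<close>

lemma differential_exists_control:
  assumes W: "control a b W" and ab: "a \<le> b" and f: "continuous_on {a..b} f"
  shows "\<exists>F. has_differential a b W (\<lambda>x s t. f x * (W t - W s)) F"
proof -
  define g where "g = inv_into {a..b} W"
  have inj: "inj_on W {a..b}" using W by (simp add: control_def strict_mono_on_imp_inj_on)
  have gW: "g (W x) = x" if "x \<in> {a..b}" for x using inj that by (simp add: g_def)
  have sur: "\<exists>u. s \<le> u \<and> u \<le> t \<and> W u = y" if "a \<le> s" "s \<le> t" "t \<le> b" "W s \<le> y" "y \<le> W t" for s t y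
    using IVT'[of W s y t] that controlD(1)[OF control_subinterval[OF W that(1,3)]] by blast
  have im: "W ` {a..b} = {W a..W b}"
  proof
    show "W ` {a..b} \<subseteq> {W a..W b}" using controlD(3)[OF W] by auto
    show "{W a..W b} \<subseteq> W ` {a..b}" using sur[of a b] ab by fastforce
  qed
  have "continuous_on {W a..W b} g"
    using continuous_on_inv[OF controlD(1)[OF W], of g] gW im by simp
  then have cfg: "continuous_on {W a..W b} (\<lambda>y. f (g y))"
    by (rule continuous_on_compose2[OF f]) (use gW im[symmetric] in auto)
  define F where "F t = integral {W a..W t} (\<lambda>y. f (g y))" for t
  have inc: "F t - F s = integral {W s..W t} (\<lambda>y. f (g y))" if "a \<le> s" "s \<le> t" "t \<le> b" for s t
  proof -
    have "(\<lambda>y. f (g y)) integrable_on {W a..W t}"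
      using cfg by (intro integrable_continuous_real continuous_on_subset[OF cfg]) (use controlD(3)[OF W] that in auto)
    then show ?thesis
      using Henstock_Kurzweil_Integration.integral_combine[of "W a" "W s" "W t" "\<lambda>y. f (g y)"]
        controlD(3)[OF W, of a s] controlD(3)[OF W, of s t] that
      by (simp add: F_def)
  qed
  have "has_differential a b W (\<lambda>x s t. f x * (W t - W s)) F"
  proof (rule has_differentialI[of 1])
    fix \<epsilon> :: real assume e: "\<epsilon> > 0"
    have "uniformly_continuous_on {a..b} f" by (rule compact_uniformly_continuous[OF f]) simp
    then obtain d where d: "d > 0" "\<And>x y. x \<in> {a..b} \<Longrightarrow> y \<in> {a..b} \<Longrightarrow> dist y x < d \<Longrightarrow> dist (f y) (f x) < \<epsilon>"
      using e unfolding uniformly_continuous_on_def by meson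
    show "\<exists>\<delta>>0. \<forall>s x t. a \<le> s \<longrightarrow> s \<le> x \<longrightarrow> x \<le> t \<longrightarrow> t \<le> b \<longrightarrow> t - s < \<delta> \<longrightarrow>
       \<bar>F t - F s - f x * (W t - W s)\<bar> \<le> \<epsilon> * (1 * (W t - W s))"
    proof (intro exI[of _ d] conjI d(1) allI impI)
      fix s x t assume h: "a \<le> s" "s \<le> x" "x \<le> t" "t \<le> b" "t - s < d"
      have Wst: "W s \<le> W t" using controlD(3)[OF W, of s t] h by simp
      have int: "(\<lambda>y. f (g y)) integrable_on {W s..W t}"
        by (intro integrable_continuous_real continuous_on_subset[OF cfg]) (use controlD(3)[OF W] h in auto)
      have "((\<lambda>y. f (g y) - f x) has_integral (F t - F s - f x * (W t - W s))) {W s..W t}"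
        using has_integral_diff[OF integrable_integral[OF int] has_integral_const_real[of "f x" "W s" "W t"]]
          inc[of s t] h Wst by (simp add: mult.commute)
      moreover have "norm (f (g y) - f x) \<le> \<epsilon>" if y: "y \<in> {W s..W t}" for y
      proof -
        obtain u where u: "s \<le> u" "u \<le> t" "W u = y" using sur[of s t y] y h by auto
        then have "g y = u" using gW[of u] h by auto
        moreover have "dist u x < d" using u h by (simp add: dist_real_def)
        ultimately show ?thesis using d(2)[of x u] u h by (simp add: dist_real_def)
      qed
      ultimately have "norm (F t - F s - f x * (W t - W s)) \<le> \<epsilon> * Henstock_Kurzweil_Integration.content {W s..W t}"
        by (intro has_integral_bound_real[where S = "{}"]) (use e in auto)
      then show "\<bar>F t - F s - f x * (W t - W s)\<bar> \<le> \<epsilon> * (1 * (W t - W s))" using Wst by simp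
    qed
  qed (use W in auto)
  then show ?thesis by blast
qed

lemma has_differential_change_control:
  assumes "has_differential a b W L F" "control a b \<omega>" "K \<ge> 0"
    "\<And>s t. a \<le> s \<Longrightarrow> s \<le> t \<Longrightarrow> t \<le> b \<Longrightarrow> W t - W s \<le> K * (\<omega> t - \<omega> s)"
  shows "has_differential a b \<omega> L F"
proof (rule has_differentialI[OF assms(3) _ assms(2)])
  fix \<epsilon> :: real assume e: "\<epsilon> > 0"
  obtain d where d: "d > 0" "\<And>s x t. a \<le> s \<Longrightarrow> s \<le> x \<Longrightarrow> x \<le> t \<Longrightarrow> t \<le> b \<Longrightarrow> t - s < d \<Longrightarrow>
      \<bar>F t - F s - L x s t\<bar> \<le> \<epsilon> * (W t - W s)" using has_differentialE[OF assms(1) e] by blast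
  have "\<bar>F t - F s - L x s t\<bar> \<le> \<epsilon> * (K * (\<omega> t - \<omega> s))"
    if h: "a \<le> s" "s \<le> x" "x \<le> t" "t \<le> b" "t - s < d" for s x t
  proof -
    have "\<epsilon> * (W t - W s) \<le> \<epsilon> * (K * (\<omega> t - \<omega> s))"
      using assms(4)[of s t] h e by (intro mult_left_mono) auto
    then show ?thesis using d(2)[OF h] by simp
  qed
  then show "\<exists>\<delta>>0. \<forall>s x t. a \<le> s \<longrightarrow> s \<le> x \<longrightarrow> x \<le> t \<longrightarrow> t \<le> b \<longrightarrow> t - s < \<delta> \<longrightarrow>
      \<bar>F t - F s - L x s t\<bar> \<le> \<epsilon> * (K * (\<omega> t - \<omega> s))" using d(1) by blast
qed

lemma continuous_on_if_increments:
  fixes F :: "real \<Rightarrow> real"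
  assumes "control a b \<omega>" "\<And>s t. a \<le> s \<Longrightarrow> s \<le> t \<Longrightarrow> t \<le> b \<Longrightarrow> \<bar>F t - F s\<bar> \<le> C * (\<omega> t - \<omega> s)"
  shows "continuous_on {a..b} F"
proof -
  have "uniformly_continuous_on {a..b} F"
    unfolding uniformly_continuous_on_def
  proof (intro allI impI)
    fix e :: real assume e: "e > 0"
    then have "e / (\<bar>C\<bar> + 1) > 0" by simp
    from control_uniform[OF assms(1) this] obtain d where d: "d > 0"
      "\<And>s t. a \<le> s \<Longrightarrow> s \<le> t \<Longrightarrow> t \<le> b \<Longrightarrow> t - s < d \<Longrightarrow> \<omega> t - \<omega> s < e / (\<bar>C\<bar> + 1)" by blast
    have "\<bar>F t - F s\<bar> < e" if h: "a \<le> s" "s \<le> t" "t \<le> b" "t - s < d" for s t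
    proof -
      have w: "0 \<le> \<omega> t - \<omega> s" using controlD(3)[OF assms(1), of s t] h by simp
      have "\<bar>F t - F s\<bar> \<le> C * (\<omega> t - \<omega> s)" using assms(2) h by simp
      also have "\<dots> \<le> (\<bar>C\<bar> + 1) * (\<omega> t - \<omega> s)" using w by (intro mult_right_mono) auto
      also have "\<dots> < (\<bar>C\<bar> + 1) * (e / (\<bar>C\<bar> + 1))" using d(2)[OF h] by (intro mult_strict_left_mono) auto
      also have "\<dots> = e" by simp
      finally show ?thesis .
    qed
    note k = this
    have "dist (F y) (F x) < e" if "x \<in> {a..b}" "y \<in> {a..b}" "dist y x < d" for x y
      using k[of x y] k[of y x] that by (cases "x \<le> y") (auto simp: dist_real_def abs_minus_commute)
    then show "\<exists>d>0. \<forall>x\<in>{a..b}. \<forall>x'\<in>{a..b}. dist x' x < d \<longrightarrow> dist (F x') (F x) < e" using d(1) by blast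
  qed
  then show ?thesis by (rule uniformly_continuous_imp_continuous)
qed

text \<open>A Jordan decomposition: \<open>h\<close> is the difference of the controls
  \<open>D * \<omega>\<close> and \<open>D * \<omega> - h\<close>, the second being strictly
  increasing because \<open>D\<close> exceeds the Lipschitz constant \<open>C\<close>. Each of them
  is integrated by substitution.\<close>

lemma differential_exists:
  assumes \<omega>: "control a b \<omega>" and ab: "a \<le> b" and f: "continuous_on {a..b} f"
    and h: "\<And>s t. a \<le> s \<Longrightarrow> s \<le> t \<Longrightarrow> t \<le> b \<Longrightarrow> \<bar>h t - h s\<bar> \<le> C * (\<omega> t - \<omega> s)"
  shows "\<exists>F. has_differential a b \<omega> (\<lambda>x s t. f x * (h t - h s)) F"
proof -
  define D where "D = \<bar>C\<bar> + 1"
  have hD: "\<bar>h t - h s\<bar> < D * (\<omega> t - \<omega> s)" if "a \<le> s" "s < t" "t \<le> b" for s t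
  proof -
    have "C * (\<omega> t - \<omega> s) < D * (\<omega> t - \<omega> s)"
      using controlD(2)[OF \<omega> that] by (intro mult_strict_right_mono) (auto simp: D_def)
    then show ?thesis using h[of s t] that by simp
  qed
  have hD': "\<bar>h t - h s\<bar> \<le> D * (\<omega> t - \<omega> s)" if "a \<le> s" "s \<le> t" "t \<le> b" for s t
    using hD[of s t] that by (cases "s = t") auto
  define W2 where "W2 t = D * \<omega> t - h t" for t
  have ch: "continuous_on {a..b} h" by (rule continuous_on_if_increments[OF \<omega> h])
  have W1: "control a b (\<lambda>t. D * \<omega> t)"
    unfolding control_def using controlD[OF \<omega>]
    by (auto intro!: continuous_intros strict_mono_onI mult_strict_left_mono simp: D_def)
  have W2: "control a b W2"
    unfolding control_def
  proof
    show "continuous_on {a..b} W2" unfolding W2_def by (intro continuous_intros controlD(1)[OF \<omega>] ch)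
    show "strict_mono_on {a..b} W2"
    proof (rule strict_mono_onI)
      fix s t assume "s \<in> {a..b}" "t \<in> {a..b}" "s < t"
      then show "W2 s < W2 t" using hD[of s t] by (simp add: W2_def abs_less_iff algebra_simps)
    qed
  qed
  obtain F1 where F1: "has_differential a b (\<lambda>t. D * \<omega> t) (\<lambda>x s t. f x * (D * \<omega> t - D * \<omega> s)) F1"
    using differential_exists_control[OF W1 ab f] by blast
  obtain F2 where F2: "has_differential a b W2 (\<lambda>x s t. f x * (W2 t - W2 s)) F2"
    using differential_exists_control[OF W2 ab f] by blast
  have F1': "has_differential a b \<omega> (\<lambda>x s t. f x * (D * \<omega> t - D * \<omega> s)) F1"
    by (rule has_differential_change_control[OF F1 \<omega>, of D]) (auto simp: D_def algebra_simps)
  have F2': "has_differential a b \<omega> (\<lambda>x s t. f x * (W2 t - W2 s)) F2"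
  proof (rule has_differential_change_control[OF F2 \<omega>, of "2 * D"])
    fix s t assume "a \<le> s" "s \<le> t" "t \<le> b"
    then show "W2 t - W2 s \<le> 2 * D * (\<omega> t - \<omega> s)" using hD'[of s t] by (simp add: W2_def abs_le_iff algebra_simps)
  qed (simp add: D_def)
  have "has_differential a b \<omega> (\<lambda>x s t. f x * (h t - h s)) (\<lambda>t. F1 t + - 1 * F2 t)"
    by (rule has_differential_cong[OF has_differential_add[OF F1' has_differential_cmult[OF F2' \<omega>, of "-1"] \<omega>]])
      (auto simp: W2_def algebra_simps)
  then show ?thesis by blast
qed

lemma has_differential_mult:
  assumes \<omega>: "control a b \<omega>" and F: "has_differential a b \<omega> L F" and G: "has_differential a b \<omega> M G"
    and FC: "\<And>s t. a \<le> s \<Longrightarrow> s \<le> t \<Longrightarrow> t \<le> b \<Longrightarrow> \<bar>F t - F s\<bar> \<le> C * (\<omega> t - \<omega> s)"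
    and GC: "\<And>s t. a \<le> s \<Longrightarrow> s \<le> t \<Longrightarrow> t \<le> b \<Longrightarrow> \<bar>G t - G s\<bar> \<le> C * (\<omega> t - \<omega> s)"
    and bF: "\<And>t. a \<le> t \<Longrightarrow> t \<le> b \<Longrightarrow> \<bar>F t\<bar> \<le> B" and bG: "\<And>t. a \<le> t \<Longrightarrow> t \<le> b \<Longrightarrow> \<bar>G t\<bar> \<le> B"
    and C: "0 \<le> C" and B: "0 \<le> B"
  shows "has_differential a b \<omega> (\<lambda>x s t. L x s t * G x + F x * M x s t) (\<lambda>t. F t * G t)"
proof (rule has_differentialI[of "2 * C\<^sup>2 + 2 * B"])
  fix \<epsilon> :: real assume e: "\<epsilon> > 0"
  obtain d1 where d1: "d1 > 0" "\<And>s x t. a \<le> s \<Longrightarrow> s \<le> x \<Longrightarrow> x \<le> t \<Longrightarrow> t \<le> b \<Longrightarrow> t - s < d1 \<Longrightarrow>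
      \<bar>F t - F s - L x s t\<bar> \<le> \<epsilon> * (\<omega> t - \<omega> s)" using has_differentialE[OF F e] by blast
  obtain d2 where d2: "d2 > 0" "\<And>s x t. a \<le> s \<Longrightarrow> s \<le> x \<Longrightarrow> x \<le> t \<Longrightarrow> t \<le> b \<Longrightarrow> t - s < d2 \<Longrightarrow>
      \<bar>G t - G s - M x s t\<bar> \<le> \<epsilon> * (\<omega> t - \<omega> s)" using has_differentialE[OF G e] by blast
  obtain d3 where d3: "d3 > 0" "\<And>s t. a \<le> s \<Longrightarrow> s \<le> t \<Longrightarrow> t \<le> b \<Longrightarrow> t - s < d3 \<Longrightarrow> \<omega> t - \<omega> s < \<epsilon>"
    using control_uniform[OF \<omega> e] by blast
  show "\<exists>\<delta>>0. \<forall>s x t. a \<le> s \<longrightarrow> s \<le> x \<longrightarrow> x \<le> t \<longrightarrow> t \<le> b \<longrightarrow> t - s < \<delta> \<longrightarrow>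
    \<bar>F t * G t - F s * G s - (L x s t * G x + F x * M x s t)\<bar> \<le> \<epsilon> * ((2 * C\<^sup>2 + 2 * B) * (\<omega> t - \<omega> s))"
  proof (intro exI[of _ "min d1 (min d2 d3)"] conjI allI impI)
    fix s x t assume h: "a \<le> s" "s \<le> x" "x \<le> t" "t \<le> b" "t - s < min d1 (min d2 d3)"
    define u where "u = \<omega> t - \<omega> s"
    have u0: "0 \<le> u" using controlD(3)[OF \<omega>, of s t] h by (simp add: u_def)
    have ue: "u \<le> \<epsilon>" using d3(2)[of s t] h by (simp add: u_def)
    have wx: "\<omega> s \<le> \<omega> x" "\<omega> x \<le> \<omega> t" using controlD(3)[OF \<omega>] h by auto
    have a1: "\<bar>F t - F s\<bar> \<le> C * u" using FC[of s t] h by (simp add: u_def)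
    have a2: "\<bar>G t - G s\<bar> \<le> C * u" using GC[of s t] h by (simp add: u_def)
    have a3: "\<bar>G t - G x\<bar> \<le> C * u"
      using GC[of x t] mult_left_mono[OF _ C, of "\<omega> t - \<omega> x" u] wx h by (simp add: u_def)
    have a4: "\<bar>F s - F x\<bar> \<le> C * u"
      using FC[of s x] mult_left_mono[OF _ C, of "\<omega> x - \<omega> s" u] wx h by (simp add: u_def abs_minus_commute)
    have a5: "\<bar>F t - F s - L x s t\<bar> \<le> \<epsilon> * u" using d1(2)[of s x t] h by (simp add: u_def)
    have a6: "\<bar>G t - G s - M x s t\<bar> \<le> \<epsilon> * u" using d2(2)[of s x t] h by (simp add: u_def)
    \<comment> \<open>The first and third products are of second order, hence at most
      \<open>C\<^sup>2 * (\<epsilon> * u)\<close> as \<open>u \<le> \<epsilon>\<close> on short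
      intervals. The other two carry the errors of the two given differentials.\<close>
    have eq: "F t * G t - F s * G s - (L x s t * G x + F x * M x s t) =
      (F t - F s) * (G t - G x) + (F t - F s - L x s t) * G x + (F s - F x) * (G t - G s) + F x * (G t - G s - M x s t)"
      by (simp add: algebra_simps)
    have cu: "C * u * (C * u) \<le> C\<^sup>2 * (\<epsilon> * u)"
      using mult_left_mono[OF mult_right_mono[OF ue u0], of "C\<^sup>2"] by (simp add: power2_eq_square algebra_simps)
    have "\<bar>(F t - F s) * (G t - G x)\<bar> \<le> C * u * (C * u)" unfolding abs_mult
      by (intro mult_mono a1 a3) (use C u0 in auto)
    moreover have "\<bar>(F t - F s - L x s t) * G x\<bar> \<le> \<epsilon> * u * B" unfolding abs_mult
      by (intro mult_mono a5 bG) (use e u0 h in auto)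
    moreover have "\<bar>(F s - F x) * (G t - G s)\<bar> \<le> C * u * (C * u)" unfolding abs_mult
      by (intro mult_mono a4 a2) (use C u0 in auto)
    moreover have "\<bar>F x * (G t - G s - M x s t)\<bar> \<le> B * (\<epsilon> * u)" unfolding abs_mult
      by (intro mult_mono a6 bF) (use B h in auto)
    ultimately have "\<bar>F t * G t - F s * G s - (L x s t * G x + F x * M x s t)\<bar> \<le>
        2 * (C\<^sup>2 * (\<epsilon> * u)) + 2 * (B * (\<epsilon> * u))"
      unfolding eq using cu by (simp add: abs_le_iff mult.commute)
    then show "\<bar>F t * G t - F s * G s - (L x s t * G x + F x * M x s t)\<bar> \<le> \<epsilon> * ((2 * C\<^sup>2 + 2 * B) * (\<omega> t - \<omega> s))"
      unfolding u_def by (simp add: algebra_simps)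
  qed (use d1 d2 d3 in simp)
qed (use B \<omega> in auto)

section \<open>Tensor series and Chen's identity\<close>

lemma tensor_mult_Nil [simp]: "tensor_mult x y [] = x [] * y []"
  by (simp add: tensor_mult_def)

text \<open>The left factor absorbs the first letter while the word shortens, so identities such as
  associativity follow by induction on the word with the left factor arbitrary.\<close>

lemma tensor_mult_Cons:
  "tensor_mult x y (\<phi> # w) = x [] * y (\<phi> # w) + tensor_mult (\<lambda>u. x (\<phi> # u)) y w"
  by (simp add: tensor_mult_def sum.atMost_Suc_shift del: sum.atMost_Suc)

lemma tensor_mult_scale_left: "tensor_mult (\<lambda>u. c * x u) y w = c * tensor_mult x y w"
  by (simp add: tensor_mult_def sum_distrib_left mult.assoc)

lemma tensor_mult_add_left: "tensor_mult (\<lambda>u. x u + x' u) y w = tensor_mult x y w + tensor_mult x' y w"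
  by (simp add: tensor_mult_def sum.distrib distrib_right)

lemma tensor_mult_assoc: "tensor_mult (tensor_mult x y) z = tensor_mult x (tensor_mult y z)"
proof
  fix w show "tensor_mult (tensor_mult x y) z w = tensor_mult x (tensor_mult y z) w"
  proof (induction w arbitrary: x)
    case (Cons \<phi> w)
    then show ?case
      by (simp add: tensor_mult_Cons tensor_mult_add_left tensor_mult_scale_left algebra_simps)
  qed simp
qed

lemma tensor_one_Nil [simp]: "tensor_one [] = 1"
  and tensor_one_Cons [simp]: "tensor_one (\<phi> # w) = 0"
  by (simp_all add: tensor_one_def)

lemma tensor_mult_zero_left: "tensor_mult (\<lambda>u. 0) y w = 0"
  by (simp add: tensor_mult_def)

lemma tensor_mult_one_left [simp]: "tensor_mult tensor_one y = y"
proof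
  show "tensor_mult tensor_one y w = y w" for w
    by (cases w) (simp_all add: tensor_mult_Cons tensor_mult_zero_left)
qed

lemma tensor_mult_one_right [simp]: "tensor_mult x tensor_one = x"
proof
  show "tensor_mult x tensor_one w = x w" for w
    by (induction w arbitrary: x) (simp_all add: tensor_mult_Cons)
qed

text \<open>Junk unless the constant term of \<open>x\<close> is \<open>1\<close>.\<close>

function tensor_inv :: "'v::real_normed_vector tensor_series \<Rightarrow> 'v tensor_series"
  where "tensor_inv x w = (if w = [] then 1 else - (\<Sum>k<length w. tensor_inv x (take k w) * x (drop k w)))"
  by auto
termination by (relation "Wellfounded.measure (\<lambda>(x, w). length w)") auto

declare tensor_inv.simps [simp del]

lemma tensor_inv_Nil [simp]: "tensor_inv x [] = 1"
  by (simp add: tensor_inv.simps)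

lemma tensor_inv_left:
  assumes "x [] = 1"
  shows "tensor_mult (tensor_inv x) x = tensor_one"
proof
  fix w
  show "tensor_mult (tensor_inv x) x w = tensor_one w"
  proof (cases "w = []")
    case False
    have "tensor_mult (tensor_inv x) x w = (\<Sum>k<length w. tensor_inv x (take k w) * x (drop k w)) + tensor_inv x w"
      unfolding tensor_mult_def using assms by (simp add: lessThan_Suc_atMost[symmetric])
    then show ?thesis using False tensor_inv.simps[of x w] by (simp add: tensor_one_def)
  qed (simp add: assms)
qed

text \<open>As in any monoid with left inverses: \<open>x\<close> turns out to be the left inverse
  of \<open>tensor_inv x\<close>.\<close>

lemma tensor_inv_right:
  assumes "x [] = 1"
  shows "tensor_mult x (tensor_inv x) = tensor_one"
proof -
  let ?u = "tensor_inv x"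
  have "tensor_inv ?u = tensor_mult (tensor_mult (tensor_inv ?u) ?u) x"
    by (subst tensor_mult_assoc) (simp add: tensor_inv_left assms)
  then have "tensor_inv ?u = x" by (simp add: tensor_inv_left)
  then show ?thesis using tensor_inv_left[of ?u] by simp
qed

lemma tensor_mult_left_cancel:
  assumes "x [] = 1" "tensor_mult x y = tensor_mult x z"
  shows "y = z"
  using arg_cong[OF assms(2), of "tensor_mult (tensor_inv x)"]
  by (simp add: tensor_mult_assoc[symmetric] tensor_inv_left assms(1))

lemma tensor_mult_right_cancel:
  assumes "z [] = 1" "tensor_mult x z = tensor_mult y z"
  shows "x = y"
  using arg_cong[OF assms(2), of "\<lambda>u. tensor_mult u (tensor_inv z)"]
  by (simp add: tensor_mult_assoc tensor_inv_right assms(1))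

lemma tensor_inv_mult:
  assumes "x [] = 1" "y [] = 1"
  shows "tensor_inv (tensor_mult x y) = tensor_mult (tensor_inv y) (tensor_inv x)"
proof (rule tensor_mult_right_cancel[of "tensor_mult x y"])
  have "tensor_mult (tensor_mult (tensor_inv y) (tensor_inv x)) (tensor_mult x y) =
      tensor_mult (tensor_inv y) (tensor_mult (tensor_mult (tensor_inv x) x) y)"
    by (simp add: tensor_mult_assoc)
  then show "tensor_mult (tensor_inv (tensor_mult x y)) (tensor_mult x y) =
      tensor_mult (tensor_mult (tensor_inv y) (tensor_inv x)) (tensor_mult x y)"
    using assms by (simp add: tensor_inv_left)
qed (use assms in simp)

section \<open>Iterated integrals: bounds, Chen's identity and the shuffle identity\<close>

lemma blinfun_increment_bound:
  assumes "controlled a b \<omega> \<gamma>" "a \<le> s" "s \<le> t" "t \<le> b"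
  shows "\<bar>blinfun_apply \<phi> (\<gamma> t) - blinfun_apply \<phi> (\<gamma> s)\<bar> \<le> norm \<phi> * (\<omega> t - \<omega> s)"
proof -
  have "\<bar>blinfun_apply \<phi> (\<gamma> t - \<gamma> s)\<bar> \<le> norm \<phi> * norm (\<gamma> t - \<gamma> s)"
    using norm_blinfun[of \<phi> "\<gamma> t - \<gamma> s"] by simp
  also have "\<dots> \<le> norm \<phi> * (\<omega> t - \<omega> s)"
    by (intro mult_left_mono controlled_increment[OF assms]) simp
  finally show ?thesis by (simp add: blinfun.diff_right)
qed

text \<open>Continuity in one degree yields existence of the integral in the next, so both claims
  advance together along the word. The minus sign appears because the moving point is the lower
  limit of integration.\<close>

lemma signature_aux:
  assumes c: "controlled a b \<omega> \<gamma>" and t: "a \<le> t" "t \<le> b"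
  shows "continuous_on {a..t} (\<lambda>s. signature s t \<gamma> w) \<and>
    (\<forall>\<phi>. has_differential a t \<omega> (\<lambda>x p q. signature x t \<gamma> w * (blinfun_apply \<phi> (\<gamma> q) - blinfun_apply \<phi> (\<gamma> p)))
       (\<lambda>s. - signature s t \<gamma> (\<phi> # w)))"
proof -
  have ct: "control a t \<omega>" using control_subinterval[OF controlled_imp_control[OF c] _ t(2), of a] by simp
  have step: "has_differential a t \<omega> (\<lambda>x p q. signature x t \<gamma> w * (blinfun_apply \<phi> (\<gamma> q) - blinfun_apply \<phi> (\<gamma> p)))
       (\<lambda>s. - signature s t \<gamma> (\<phi> # w))" if cw: "continuous_on {a..t} (\<lambda>s. signature s t \<gamma> w)" for w \<phi>
  proof -
    obtain F where F: "has_differential a t \<omega> (\<lambda>x p q. signature x t \<gamma> w * (blinfun_apply \<phi> (\<gamma> q) - blinfun_apply \<phi> (\<gamma> p))) F"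
      using differential_exists[OF ct t(1) cw, of "\<lambda>u. blinfun_apply \<phi> (\<gamma> u)" "norm \<phi>"]
        blinfun_increment_bound[OF c] t by fastforce
    have "signature s t \<gamma> (\<phi> # w) = F t - F s" if "a \<le> s" "s \<le> t" for s
      using rs_integral_eqI[OF has_differential_imp_rs_integral[OF F ct that order_refl]] by simp
    then show ?thesis by (intro has_differential_cong[OF F]) auto
  qed
  have "continuous_on {a..t} (\<lambda>s. signature s t \<gamma> w)" for w
  proof (induction w)
    case (Cons \<phi> w)
    have "\<exists>M. \<forall>s\<in>{a..t}. \<bar>signature s t \<gamma> w\<bar> \<le> M"
      using compact_imp_bounded[OF compact_continuous_image[OF Cons compact_Icc]] unfolding bounded_iff by simp
    then obtain M where M: "\<And>s. s \<in> {a..t} \<Longrightarrow> \<bar>signature s t \<gamma> w\<bar> \<le> M" by blast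
    have M0: "0 \<le> M" using M[of a] t by auto
    have "\<bar>(- signature q t \<gamma> (\<phi> # w)) - (- signature p t \<gamma> (\<phi> # w))\<bar> \<le> (\<lambda>u. M * norm \<phi> * \<omega> u) q - (\<lambda>u. M * norm \<phi> * \<omega> u) p"
      if "a \<le> p" "p \<le> q" "q \<le> t" for p q
    proof (rule has_differential_bound[OF step[OF Cons, of \<phi>] ct that])
      fix p' x q' assume h: "p \<le> p'" "p' \<le> x" "x \<le> q'" "q' \<le> q"
      have "\<bar>signature x t \<gamma> w\<bar> * \<bar>blinfun_apply \<phi> (\<gamma> q') - blinfun_apply \<phi> (\<gamma> p')\<bar> \<le> M * (norm \<phi> * (\<omega> q' - \<omega> p'))"
        by (intro mult_mono M blinfun_increment_bound[OF c] M0) (use that h t in auto)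
      then show "\<bar>signature x t \<gamma> w * (blinfun_apply \<phi> (\<gamma> q') - blinfun_apply \<phi> (\<gamma> p'))\<bar> \<le> M * norm \<phi> * \<omega> q' - M * norm \<phi> * \<omega> p'"
        unfolding abs_mult by (simp add: algebra_simps)
    qed
    then have "continuous_on {a..t} (\<lambda>s. - signature s t \<gamma> (\<phi> # w))"
      by (intro continuous_on_if_increments[OF ct, where C = "M * norm \<phi>"]) (simp add: right_diff_distrib)
    from continuous_on_minus[OF this] show ?case by simp
  qed simp
  with step show ?thesis by blast
qed

lemmas continuous_signature_left = conjunct1[OF signature_aux]
lemmas signature_differential = conjunct2[OF signature_aux, rule_format]

lemma signature_degenerate:
  "signature a a \<gamma> = (tensor_one :: 'v::real_normed_vector tensor_series)"
proof
  fix w :: "('v \<Rightarrow>\<^sub>L real) list"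
  show "signature a a \<gamma> w = tensor_one w"
  proof (cases w)
    case (Cons \<phi> v)
    have "has_rs_integral (\<lambda>t. signature t a \<gamma> v) (\<lambda>t. blinfun_apply \<phi> (\<gamma> t)) a a 0"
      unfolding has_rs_integral_def
    proof (intro allI impI exI[of _ "1::real"] conjI)
      fix e :: real and p assume e: "0 < e" and p: "p tagged_division_of {a..a} \<and> (\<lambda>x. ball x 1) fine p"
      have "Sup K = a \<and> Inf K = a" if "(x, K) \<in> p" for x K
      proof -
        have "x \<in> K" "K \<subseteq> {a..a}" using tagged_division_ofD(2,3) p that by blast+
        then have "K = {a}" by auto
        then show ?thesis by simp
      qed
      then have "(\<Sum>(x, K)\<in>p. signature x a \<gamma> v * (blinfun_apply \<phi> (\<gamma> (Sup K)) - blinfun_apply \<phi> (\<gamma> (Inf K)))) = 0"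
        by (intro sum.neutral) auto
      then show "\<bar>(\<Sum>(x, K)\<in>p. signature x a \<gamma> v * (blinfun_apply \<phi> (\<gamma> (Sup K)) - blinfun_apply \<phi> (\<gamma> (Inf K)))) - 0\<bar> < e"
        using e by simp
    qed simp
    then show ?thesis using rs_integral_eqI Cons by fastforce
  qed simp
qed

definition word_norm :: "('v::real_normed_vector \<Rightarrow>\<^sub>L real) list \<Rightarrow> real"
  where "word_norm w = (\<Prod>\<phi>\<leftarrow>w. norm \<phi>)"

lemma word_norm_simps [simp]: "word_norm [] = 1" "word_norm (\<phi> # w) = norm \<phi> * word_norm w"
  by (simp_all add: word_norm_def)

lemma word_norm_nonneg: "0 \<le> word_norm w"
  by (induction w) auto

text \<open>\<open>\<Omega>\<close> is kept apart from the control, so that it may be a multiple of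
  an arc length, which need not be strict. Geometric growth, without the factorial, suffices for the
  compactness of \<open>characters\<close>.\<close>

lemma signature_bound:
  assumes c: "controlled a b \<omega> \<gamma>" and st: "a \<le> s" "s \<le> t" "t \<le> b"
    and \<Omega>: "\<And>s t. a \<le> s \<Longrightarrow> s \<le> t \<Longrightarrow> t \<le> b \<Longrightarrow> norm (\<gamma> t - \<gamma> s) \<le> \<Omega> t - \<Omega> s"
  shows "\<bar>signature s t \<gamma> w\<bar> \<le> word_norm w * (\<Omega> t - \<Omega> s) ^ length w"
  using st(1,2)
proof (induction w arbitrary: s)
  case (Cons \<phi> w)
  have t: "a \<le> t" using Cons by simp
  have ct: "control a t \<omega>" using control_subinterval[OF controlled_imp_control[OF c] _ st(3), of a] by simp
  have \<Omega>mono: "\<Omega> p \<le> \<Omega> q" if "a \<le> p" "p \<le> q" "q \<le> b" for p q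
    using \<Omega>[OF that] norm_ge_zero[of "\<gamma> q - \<gamma> p"] by linarith
  define M where "M = word_norm w * (\<Omega> t - \<Omega> s) ^ length w"
  have "\<bar>(- signature t t \<gamma> (\<phi> # w)) - (- signature s t \<gamma> (\<phi> # w))\<bar> \<le>
      (\<lambda>u. norm \<phi> * M * \<Omega> u) t - (\<lambda>u. norm \<phi> * M * \<Omega> u) s"
  proof (rule has_differential_bound[OF signature_differential[OF c t st(3)] ct Cons.prems order_refl])
    fix p x q assume h: "s \<le> p" "p \<le> x" "x \<le> q" "q \<le> t"
    have "\<bar>signature x t \<gamma> w\<bar> \<le> word_norm w * (\<Omega> t - \<Omega> x) ^ length w"
      using Cons.IH[of x] h Cons.prems by simp
    also have "\<dots> \<le> M" unfolding M_def
      by (intro mult_left_mono power_mono word_norm_nonneg) (use \<Omega>mono h Cons.prems st in auto)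
    finally have 1: "\<bar>signature x t \<gamma> w\<bar> \<le> M" .
    have "\<bar>blinfun_apply \<phi> (\<gamma> q - \<gamma> p)\<bar> \<le> norm \<phi> * norm (\<gamma> q - \<gamma> p)"
      using norm_blinfun[of \<phi> "\<gamma> q - \<gamma> p"] by simp
    also have "\<dots> \<le> norm \<phi> * (\<Omega> q - \<Omega> p)"
      by (intro mult_left_mono \<Omega>) (use h Cons.prems st in auto)
    finally have 2: "\<bar>blinfun_apply \<phi> (\<gamma> q) - blinfun_apply \<phi> (\<gamma> p)\<bar> \<le> norm \<phi> * (\<Omega> q - \<Omega> p)"
      by (simp add: blinfun.diff_right)
    have "\<bar>signature x t \<gamma> w\<bar> * \<bar>blinfun_apply \<phi> (\<gamma> q) - blinfun_apply \<phi> (\<gamma> p)\<bar> \<le> M * (norm \<phi> * (\<Omega> q - \<Omega> p))"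
      by (intro mult_mono 1 2) (use 1 in auto)
    then show "\<bar>signature x t \<gamma> w * (blinfun_apply \<phi> (\<gamma> q) - blinfun_apply \<phi> (\<gamma> p))\<bar> \<le> norm \<phi> * M * \<Omega> q - norm \<phi> * M * \<Omega> p"
      unfolding abs_mult by (simp add: algebra_simps)
  qed
  then show ?case unfolding M_def signature_degenerate by (simp add: algebra_simps)
qed simp

lemma signature_bound_control:
  assumes "controlled a b \<omega> \<gamma>" "a \<le> s" "s \<le> t" "t \<le> b"
  shows "\<bar>signature s t \<gamma> w\<bar> \<le> word_norm w * (\<omega> t - \<omega> s) ^ length w"
  by (rule signature_bound[OF assms controlled_increment[OF assms(1)]])

lemma signature_lipschitz_left:
  assumes c: "controlled a b \<omega> \<gamma>" and st: "a \<le> r" "r \<le> s" "s \<le> t" "t \<le> b"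
  shows "\<bar>signature s t \<gamma> (\<phi> # w) - signature r t \<gamma> (\<phi> # w)\<bar> \<le>
    norm \<phi> * word_norm w * (\<omega> t - \<omega> a) ^ length w * (\<omega> s - \<omega> r)"
proof -
  have t: "a \<le> t" using st by simp
  have ct: "control a t \<omega>" using control_subinterval[OF controlled_imp_control[OF c] _ st(4), of a] by simp
  define M where "M = word_norm w * (\<omega> t - \<omega> a) ^ length w"
  have "\<bar>(- signature s t \<gamma> (\<phi> # w)) - (- signature r t \<gamma> (\<phi> # w))\<bar> \<le>
      (\<lambda>u. norm \<phi> * M * \<omega> u) s - (\<lambda>u. norm \<phi> * M * \<omega> u) r"
  proof (rule has_differential_bound[OF signature_differential[OF c t st(4)] ct st(1-3)])
    fix p x q assume h: "r \<le> p" "p \<le> x" "x \<le> q" "q \<le> s"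
    have "\<bar>signature x t \<gamma> w\<bar> \<le> word_norm w * (\<omega> t - \<omega> x) ^ length w"
      by (rule signature_bound_control[OF c]) (use h st in auto)
    also have "\<dots> \<le> M" unfolding M_def
      by (intro mult_left_mono power_mono word_norm_nonneg) (use controlled_mono[OF c] h st in auto)
    finally have 1: "\<bar>signature x t \<gamma> w\<bar> \<le> M" .
    have 2: "\<bar>blinfun_apply \<phi> (\<gamma> q) - blinfun_apply \<phi> (\<gamma> p)\<bar> \<le> norm \<phi> * (\<omega> q - \<omega> p)"
      by (rule blinfun_increment_bound[OF c]) (use h st in auto)
    have "\<bar>signature x t \<gamma> w\<bar> * \<bar>blinfun_apply \<phi> (\<gamma> q) - blinfun_apply \<phi> (\<gamma> p)\<bar> \<le> M * (norm \<phi> * (\<omega> q - \<omega> p))"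
      by (intro mult_mono 1 2) (use 1 in auto)
    then show "\<bar>signature x t \<gamma> w * (blinfun_apply \<phi> (\<gamma> q) - blinfun_apply \<phi> (\<gamma> p))\<bar> \<le> norm \<phi> * M * \<omega> q - norm \<phi> * M * \<omega> p"
      unfolding abs_mult by (simp add: algebra_simps)
  qed
  then show ?thesis unfolding M_def by (simp add: algebra_simps)
qed

text \<open>As functions of the left end point both sides have the same differential, by the
  induction hypothesis for the shorter word, and they agree at \<open>s = t\<close>.\<close>

theorem chen:
  assumes c: "controlled a b \<omega> \<gamma>" and st: "a \<le> s" "s \<le> t" "t \<le> u" "u \<le> b"
  shows "signature s u \<gamma> = tensor_mult (signature s t \<gamma>) (signature t u \<gamma>)"
proof
  fix w
  show "signature s u \<gamma> w = tensor_mult (signature s t \<gamma>) (signature t u \<gamma>) w"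
    using st(1,2)
  proof (induction w arbitrary: s)
    case (Cons \<phi> w)
    have t: "a \<le> t" "t \<le> b" "a \<le> u" using Cons st by auto
    have ct: "control a t \<omega>" using control_subinterval[OF controlled_imp_control[OF c] _ t(2), of a] by simp
    let ?d = "\<lambda>p q. blinfun_apply \<phi> (\<gamma> q) - blinfun_apply \<phi> (\<gamma> p)"
    have F: "has_differential a t \<omega> (\<lambda>x p q. signature x u \<gamma> w * ?d p q) (\<lambda>s. - signature s u \<gamma> (\<phi> # w))"
      by (rule has_differential_subinterval[OF signature_differential[OF c t(3) st(4)]]) (use st in auto)
    have "has_differential a t \<omega> (\<lambda>x p q. \<Sum>k\<le>length w. signature t u \<gamma> (drop k w) * (signature x t \<gamma> (take k w) * ?d p q))
        (\<lambda>s. \<Sum>k\<le>length w. signature t u \<gamma> (drop k w) * (- signature s t \<gamma> (\<phi> # take k w)))"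
      by (intro has_differential_sum has_differential_cmult ct signature_differential[OF c t(1,2)])
    then have G: "has_differential a t \<omega> (\<lambda>x p q. signature x u \<gamma> w * ?d p q)
        (\<lambda>s. \<Sum>k\<le>length w. signature t u \<gamma> (drop k w) * (- signature s t \<gamma> (\<phi> # take k w)))"
    proof (rule has_differential_cong)
      fix p x q assume "a \<le> p" "p \<le> x" "x \<le> q" "q \<le> t"
      then show "(\<Sum>k\<le>length w. signature t u \<gamma> (drop k w) * (signature x t \<gamma> (take k w) * ?d p q)) = signature x u \<gamma> w * ?d p q"
        using Cons.IH[of x] by (simp add: tensor_mult_def sum_distrib_right sum_distrib_left mult.commute mult.left_commute)
    qed simp
    from has_differential_unique[OF F G ct Cons.prems order_refl]
    show ?case
      by (simp add: tensor_mult_Cons signature_degenerate, simp add: tensor_mult_def sum_negf mult.commute)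
  qed simp
qed

text \<open>A list and not a set, since a word arising in several ways counts with multiplicity. The
  recursion on first letters mirrors the product rule.\<close>

fun shuffle_words :: "'a list \<Rightarrow> 'a list \<Rightarrow> 'a list list"
  where
    "shuffle_words [] w = [w]"
  | "shuffle_words v [] = [v]"
  | "shuffle_words (x # v) (y # w) =
      map ((#) x) (shuffle_words v (y # w)) @ map ((#) y) (shuffle_words (x # v) w)"

text \<open>Product rule in the left end point: differentiating one factor removes its first letter,
  and the induction hypothesis turns the remaining product into the matching branch of the shuffle
  recursion.\<close>

lemma signature_shuffle:
  fixes \<gamma> :: "real \<Rightarrow> 'v::real_normed_vector"
  assumes c: "controlled a b \<omega> \<gamma>" and st: "a \<le> s" "s \<le> t" "t \<le> b"
  shows "signature s t \<gamma> v * signature s t \<gamma> w = (\<Sum>u\<leftarrow>shuffle_words v w. signature s t \<gamma> u)"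
  using st(1,2)
proof (induction v w arbitrary: s rule: shuffle_words.induct)
  case (3 \<phi> v \<psi> w)
  have t: "a \<le> t" using 3 by simp
  have ct: "control a t \<omega>" using control_subinterval[OF controlled_imp_control[OF c] _ st(3), of a] by simp
  let ?S = "\<lambda>w s. signature s t \<gamma> w"
  let ?d = "\<lambda>\<phi> p q. blinfun_apply \<phi> (\<gamma> q) - blinfun_apply \<phi> (\<gamma> p)"
  have lip: "\<exists>C\<ge>0. \<forall>r s. a \<le> r \<longrightarrow> r \<le> s \<longrightarrow> s \<le> t \<longrightarrow> \<bar>- ?S (\<phi> # w) s - - ?S (\<phi> # w) r\<bar> \<le> C * (\<omega> s - \<omega> r)" for \<phi> w
  proof (intro exI conjI allI impI)
    show "0 \<le> norm \<phi> * word_norm w * (\<omega> t - \<omega> a) ^ length w"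
      using controlled_mono[OF c, of a t] t st word_norm_nonneg[of w] by simp
    fix r s assume "a \<le> r" "r \<le> s" "s \<le> t"
    then show "\<bar>- ?S (\<phi> # w) s - - ?S (\<phi> # w) r\<bar> \<le> norm \<phi> * word_norm w * (\<omega> t - \<omega> a) ^ length w * (\<omega> s - \<omega> r)"
      using signature_lipschitz_left[OF c, of r s t \<phi> w] st by (simp add: abs_minus_commute)
  qed
  obtain C1 where C1: "C1 \<ge> 0" "\<And>r s. a \<le> r \<Longrightarrow> r \<le> s \<Longrightarrow> s \<le> t \<Longrightarrow> \<bar>- ?S (\<phi> # v) s - - ?S (\<phi> # v) r\<bar> \<le> C1 * (\<omega> s - \<omega> r)"
    using lip[of \<phi> v] by blast
  obtain C2 where C2: "C2 \<ge> 0" "\<And>r s. a \<le> r \<Longrightarrow> r \<le> s \<Longrightarrow> s \<le> t \<Longrightarrow> \<bar>- ?S (\<psi> # w) s - - ?S (\<psi> # w) r\<bar> \<le> C2 * (\<omega> s - \<omega> r)"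
    using lip[of \<psi> w] by blast
  define C where "C = C1 + C2"
  have C: "0 \<le> C" "C1 \<le> C" "C2 \<le> C" using C1 C2 by (auto simp: C_def)
  have wm: "0 \<le> \<omega> q - \<omega> p" if "a \<le> p" "p \<le> q" "q \<le> t" for p q using controlled_mono[OF c, of p q] that st by simp
  have le: "\<bar>- ?S u s - - ?S u r\<bar> \<le> C * (\<omega> s - \<omega> r)" if "u = \<phi> # v \<or> u = \<psi> # w" "a \<le> r" "r \<le> s" "s \<le> t" for u r s
    using C1(2)[of r s] C2(2)[of r s] that mult_right_mono[OF C(2) wm[of r s]] mult_right_mono[OF C(3) wm[of r s]] by auto
  have B: "\<bar>- ?S u s\<bar> \<le> C * (\<omega> t - \<omega> a)" if u: "u = \<phi> # v \<or> u = \<psi> # w" and s: "a \<le> s" "s \<le> t" for u s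
  proof -
    have "?S u t = 0" using u by (auto simp: signature_degenerate simp del: signature.simps)
    then have "\<bar>- ?S u s\<bar> \<le> C * (\<omega> t - \<omega> s)" using le[OF u, of s t] s by simp
    also have "\<dots> \<le> C * (\<omega> t - \<omega> a)" using wm[of a s] s C(1) by (intro mult_left_mono) auto
    finally show ?thesis .
  qed
  have F: "has_differential a t \<omega>
     (\<lambda>x p q. (?S v x * ?d \<phi> p q) * (- ?S (\<psi> # w) x) + (- ?S (\<phi> # v) x) * (?S w x * ?d \<psi> p q))
     (\<lambda>s. (- ?S (\<phi> # v) s) * (- ?S (\<psi> # w) s))"
    by (rule has_differential_mult[OF ct signature_differential[OF c t st(3)] signature_differential[OF c t st(3)],
          where C = C and B = "C * (\<omega> t - \<omega> a)"])
      (use le B C wm[of a t] t in \<open>auto simp del: signature.simps\<close>)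
  have "has_differential a t \<omega>
     (\<lambda>x p q. (\<Sum>u\<leftarrow>shuffle_words v (\<psi> # w). ?S u x * ?d \<phi> p q) + (\<Sum>u\<leftarrow>shuffle_words (\<phi> # v) w. ?S u x * ?d \<psi> p q))
     (\<lambda>s. (\<Sum>u\<leftarrow>shuffle_words v (\<psi> # w). - ?S (\<phi> # u) s) + (\<Sum>u\<leftarrow>shuffle_words (\<phi> # v) w. - ?S (\<psi> # u) s))"
    by (intro has_differential_add has_differential_sum_list ct signature_differential[OF c t st(3)])
  then have G: "has_differential a t \<omega>
     (\<lambda>x p q. (?S v x * ?d \<phi> p q) * ?S (\<psi> # w) x + ?S (\<phi> # v) x * (?S w x * ?d \<psi> p q))
     (\<lambda>s. (\<Sum>u\<leftarrow>shuffle_words v (\<psi> # w). - ?S (\<phi> # u) s) + (\<Sum>u\<leftarrow>shuffle_words (\<phi> # v) w. - ?S (\<psi> # u) s))"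
  proof (rule has_differential_cong)
    fix p x q assume h: "a \<le> p" "p \<le> x" "x \<le> q" "q \<le> t"
    have 1: "(\<Sum>u\<leftarrow>shuffle_words v (\<psi> # w). ?S u x) = ?S v x * ?S (\<psi> # w) x"
      by (rule "3.IH"(1)[symmetric]) (use h in auto)
    have 2: "(\<Sum>u\<leftarrow>shuffle_words (\<phi> # v) w. ?S u x) = ?S (\<phi> # v) x * ?S w x"
      by (rule "3.IH"(2)[symmetric]) (use h in auto)
    show "(\<Sum>u\<leftarrow>shuffle_words v (\<psi> # w). ?S u x * ?d \<phi> p q) + (\<Sum>u\<leftarrow>shuffle_words (\<phi> # v) w. ?S u x * ?d \<psi> p q) =
      (?S v x * ?d \<phi> p q) * ?S (\<psi> # w) x + ?S (\<phi> # v) x * (?S w x * ?d \<psi> p q)"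
      unfolding sum_list_mult_const 1 2 by (simp only: mult.assoc mult.commute mult.left_commute)
  qed simp
  \<comment> \<open>The minus signs of the antiderivatives give \<open>F\<close> and
    \<open>G\<close> opposite differentials; the sum is constant, and it vanishes at
    \<open>s = t\<close>.\<close>
  have "has_differential a t \<omega> (\<lambda>x p q. 0) (\<lambda>s. (- ?S (\<phi> # v) s) * (- ?S (\<psi> # w) s) +
     ((\<Sum>u\<leftarrow>shuffle_words v (\<psi> # w). - ?S (\<phi> # u) s) + (\<Sum>u\<leftarrow>shuffle_words (\<phi> # v) w. - ?S (\<psi> # u) s)))"
    by (rule has_differential_cong[OF has_differential_add[OF F G ct]]) (auto simp: algebra_simps simp del: signature.simps)
  from has_differential_unique[OF this has_differential_const[OF ct, of 0] ct "3.prems" order_refl]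
  have "?S (\<phi> # v) s * ?S (\<psi> # w) s + ((\<Sum>u\<leftarrow>shuffle_words v (\<psi> # w). - ?S (\<phi> # u) s) + (\<Sum>u\<leftarrow>shuffle_words (\<phi> # v) w. - ?S (\<psi> # u) s)) = 0"
    by (simp add: signature_degenerate del: signature.simps)
  moreover have "(\<Sum>u\<leftarrow>us. - f u) = - (\<Sum>u\<leftarrow>us. f u)" for us :: "('v \<Rightarrow>\<^sub>L real) list list" and f :: "('v \<Rightarrow>\<^sub>L real) list \<Rightarrow> real"
    by (induction us) auto
  ultimately show ?case by (simp add: o_def del: signature.simps)
qed simp_all

section \<open>Signatures as multiplicative families\<close>

text \<open>The multiplicative functionals of rough path theory, in the bounded-variation regime.
  Recognising an explicit family as one of them replaces the evaluation of iterated
  integrals.\<close>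

definition multiplicative_family ::
    "real \<Rightarrow> real \<Rightarrow> (real \<Rightarrow> real) \<Rightarrow> (real \<Rightarrow> real \<Rightarrow> 'v::real_normed_vector tensor_series) \<Rightarrow> bool"
  where "multiplicative_family a b \<omega> X \<longleftrightarrow>
    (\<forall>s t u. a \<le> s \<and> s \<le> t \<and> t \<le> u \<and> u \<le> b \<longrightarrow> X s u = tensor_mult (X s t) (X t u)) \<and>
    (\<forall>s t. a \<le> s \<and> s \<le> t \<and> t \<le> b \<longrightarrow> X s t [] = 1) \<and>
    (\<forall>w. \<exists>C. \<forall>s t. a \<le> s \<and> s \<le> t \<and> t \<le> b \<longrightarrow> \<bar>X s t w\<bar> \<le> C * (\<omega> t - \<omega> s) ^ length w)"

lemma multiplicative_familyD:
  assumes "multiplicative_family a b \<omega> X"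
  shows "a \<le> s \<Longrightarrow> s \<le> t \<Longrightarrow> t \<le> u \<Longrightarrow> u \<le> b \<Longrightarrow> X s u = tensor_mult (X s t) (X t u)"
    "a \<le> s \<Longrightarrow> s \<le> t \<Longrightarrow> t \<le> b \<Longrightarrow> X s t [] = 1"
    "\<exists>C. \<forall>s t. a \<le> s \<and> s \<le> t \<and> t \<le> b \<longrightarrow> \<bar>X s t w\<bar> \<le> C * (\<omega> t - \<omega> s) ^ length w"
    "a \<le> s \<Longrightarrow> s \<le> b \<Longrightarrow> w \<noteq> [] \<Longrightarrow> X s s w = 0"
proof -
  show "a \<le> s \<Longrightarrow> s \<le> t \<Longrightarrow> t \<le> u \<Longrightarrow> u \<le> b \<Longrightarrow> X s u = tensor_mult (X s t) (X t u)"
    "a \<le> s \<Longrightarrow> s \<le> t \<Longrightarrow> t \<le> b \<Longrightarrow> X s t [] = 1"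
    using assms unfolding multiplicative_family_def by blast+
  show C: "\<exists>C. \<forall>s t. a \<le> s \<and> s \<le> t \<and> t \<le> b \<longrightarrow> \<bar>X s t w\<bar> \<le> C * (\<omega> t - \<omega> s) ^ length w" for w
    using assms unfolding multiplicative_family_def by blast
  assume h: "a \<le> s" "s \<le> b" "w \<noteq> []"
  obtain C where "\<And>s t. a \<le> s \<Longrightarrow> s \<le> t \<Longrightarrow> t \<le> b \<Longrightarrow> \<bar>X s t w\<bar> \<le> C * (\<omega> t - \<omega> s) ^ length w"
    using C by blast
  from this[of s s] h show "X s s w = 0" by (simp add: power_0_left)
qed

text \<open>Only the two extreme splittings see coefficients of top degree, and there the other
  factor is a constant term \<open>1\<close>.\<close>

lemma tensor_mult_diff_outer:
  fixes x :: "'a::real_normed_vector tensor_series"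
  assumes "length w \<ge> 1" "x [] = 1" "x' [] = 1" "y [] = 1" "y' [] = 1"
    and "\<And>u. length u < length w \<Longrightarrow> x u = x' u" "\<And>u. length u < length w \<Longrightarrow> y u = y' u"
  shows "tensor_mult x y w - tensor_mult x' y' w = (x w - x' w) + (y w - y' w)"
proof -
  obtain n where n: "length w = Suc n" using assms(1) by (cases "length w") auto
  have "tensor_mult x y w = y w + (\<Sum>k<n. x (take (Suc k) w) * y (drop (Suc k) w)) + x w"
    if "x [] = 1" "y [] = 1" for x y :: "'a tensor_series"
  proof -
    have "(\<Sum>k\<le>Suc n. f k) = f 0 + (\<Sum>k<n. f (Suc k)) + f (Suc n)" for f :: "nat \<Rightarrow> real"
      unfolding sum.atMost_Suc by (simp only: lessThan_Suc_atMost[symmetric] sum.lessThan_Suc_shift)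
    then show ?thesis unfolding tensor_mult_def n using that n by simp
  qed
  note e = this
  have "(\<Sum>k<n. x (take (Suc k) w) * y (drop (Suc k) w)) = (\<Sum>k<n. x' (take (Suc k) w) * y' (drop (Suc k) w))"
    by (intro sum.cong refl arg_cong2[where f = "(*)"] assms) (use n in auto)
  then show ?thesis using e[of x y] e[of x' y'] assms by simp
qed

text \<open>The difference of the two families is, in the lowest degree where they might differ, additive in
  the interval, hence it vanishes as it is of second order in \<open>\<omega>\<close>.\<close>

lemma multiplicative_family_unique:
  assumes \<omega>: "control a b \<omega>" and X: "multiplicative_family a b \<omega> X" and Y: "multiplicative_family a b \<omega> Y"
    and deg1: "\<And>s t \<phi>. a \<le> s \<Longrightarrow> s \<le> t \<Longrightarrow> t \<le> b \<Longrightarrow> X s t [\<phi>] = Y s t [\<phi>]"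
    and st: "a \<le> s" "s \<le> t" "t \<le> b"
  shows "X s t = Y s t"
proof
  fix w
  show "X s t w = Y s t w"
    using st
  proof (induction "length w" arbitrary: w s t rule: less_induct)
    case less
    show ?case
    proof (cases "length w < 2")
      case True
      then consider "w = []" | \<phi> where "w = [\<phi>]" by (cases w rule: remdups_adj.cases) auto
      then show ?thesis
        using deg1 multiplicative_familyD(2)[OF X] multiplicative_familyD(2)[OF Y] less.prems by cases auto
    next
      case False
      define D where "D u = X s u w - Y s u w" for u
      have inc: "D v - D u = X u v w - Y u v w" if "s \<le> u" "u \<le> v" "v \<le> t" for u v
      proof -
        have "X s v w - Y s v w = (X s u w - Y s u w) + (X u v w - Y u v w)"
          unfolding multiplicative_familyD(1)[OF X less.prems(1) that(1,2) order_trans[OF that(3) less.prems(3)]]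
            multiplicative_familyD(1)[OF Y less.prems(1) that(1,2) order_trans[OF that(3) less.prems(3)]]
          by (rule tensor_mult_diff_outer)
            (use False less that multiplicative_familyD(2)[OF X] multiplicative_familyD(2)[OF Y] in auto)
        then show ?thesis by (simp add: D_def)
      qed
      obtain C where C: "\<And>u v. a \<le> u \<Longrightarrow> u \<le> v \<Longrightarrow> v \<le> b \<Longrightarrow> \<bar>X u v w\<bar> \<le> C * (\<omega> v - \<omega> u) ^ length w"
        using multiplicative_familyD(3)[OF X, of w] by blast
      obtain C' where C': "\<And>u v. a \<le> u \<Longrightarrow> u \<le> v \<Longrightarrow> v \<le> b \<Longrightarrow> \<bar>Y u v w\<bar> \<le> C' * (\<omega> v - \<omega> u) ^ length w"
        using multiplicative_familyD(3)[OF Y, of w] by blast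
      define K where "K = \<bar>C\<bar> + \<bar>C'\<bar>"
      have K: "\<bar>X u v w - Y u v w\<bar> \<le> K * (\<omega> v - \<omega> u) ^ length w" if "a \<le> u" "u \<le> v" "v \<le> b" for u v
      proof -
        have "(\<omega> v - \<omega> u) ^ length w \<ge> 0" using controlD(3)[OF \<omega> that] by simp
        then have "C * (\<omega> v - \<omega> u) ^ length w \<le> \<bar>C\<bar> * (\<omega> v - \<omega> u) ^ length w"
          "C' * (\<omega> v - \<omega> u) ^ length w \<le> \<bar>C'\<bar> * (\<omega> v - \<omega> u) ^ length w"
          by (intro mult_right_mono; simp)+
        then show ?thesis using C[OF that] C'[OF that] by (simp add: K_def distrib_right)
      qed
      have cs: "control s t \<omega>" by (rule control_subinterval[OF \<omega> less.prems(1,3)])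
      have "has_differential s t \<omega> (\<lambda>x p q. 0) D"
      proof (rule has_differentialI[of K])
        fix \<epsilon> :: real assume e: "\<epsilon> > 0"
        have e': "min \<epsilon> 1 > 0" using e by simp
        obtain d where d: "d > 0" "\<And>p q. s \<le> p \<Longrightarrow> p \<le> q \<Longrightarrow> q \<le> t \<Longrightarrow> q - p < d \<Longrightarrow> \<omega> q - \<omega> p < min \<epsilon> 1"
          using control_uniform[OF cs e'] by blast
        show "\<exists>\<delta>>0. \<forall>p x q. s \<le> p \<longrightarrow> p \<le> x \<longrightarrow> x \<le> q \<longrightarrow> q \<le> t \<longrightarrow> q - p < \<delta> \<longrightarrow>
            \<bar>D q - D p - 0\<bar> \<le> \<epsilon> * (K * (\<omega> q - \<omega> p))"
        proof (intro exI[of _ d] conjI d(1) allI impI)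
          fix p x q assume h: "s \<le> p" "p \<le> x" "x \<le> q" "q \<le> t" "q - p < d"
          define y where "y = \<omega> q - \<omega> p"
          have y: "0 \<le> y" "y \<le> 1" "y \<le> \<epsilon>"
            using controlD(3)[OF cs, of p q] d(2)[of p q] h by (auto simp: y_def)
          \<comment> \<open>Degree at least two makes the increments of \<open>D\<close> quadratic
            in those of \<open>\<omega>\<close>, so the differential of \<open>D\<close> is
            zero.\<close>
          have "y ^ length w \<le> y ^ 2" by (rule power_decreasing) (use False y in auto)
          also have "\<dots> \<le> \<epsilon> * y" using y by (simp add: power2_eq_square mult_right_mono)
          finally have "K * y ^ length w \<le> K * (\<epsilon> * y)" by (intro mult_left_mono) (simp_all add: K_def)
          then show "\<bar>D q - D p - 0\<bar> \<le> \<epsilon> * (K * (\<omega> q - \<omega> p))"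
            using inc[of p q] K[of p q] h less.prems by (simp add: y_def mult.left_commute)
        qed
      qed (use cs in \<open>auto simp: K_def\<close>)
      from has_differential_unique[OF this has_differential_const[OF cs, of 0] cs order_refl less.prems(2) order_refl]
      have "D t = D s" by simp
      moreover have "w \<noteq> []" using False by auto
      then have "D s = 0"
        using multiplicative_familyD(4)[OF X, of s w] multiplicative_familyD(4)[OF Y, of s w] less.prems
        by (simp add: D_def)
      ultimately show ?thesis by (simp add: D_def)
    qed
  qed
qed

lemma multiplicative_family_signature:
  assumes "controlled a b \<omega> \<gamma>"
  shows "multiplicative_family a b \<omega> (\<lambda>s t. signature s t \<gamma>)"
  unfolding multiplicative_family_def
proof (intro conjI allI impI)
  fix s t u assume "a \<le> s \<and> s \<le> t \<and> t \<le> u \<and> u \<le> b"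
  then show "signature s u \<gamma> = tensor_mult (signature s t \<gamma>) (signature t u \<gamma>)"
    using chen[OF assms] by blast
next
  fix w show "\<exists>C. \<forall>s t. a \<le> s \<and> s \<le> t \<and> t \<le> b \<longrightarrow> \<bar>signature s t \<gamma> w\<bar> \<le> C * (\<omega> t - \<omega> s) ^ length w"
    using signature_bound_control[OF assms] by blast
qed simp

lemma multiplicative_family_time_change:
  assumes X: "multiplicative_family a b \<omega> X" and c: "control a b \<omega>"
    and \<theta>: "\<And>s t. c \<le> s \<Longrightarrow> s \<le> t \<Longrightarrow> t \<le> d \<Longrightarrow> a \<le> \<theta> s \<and> \<theta> s \<le> \<theta> t \<and> \<theta> t \<le> b \<and> \<omega> (\<theta> t) - \<omega> (\<theta> s) \<le> \<omega>' t - \<omega>' s"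
  shows "multiplicative_family c d \<omega>' (\<lambda>s t. X (\<theta> s) (\<theta> t))"
  unfolding multiplicative_family_def
proof (intro conjI allI impI)
  fix s t u assume h: "c \<le> s \<and> s \<le> t \<and> t \<le> u \<and> u \<le> d"
  then show "X (\<theta> s) (\<theta> u) = tensor_mult (X (\<theta> s) (\<theta> t)) (X (\<theta> t) (\<theta> u))"
    using multiplicative_familyD(1)[OF X] \<theta>[of s t] \<theta>[of t u] by auto
next
  fix s t assume "c \<le> s \<and> s \<le> t \<and> t \<le> d"
  then show "X (\<theta> s) (\<theta> t) [] = 1" using multiplicative_familyD(2)[OF X] \<theta>[of s t] by auto
next
  fix w
  obtain C where C: "\<And>u v. a \<le> u \<Longrightarrow> u \<le> v \<Longrightarrow> v \<le> b \<Longrightarrow> \<bar>X u v w\<bar> \<le> C * (\<omega> v - \<omega> u) ^ length w"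
    using multiplicative_familyD(3)[OF X, of w] by blast
  show "\<exists>C. \<forall>s t. c \<le> s \<and> s \<le> t \<and> t \<le> d \<longrightarrow> \<bar>X (\<theta> s) (\<theta> t) w\<bar> \<le> C * (\<omega>' t - \<omega>' s) ^ length w"
  proof (intro exI[of _ "\<bar>C\<bar>"] allI impI)
    fix s t assume "c \<le> s \<and> s \<le> t \<and> t \<le> d"
    then have h: "a \<le> \<theta> s" "\<theta> s \<le> \<theta> t" "\<theta> t \<le> b" "\<omega> (\<theta> t) - \<omega> (\<theta> s) \<le> \<omega>' t - \<omega>' s" using \<theta>[of s t] by auto
    have w: "0 \<le> \<omega> (\<theta> t) - \<omega> (\<theta> s)" using controlD(3)[OF c h(1-3)] by simp
    have "\<bar>X (\<theta> s) (\<theta> t) w\<bar> \<le> C * (\<omega> (\<theta> t) - \<omega> (\<theta> s)) ^ length w" by (rule C[OF h(1-3)])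
    also have "\<dots> \<le> \<bar>C\<bar> * (\<omega>' t - \<omega>' s) ^ length w"
      by (intro mult_mono power_mono h w) (use w in auto)
    finally show "\<bar>X (\<theta> s) (\<theta> t) w\<bar> \<le> \<bar>C\<bar> * (\<omega>' t - \<omega>' s) ^ length w" .
  qed
qed

text \<open>By \<open>multiplicative_family_unique\<close> only degree one has to be compared. The
  new path enters through its increments alone, so translated pieces of a concatenation are covered;
  the summand \<open>t\<close> keeps the control strict where \<open>\<theta>\<close> is
  flat.\<close>

lemma signature_time_change:
  assumes c: "controlled a b \<omega> \<gamma>"
    and \<theta>: "continuous_on {c..d} \<theta>" "mono_on {c..d} \<theta>" "\<And>t. c \<le> t \<Longrightarrow> t \<le> d \<Longrightarrow> a \<le> \<theta> t \<and> \<theta> t \<le> b"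
    and inc: "\<And>s t. c \<le> s \<Longrightarrow> s \<le> t \<Longrightarrow> t \<le> d \<Longrightarrow> \<gamma>' t - \<gamma>' s = \<gamma> (\<theta> t) - \<gamma> (\<theta> s)"
  shows "controlled c d (\<lambda>t. \<omega> (\<theta> t) + t) \<gamma>'"
    and "c \<le> s \<Longrightarrow> s \<le> t \<Longrightarrow> t \<le> d \<Longrightarrow> signature s t \<gamma>' = signature (\<theta> s) (\<theta> t) \<gamma>"
proof -
  have mono: "\<theta> s \<le> \<theta> t" if "c \<le> s" "s \<le> t" "t \<le> d" for s t
    using \<theta>(2) that by (auto simp: mono_on_def)
  have rng: "a \<le> \<theta> t" "\<theta> t \<le> b" if "c \<le> t" "t \<le> d" for t using \<theta>(3) that by auto
  have \<omega>m: "\<omega> (\<theta> s) \<le> \<omega> (\<theta> t)" if "c \<le> s" "s \<le> t" "t \<le> d" for s t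
    by (rule controlled_mono[OF c]) (use that rng mono in auto)
  show c': "controlled c d (\<lambda>t. \<omega> (\<theta> t) + t) \<gamma>'"
    unfolding controlled_def
  proof (intro conjI allI impI strict_mono_onI)
    show "continuous_on {c..d} (\<lambda>t. \<omega> (\<theta> t) + t)"
      using rng by (intro continuous_intros continuous_on_compose2[OF controlD(1)[OF controlled_imp_control[OF c]] \<theta>(1)]) auto
  next
    fix s t assume "s \<in> {c..d}" "t \<in> {c..d}" "s < t"
    then show "\<omega> (\<theta> s) + s < \<omega> (\<theta> t) + t" using \<omega>m[of s t] by simp
  next
    fix s t assume h: "c \<le> s \<and> s \<le> t \<and> t \<le> d"
    then have "norm (\<gamma> (\<theta> t) - \<gamma> (\<theta> s)) \<le> \<omega> (\<theta> t) - \<omega> (\<theta> s)"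
      by (intro controlled_increment[OF c] rng mono) auto
    then show "norm (\<gamma>' t - \<gamma>' s) \<le> \<omega> (\<theta> t) + t - (\<omega> (\<theta> s) + s)" using inc[of s t] h by simp
  qed
  show "signature s t \<gamma>' = signature (\<theta> s) (\<theta> t) \<gamma>" if "c \<le> s" "s \<le> t" "t \<le> d"
  proof (rule multiplicative_family_unique[OF controlled_imp_control[OF c'] multiplicative_family_signature[OF c'] _ _ that])
    show "multiplicative_family c d (\<lambda>t. \<omega> (\<theta> t) + t) (\<lambda>s t. signature (\<theta> s) (\<theta> t) \<gamma>)"
      by (rule multiplicative_family_time_change[OF multiplicative_family_signature[OF c] controlled_imp_control[OF c]])
        (use rng mono in auto)
    fix s t \<phi> assume "c \<le> s" "s \<le> t" "t \<le> d"
    then show "signature s t \<gamma>' [\<phi>] = signature (\<theta> s) (\<theta> t) \<gamma> [\<phi>]"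
      using mono[of s t] inc[of s t] by (simp add: signature_degree_one del: signature.simps)
  qed
qed

lemma signature_cong:
  assumes c: "controlled a b \<omega> \<gamma>" and inc: "\<And>s t. a \<le> s \<Longrightarrow> s \<le> t \<Longrightarrow> t \<le> b \<Longrightarrow> \<gamma>' t - \<gamma>' s = \<gamma> t - \<gamma> s"
  shows "controlled a b \<omega> \<gamma>'" "a \<le> s \<Longrightarrow> s \<le> t \<Longrightarrow> t \<le> b \<Longrightarrow> signature s t \<gamma>' = signature s t \<gamma>"
proof -
  have "norm (\<gamma>' t - \<gamma>' s) \<le> \<omega> t - \<omega> s" if "a \<le> s" "s \<le> t" "t \<le> b" for s t
    unfolding inc[OF that] by (rule controlled_increment[OF c that])
  then show "controlled a b \<omega> \<gamma>'" using c unfolding controlled_def by blast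
  show "a \<le> s \<Longrightarrow> s \<le> t \<Longrightarrow> t \<le> b \<Longrightarrow> signature s t \<gamma>' = signature s t \<gamma>"
    using signature_time_change(2)[OF c, of a b "\<lambda>t. t" \<gamma>' s t] inc by (simp add: mono_on_def)
qed

section \<open>Concatenation, reversal and straight segments\<close>

lemma controlled_join:
  assumes "controlled a c \<omega>1 \<gamma>" "controlled c b \<omega>2 \<gamma>" "a \<le> c" "c \<le> b"
  shows "\<exists>\<omega>. controlled a b \<omega> \<gamma>"
proof
  \<comment> \<open>The second control is shifted to match the first at \<open>c\<close>.\<close>
  define \<omega> where "\<omega> t = (if t \<le> c then \<omega>1 t else \<omega>2 t + (\<omega>1 c - \<omega>2 c))" for t

  have s1: "\<omega>1 s < \<omega>1 t" if "a \<le> s" "s < t" "t \<le> c" for s t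
    using controlD(2)[OF controlled_imp_control[OF assms(1)] that] .
  have s2: "\<omega>2 s < \<omega>2 t" if "c \<le> s" "s < t" "t \<le> b" for s t
    using controlD(2)[OF controlled_imp_control[OF assms(2)] that] .
  show "controlled a b \<omega> \<gamma>"
    unfolding controlled_def
  proof (intro conjI allI impI strict_mono_onI)
    have "continuous_on ({a..c} \<union> {c..b}) (\<lambda>t. if t \<le> c then \<omega>1 t else \<omega>2 t + (\<omega>1 c - \<omega>2 c))"
      by (rule continuous_on_cases)
        (use controlD(1)[OF controlled_imp_control[OF assms(1)]] controlD(1)[OF controlled_imp_control[OF assms(2)]]
          in \<open>auto intro!: continuous_intros\<close>)
    moreover have "{a..c} \<union> {c..b} = {a..b}" using assms(3,4) by auto
    ultimately show "continuous_on {a..b} \<omega>" by (simp add: \<omega>_def[abs_def])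
  next
    fix s t assume h: "s \<in> {a..b}" "t \<in> {a..b}" "s < t"
    consider "t \<le> c" | "c < s" | "s = c" | "s < c" "c < t" by linarith
    then show "\<omega> s < \<omega> t"
    proof cases
      case 1 then show ?thesis using s1[of s t] h by (simp add: \<omega>_def)
    next
      case 2 then show ?thesis using s2[of s t] h by (simp add: \<omega>_def)
    next
      case 3 then show ?thesis using s2[of s t] h by (simp add: \<omega>_def)
    next
      case 4 then show ?thesis using s1[of s c] s2[of c t] h by (simp add: \<omega>_def)
    qed
  next
    fix s t assume h: "a \<le> s \<and> s \<le> t \<and> t \<le> b"
    consider "t \<le> c" | "c < s" | "s \<le> c" "c < t" by linarith
    then show "norm (\<gamma> t - \<gamma> s) \<le> \<omega> t - \<omega> s"
    proof cases
      case 1 then show ?thesis using controlled_increment[OF assms(1), of s t] h by (simp add: \<omega>_def)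
    next
      case 2 then show ?thesis using controlled_increment[OF assms(2), of s t] h by (simp add: \<omega>_def)
    next
      case 3
      have "norm (\<gamma> t - \<gamma> s) \<le> norm (\<gamma> t - \<gamma> c) + norm (\<gamma> c - \<gamma> s)"
        using norm_triangle_ineq[of "\<gamma> t - \<gamma> c" "\<gamma> c - \<gamma> s"] by simp
      then show ?thesis
        using controlled_increment[OF assms(1), of s c] controlled_increment[OF assms(2), of c t] h 3
        by (simp add: \<omega>_def)
    qed
  qed
qed

lemma bv_path_controlled:
  assumes "bv_path A \<gamma>"
  obtains \<omega> where "0 \<le> A" "controlled 0 A \<omega> \<gamma>"
  using assms unfolding bv_path_iff_controlled by blast

lemma bv_path_concat:
  assumes \<alpha>: "bv_path A \<alpha>" and \<beta>: "bv_path B \<beta>"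
  shows "bv_path (A + B) (path_concat A \<alpha> \<beta>)"
    and "0 \<le> s \<Longrightarrow> s \<le> t \<Longrightarrow> t \<le> A \<Longrightarrow> signature s t (path_concat A \<alpha> \<beta>) = signature s t \<alpha>"
    and "A \<le> s \<Longrightarrow> s \<le> t \<Longrightarrow> t \<le> A + B \<Longrightarrow> signature s t (path_concat A \<alpha> \<beta>) = signature (s - A) (t - A) \<beta>"
    and "0 \<le> t \<Longrightarrow> t \<le> B \<Longrightarrow> signature 0 (A + t) (path_concat A \<alpha> \<beta>) = tensor_mult (signature 0 A \<alpha>) (signature 0 t \<beta>)"
proof -
  obtain \<omega>1 where A: "0 \<le> A" and c1: "controlled 0 A \<omega>1 \<alpha>" using \<alpha> by (rule bv_path_controlled)
  obtain \<omega>2 where B: "0 \<le> B" and c2: "controlled 0 B \<omega>2 \<beta>" using \<beta> by (rule bv_path_controlled)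
  let ?\<eta> = "path_concat A \<alpha> \<beta>"
  have i1: "?\<eta> t - ?\<eta> s = \<alpha> t - \<alpha> s" if "0 \<le> s" "s \<le> t" "t \<le> A" for s t
    using that by (simp add: path_concat_def)
  have i2: "?\<eta> t - ?\<eta> s = \<beta> (t - A) - \<beta> (s - A)" if "A \<le> s" "s \<le> t" "t \<le> A + B" for s t
    using that by (cases "t = A"; cases "s = A") (simp_all add: path_concat_def)
  have \<theta>: "continuous_on {A..A + B} (\<lambda>t. t - A)" "mono_on {A..A + B} (\<lambda>t. t - A)"
    "\<And>t. A \<le> t \<Longrightarrow> t \<le> A + B \<Longrightarrow> 0 \<le> t - A \<and> t - A \<le> B"
    by (auto intro!: continuous_intros simp: mono_on_def)
  note 1 = signature_cong(1)[OF c1 i1] and s1 = signature_cong(2)[OF c1 i1]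
  note 2 = signature_time_change(1)[OF c2 \<theta> i2] and s2 = signature_time_change(2)[OF c2 \<theta> i2]
  show "0 \<le> s \<Longrightarrow> s \<le> t \<Longrightarrow> t \<le> A \<Longrightarrow> signature s t ?\<eta> = signature s t \<alpha>" using s1 by blast
  show "A \<le> s \<Longrightarrow> s \<le> t \<Longrightarrow> t \<le> A + B \<Longrightarrow> signature s t ?\<eta> = signature (s - A) (t - A) \<beta>" using s2 by blast
  obtain \<omega> where \<omega>: "controlled 0 (A + B) \<omega> ?\<eta>"
    using controlled_join[OF 1 2] A B by auto
  then show "bv_path (A + B) ?\<eta>" unfolding bv_path_iff_controlled using A B by (auto intro: add_nonneg_nonneg)
  assume "0 \<le> t" "t \<le> B"
  then show "signature 0 (A + t) ?\<eta> = tensor_mult (signature 0 A \<alpha>) (signature 0 t \<beta>)"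
    using chen[OF \<omega>, of 0 A "A + t"] s1[of 0 A] s2[of A "A + t"] A by simp
qed

text \<open>Every term in the recursion for the inverse has the total degree as its order in
  \<open>r\<close>, so the growth required of a multiplicative family passes to inverses.\<close>

lemma tensor_inv_bound:
  fixes X :: "'i \<Rightarrow> 'v::real_normed_vector tensor_series" and r :: "'i \<Rightarrow> real"
  assumes "\<And>w. \<exists>C. \<forall>i\<in>I. \<bar>X i w\<bar> \<le> C * r i ^ length w" "\<And>i. i \<in> I \<Longrightarrow> 0 \<le> r i"
  shows "\<exists>C. \<forall>i\<in>I. \<bar>tensor_inv (X i) w\<bar> \<le> C * r i ^ length w"
proof (induction "length w" arbitrary: w rule: less_induct)
  case less
  show ?case
  proof (cases "w = []")
    case True then show ?thesis by (intro exI[of _ 1]) simp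
  next
    case False
    obtain C where C: "\<And>w i. i \<in> I \<Longrightarrow> \<bar>X i w\<bar> \<le> C w * r i ^ length w" using assms(1) by metis
    have "\<forall>k\<in>{..<length w}. \<exists>C. \<forall>i\<in>I. \<bar>tensor_inv (X i) (take k w)\<bar> \<le> C * r i ^ k"
    proof
      fix k assume "k \<in> {..<length w}"
      then show "\<exists>C. \<forall>i\<in>I. \<bar>tensor_inv (X i) (take k w)\<bar> \<le> C * r i ^ k"
        using less[of "take k w"] by (simp add: min_def)
    qed
    then obtain C' where C': "\<And>k i. k < length w \<Longrightarrow> i \<in> I \<Longrightarrow> \<bar>tensor_inv (X i) (take k w)\<bar> \<le> C' k * r i ^ k"
      by (auto dest!: bchoice)
    have "\<bar>tensor_inv (X i) w\<bar> \<le> (\<Sum>k<length w. \<bar>C' k\<bar> * \<bar>C (drop k w)\<bar>) * r i ^ length w" if i: "i \<in> I" for i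
    proof -
      have r: "0 \<le> r i ^ k" for k using assms(2)[OF i] by simp
      have "\<bar>tensor_inv (X i) w\<bar> = \<bar>\<Sum>k<length w. tensor_inv (X i) (take k w) * X i (drop k w)\<bar>"
        by (subst tensor_inv.simps) (use False in simp)
      also have "\<dots> \<le> (\<Sum>k<length w. \<bar>tensor_inv (X i) (take k w)\<bar> * \<bar>X i (drop k w)\<bar>)"
        unfolding abs_mult[symmetric] by (rule sum_abs)
      also have "\<dots> \<le> (\<Sum>k<length w. (\<bar>C' k\<bar> * r i ^ k) * (\<bar>C (drop k w)\<bar> * r i ^ (length w - k)))"
      proof (intro sum_mono mult_mono)
        fix k assume k: "k \<in> {..<length w}"
        have "\<bar>tensor_inv (X i) (take k w)\<bar> \<le> C' k * r i ^ k" using C' i k by simp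
        also have "\<dots> \<le> \<bar>C' k\<bar> * r i ^ k" by (intro mult_right_mono r) simp
        finally show "\<bar>tensor_inv (X i) (take k w)\<bar> \<le> \<bar>C' k\<bar> * r i ^ k" .
        have "\<bar>X i (drop k w)\<bar> \<le> C (drop k w) * r i ^ (length w - k)" using C[OF i, of "drop k w"] by simp
        also have "\<dots> \<le> \<bar>C (drop k w)\<bar> * r i ^ (length w - k)" by (intro mult_right_mono r) simp
        finally show "\<bar>X i (drop k w)\<bar> \<le> \<bar>C (drop k w)\<bar> * r i ^ (length w - k)" .
      qed (use r in auto)
      also have "\<dots> = (\<Sum>k<length w. \<bar>C' k\<bar> * \<bar>C (drop k w)\<bar>) * r i ^ length w"
        unfolding sum_distrib_right
      proof (intro sum.cong refl)
        fix k assume "k \<in> {..<length w}"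
        then have "r i ^ k * r i ^ (length w - k) = r i ^ length w" by (simp add: power_add[symmetric])
        then show "(\<bar>C' k\<bar> * r i ^ k) * (\<bar>C (drop k w)\<bar> * r i ^ (length w - k)) = \<bar>C' k\<bar> * \<bar>C (drop k w)\<bar> * r i ^ length w"
          by (metis mult.assoc mult.left_commute)
      qed
      finally show ?thesis .
    qed
    then show ?thesis by blast
  qed
qed

lemma tensor_inv_degree_one: "x [] = 1 \<Longrightarrow> tensor_inv x [\<phi>] = - x [\<phi>]"
  by (subst tensor_inv.simps) simp

text \<open>Inversion reverses products just as time reversal reverses the order of intervals, so
  the inverses form a multiplicative family; in degree one inversion is a change of sign, as for the
  reversed increments.\<close>

lemma bv_path_reverse:
  assumes \<alpha>: "bv_path A \<alpha>"
  shows "bv_path A (path_reverse A \<alpha>)"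
    and "0 \<le> s \<Longrightarrow> s \<le> t \<Longrightarrow> t \<le> A \<Longrightarrow> signature s t (path_reverse A \<alpha>) = tensor_inv (signature (A - t) (A - s) \<alpha>)"
proof -
  obtain \<omega> where A: "0 \<le> A" and c: "controlled 0 A \<omega> \<alpha>" using \<alpha> by (rule bv_path_controlled)
  define \<omega>' where "\<omega>' t = - \<omega> (A - t)" for t
  have c': "controlled 0 A \<omega>' (path_reverse A \<alpha>)"
    unfolding controlled_def
  proof (intro conjI allI impI strict_mono_onI)
    show "continuous_on {0..A} \<omega>'" unfolding \<omega>'_def
      by (intro continuous_intros continuous_on_compose2[OF controlD(1)[OF controlled_imp_control[OF c]]]) auto
  next
    fix s t assume "s \<in> {0..A}" "t \<in> {0..A}" "s < t"
    then show "\<omega>' s < \<omega>' t" using controlD(2)[OF controlled_imp_control[OF c], of "A - t" "A - s"] by (simp add: \<omega>'_def)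
  next
    fix s t assume "0 \<le> s \<and> s \<le> t \<and> t \<le> A"
    then show "norm (path_reverse A \<alpha> t - path_reverse A \<alpha> s) \<le> \<omega>' t - \<omega>' s"
      using controlled_increment[OF c, of "A - t" "A - s"] by (simp add: \<omega>'_def path_reverse_def norm_minus_commute)
  qed
  then show "bv_path A (path_reverse A \<alpha>)" using A unfolding bv_path_iff_controlled by blast
  let ?X = "\<lambda>s t. tensor_inv (signature (A - t) (A - s) \<alpha>)"
  have "multiplicative_family 0 A \<omega>' ?X"
    unfolding multiplicative_family_def
  proof (intro conjI allI impI)
    fix s t u assume "0 \<le> s \<and> s \<le> t \<and> t \<le> u \<and> u \<le> A"
    then show "?X s u = tensor_mult (?X s t) (?X t u)"
      using chen[OF c, of "A - u" "A - t" "A - s"] by (simp add: tensor_inv_mult)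
  next
    fix w
    let ?I = "{(s, t). 0 \<le> s \<and> s \<le> t \<and> t \<le> A}"
    have "\<exists>C. \<forall>i\<in>?I. \<bar>tensor_inv (case i of (s, t) \<Rightarrow> signature (A - t) (A - s) \<alpha>) w\<bar> \<le> C * (case i of (s, t) \<Rightarrow> \<omega>' t - \<omega>' s) ^ length w"
    proof (rule tensor_inv_bound)
      fix w show "\<exists>C. \<forall>i\<in>?I. \<bar>(case i of (s, t) \<Rightarrow> signature (A - t) (A - s) \<alpha>) w\<bar> \<le> C * (case i of (s, t) \<Rightarrow> \<omega>' t - \<omega>' s) ^ length w"
        using signature_bound_control[OF c] by (intro exI[of _ "word_norm w"]) (auto simp: \<omega>'_def)
    qed (use controlled_mono[OF c'] in auto)
    then show "\<exists>C. \<forall>s t. 0 \<le> s \<and> s \<le> t \<and> t \<le> A \<longrightarrow> \<bar>?X s t w\<bar> \<le> C * (\<omega>' t - \<omega>' s) ^ length w"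
      by auto
  qed simp
  note X = this
  show "signature s t (path_reverse A \<alpha>) = ?X s t" if "0 \<le> s" "s \<le> t" "t \<le> A"
  proof (rule multiplicative_family_unique[OF controlled_imp_control[OF c'] multiplicative_family_signature[OF c'] X _ that])
    fix s t \<phi> assume "0 \<le> s" "s \<le> t" "t \<le> A"
    then show "signature s t (path_reverse A \<alpha>) [\<phi>] = ?X s t [\<phi>]"
      by (simp add: tensor_inv_degree_one signature_degree_one path_reverse_def blinfun.diff_right del: signature.simps(2))
  qed
qed

lemma tensor_exp_Nil [simp]: "tensor_exp v [] = 1"
  by (simp add: tensor_exp_def)

lemma tensor_exp_scaleR: "tensor_exp (c *\<^sub>R v) w = c ^ length w * tensor_exp v w"
proof -
  have "(\<Prod>\<phi>\<leftarrow>w. blinfun_apply \<phi> (c *\<^sub>R v)) = c ^ length w * (\<Prod>\<phi>\<leftarrow>w. blinfun_apply \<phi> v)"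
    by (induction w) (simp_all add: blinfun.scaleR_right)
  then show ?thesis by (simp add: tensor_exp_def)
qed

text \<open>On each word this is the binomial theorem, since all terms are multiples of the same
  product \<open>P\<close>.\<close>

lemma tensor_exp_add:
  fixes v :: "'v::real_normed_vector"
  shows "tensor_mult (tensor_exp (c *\<^sub>R v)) (tensor_exp (d *\<^sub>R v)) = tensor_exp ((c + d) *\<^sub>R v)"
proof
  fix w :: "('v \<Rightarrow>\<^sub>L real) list"
  define P where "P = (\<Prod>\<phi>\<leftarrow>w. blinfun_apply \<phi> v)"
  have P: "(\<Prod>\<phi>\<leftarrow>take k w. blinfun_apply \<phi> v) * (\<Prod>\<phi>\<leftarrow>drop k w. blinfun_apply \<phi> v) = P" for k
    unfolding P_def prod_list.append[symmetric] map_append[symmetric] by simp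
  have "tensor_mult (tensor_exp (c *\<^sub>R v)) (tensor_exp (d *\<^sub>R v)) w =
      (\<Sum>k\<le>length w. P / fact (length w) * (of_nat (length w choose k) * c ^ k * d ^ (length w - k)))"
    unfolding tensor_mult_def
  proof (intro sum.cong refl)
    fix k assume k: "k \<in> {..length w}"
    have "tensor_exp (c *\<^sub>R v) (take k w) * tensor_exp (d *\<^sub>R v) (drop k w) =
        P * (c ^ k * d ^ (length w - k)) / (fact k * fact (length w - k))"
      unfolding tensor_exp_scaleR tensor_exp_def[of v] P[of k, symmetric] using k by (simp add: min_absorb2)
    also have "\<dots> = P / fact (length w) * (of_nat (length w choose k) * c ^ k * d ^ (length w - k))"
      using k by (simp add: binomial_fact)
    finally show "tensor_exp (c *\<^sub>R v) (take k w) * tensor_exp (d *\<^sub>R v) (drop k w) =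
        P / fact (length w) * (of_nat (length w choose k) * c ^ k * d ^ (length w - k))" .
  qed
  also have "\<dots> = P / fact (length w) * (c + d) ^ length w"
    unfolding sum_distrib_left[symmetric] binomial_ring[of c d] ..
  also have "\<dots> = tensor_exp ((c + d) *\<^sub>R v) w"
    unfolding tensor_exp_scaleR by (simp add: tensor_exp_def[of v] P_def)
  finally show "tensor_mult (tensor_exp (c *\<^sub>R v)) (tensor_exp (d *\<^sub>R v)) w = tensor_exp ((c + d) *\<^sub>R v) w" .
qed

lemma tensor_exp_zero: "tensor_exp 0 = tensor_one"
proof
  show "tensor_exp 0 w = tensor_one w" for w
    using tensor_exp_scaleR[of 0 0 w] by (cases w) auto
qed

text \<open>The summand \<open>1\<close> keeps the control strict for \<open>v = 0\<close>, the case
  used for constant paths.\<close>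

lemma controlled_linear: "controlled a b (\<lambda>t. (norm v + 1) * t) (\<lambda>t. t *\<^sub>R v)"
  unfolding controlled_def
proof (intro conjI allI impI strict_mono_onI)
  show "continuous_on {a..b} (\<lambda>t. (norm v + 1) * t)" by (intro continuous_intros)
  fix s t :: real assume "s < t"
  then show "(norm v + 1) * s < (norm v + 1) * t" by (intro mult_strict_left_mono) (auto simp: add_nonneg_pos)
next
  fix s t :: real assume "a \<le> s \<and> s \<le> t \<and> t \<le> b"
  moreover have "norm (t *\<^sub>R v - s *\<^sub>R v) = \<bar>t - s\<bar> * norm v"
    unfolding scaleR_diff_left[symmetric] norm_scaleR ..
  ultimately show "norm (t *\<^sub>R v - s *\<^sub>R v) \<le> (norm v + 1) * t - (norm v + 1) * s"
    by (simp add: algebra_simps)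
qed

lemma signature_linear:
  assumes "s \<le> t"
  shows "signature s t (\<lambda>t. t *\<^sub>R v) = tensor_exp ((t - s) *\<^sub>R v)"
proof -
  note c = controlled_linear[of s t v]
  have X: "multiplicative_family s t (\<lambda>t. (norm v + 1) * t) (\<lambda>s t. tensor_exp ((t - s) *\<^sub>R v))"
    unfolding multiplicative_family_def
  proof (intro conjI allI impI)
    fix p q r show "tensor_exp ((r - p) *\<^sub>R v) = tensor_mult (tensor_exp ((q - p) *\<^sub>R v)) (tensor_exp ((r - q) *\<^sub>R v))"
      by (simp add: tensor_exp_add)
  next
    fix w
    show "\<exists>C. \<forall>p q. s \<le> p \<and> p \<le> q \<and> q \<le> t \<longrightarrow> \<bar>tensor_exp ((q - p) *\<^sub>R v) w\<bar> \<le> C * ((norm v + 1) * q - (norm v + 1) * p) ^ length w"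
    proof (intro exI[of _ "\<bar>tensor_exp v w\<bar>"] allI impI)
      fix p q assume h: "s \<le> p \<and> p \<le> q \<and> q \<le> t"
      have "(q - p) ^ length w \<le> ((norm v + 1) * q - (norm v + 1) * p) ^ length w"
      proof (rule power_mono)
        have "0 \<le> norm v * (q - p)" using h by simp
        then show "q - p \<le> (norm v + 1) * q - (norm v + 1) * p" by (simp add: algebra_simps)
      qed (use h in simp)
      then show "\<bar>tensor_exp ((q - p) *\<^sub>R v) w\<bar> \<le> \<bar>tensor_exp v w\<bar> * ((norm v + 1) * q - (norm v + 1) * p) ^ length w"
        using h by (simp add: tensor_exp_scaleR abs_mult mult.commute mult_left_mono)
    qed
  qed simp
  show ?thesis
  proof (rule multiplicative_family_unique[OF controlled_imp_control[OF c] multiplicative_family_signature[OF c] X _ order_refl assms order_refl])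
    fix p q \<phi> assume "s \<le> p" "p \<le> q" "q \<le> t"
    then show "signature p q (\<lambda>t. t *\<^sub>R v) [\<phi>] = tensor_exp ((q - p) *\<^sub>R v) [\<phi>]"
      by (simp add: signature_degree_one tensor_exp_def scaleR_diff_left[symmetric] blinfun.scaleR_right del: signature.simps(2))
  qed
qed

lemma bv_path_linear: "0 \<le> A \<Longrightarrow> bv_path A (\<lambda>t. t *\<^sub>R v)"
  unfolding bv_path_iff_controlled using controlled_linear by blast

section \<open>The group of signatures\<close>

lemma sig_group_simps [simp]:
  "mult sig_group = tensor_mult" "one sig_group = tensor_one"
  by (simp_all add: sig_group_def)

lemma sig_groupI: "bv_path A \<eta> \<Longrightarrow> signature 0 A \<eta> \<in> carrier sig_group"
  by (auto simp: sig_group_def)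

lemma sig_groupE:
  assumes "g \<in> carrier sig_group"
  obtains A \<eta> where "bv_path A \<eta>" "g = signature 0 A \<eta>"
  using assms by (auto simp: sig_group_def)

lemma sig_group_Nil: "g \<in> carrier sig_group \<Longrightarrow> g [] = 1"
  by (auto elim: sig_groupE)

lemma tensor_inv_in_sig_group:
  assumes "g \<in> carrier sig_group"
  shows "tensor_inv g \<in> carrier sig_group"
proof -
  obtain A \<eta> where \<eta>: "bv_path A \<eta>" "g = signature 0 A \<eta>" using assms by (rule sig_groupE)
  then have "0 \<le> A" by (simp add: bv_path_def)
  then have "tensor_inv g = signature 0 A (path_reverse A \<eta>)" using bv_path_reverse(2)[OF \<eta>(1), of 0 A] \<eta> by simp
  then show ?thesis using sig_groupI[OF bv_path_reverse(1)[OF \<eta>(1)]] by simp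
qed

lemma group_sig_group: "group sig_group"
proof (rule groupI)
  fix x y :: "'a tensor_series" assume "x \<in> carrier sig_group" "y \<in> carrier sig_group"
  then obtain A \<alpha> B \<beta> where h: "bv_path A \<alpha>" "x = signature 0 A \<alpha>" "bv_path B \<beta>" "y = signature 0 B \<beta>"
    by (meson sig_groupE)
  then have "0 \<le> B" by (simp add: bv_path_def)
  then have "x \<otimes>\<^bsub>sig_group\<^esub> y = signature 0 (A + B) (path_concat A \<alpha> \<beta>)"
    using bv_path_concat(4)[OF h(1,3), of B] h by simp
  then show "x \<otimes>\<^bsub>sig_group\<^esub> y \<in> carrier sig_group" using sig_groupI[OF bv_path_concat(1)[OF h(1,3)]] by simp
next
  have "bv_path 0 (\<lambda>t. t *\<^sub>R 0 :: 'a)" by (rule bv_path_linear) simp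
  from sig_groupI[OF this] show "\<one>\<^bsub>sig_group\<^esub> \<in> carrier (sig_group :: 'a tensor_series monoid)"
    by (simp add: signature_degenerate)
next
  fix x :: "'a tensor_series" assume x: "x \<in> carrier sig_group"
  then show "\<exists>y\<in>carrier sig_group. y \<otimes>\<^bsub>sig_group\<^esub> x = \<one>\<^bsub>sig_group\<^esub>"
    using tensor_inv_in_sig_group[OF x] tensor_inv_left[of x, OF sig_group_Nil[OF x]] by auto
qed (simp_all add: tensor_mult_assoc)

lemma sig_group_inv:
  assumes "g \<in> carrier sig_group"
  shows "inv\<^bsub>sig_group\<^esub> g = tensor_inv g"
  using group.inv_equality[OF group_sig_group, of "tensor_inv g" g] assms tensor_inv_in_sig_group[OF assms]
    tensor_inv_left[of g, OF sig_group_Nil[OF assms]] by simp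

section \<open>The shuffle algebra on a compact set of characters\<close>

lemma open_coordinate_vimage:
  "open W \<Longrightarrow> open ((\<lambda>f::'a \<Rightarrow> 'b::topological_space. f i) -` W)"
  by (intro open_vimage continuous_on_product_coordinates)

text \<open>The Stone--Weierstrass locale \<open>function_ring_on\<close> asks for a Hausdorff type
  of points; the two weaker separation axioms are the superclasses on the way.\<close>

instance "fun" :: (type, t0_space) t0_space
proof
  fix x y :: "'a \<Rightarrow> 'b" assume "x \<noteq> y"
  then obtain i where "x i \<noteq> y i" by auto
  from Topological_Spaces.t0_space[OF this] obtain U where U: "open U" "(x i \<in> U) \<noteq> (y i \<in> U)" by blast
  then show "\<exists>U. open U \<and> \<not> (x \<in> U \<longleftrightarrow> y \<in> U)"
    using open_coordinate_vimage[OF U(1), of i] by (intro exI[of _ "(\<lambda>f. f i) -` U"]) auto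
qed

instance "fun" :: (type, t1_space) t1_space
proof
  fix x y :: "'a \<Rightarrow> 'b" assume "x \<noteq> y"
  then obtain i where "x i \<noteq> y i" by auto
  from Topological_Spaces.t1_space[OF this] obtain U where U: "open U" "x i \<in> U" "y i \<notin> U" by blast
  then show "\<exists>U. open U \<and> x \<in> U \<and> y \<notin> U"
    using open_coordinate_vimage[OF U(1), of i] by (intro exI[of _ "(\<lambda>f. f i) -` U"]) auto
qed

instance "fun" :: (type, t2_space) t2_space
proof
  fix x y :: "'a \<Rightarrow> 'b" assume "x \<noteq> y"
  then obtain i where "x i \<noteq> y i" by auto
  then obtain U V where UV: "open U" "open V" "x i \<in> U" "y i \<in> V" "U \<inter> V = {}" using hausdorff by metis
  then show "\<exists>U V. open U \<and> open V \<and> x \<in> U \<and> y \<in> V \<and> U \<inter> V = {}"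
    using open_coordinate_vimage[OF UV(1), of i] open_coordinate_vimage[OF UV(2), of i]
    by (intro exI[of _ "(\<lambda>f. f i) -` U"] exI[of _ "(\<lambda>f. f i) -` V"]) auto
qed

lemma continuous_on_coordinate [continuous_intros]: "continuous_on S (\<lambda>x::'a \<Rightarrow> 'b::topological_space. x i)"
  by (rule continuous_on_subset[OF continuous_on_product_coordinates subset_UNIV])

text \<open>Tychonoff's theorem for a product of compact intervals.\<close>

lemma compact_box: "compact {x::'i \<Rightarrow> real. \<forall>i. \<bar>x i\<bar> \<le> c i}"
proof -
  have "compactin (product_topology (\<lambda>_. euclidean) UNIV) (PiE UNIV (\<lambda>i. {- c i..c i}))"
    unfolding compactin_PiE by (rule disjI2) simp
  moreover have iff: "y \<in> {- b..b} \<longleftrightarrow> \<bar>y\<bar> \<le> b" for y b :: real by auto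
  have "PiE UNIV (\<lambda>i. {- c i..c i}) = {x. \<forall>i. \<bar>x i\<bar> \<le> c i}"
    unfolding PiE_UNIV_domain Pi_def iff by simp
  ultimately show ?thesis by (simp add: euclidean_product_topology)
qed

section \<open>Norms and functionals on a finite-dimensional space\<close>

definition seminorm :: "('v::real_vector \<Rightarrow> real) \<Rightarrow> bool"
  where "seminorm G \<longleftrightarrow> (\<forall>x y. G (x + y) \<le> G x + G y) \<and> (\<forall>c x. G (c *\<^sub>R x) = \<bar>c\<bar> * G x)"

lemma seminorm_sum_le:
  assumes "seminorm G"
  shows "G (\<Sum>i\<in>I. c i *\<^sub>R f i) \<le> (\<Sum>i\<in>I. \<bar>c i\<bar> * G (f i))"
proof -
  have z: "G 0 = 0" using assms unfolding seminorm_def by (metis abs_zero mult_zero_left scaleR_zero_left)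
  have "G (\<Sum>i\<in>I. g i) \<le> (\<Sum>i\<in>I. G (g i))" for g
  proof (induction I rule: infinite_finite_induct)
    case (insert i I)
    have "G (g i + (\<Sum>i\<in>I. g i)) \<le> G (g i) + G (\<Sum>i\<in>I. g i)" using assms unfolding seminorm_def by blast
    then show ?case using insert by simp
  qed (simp_all add: z)
  from this[of "\<lambda>i. c i *\<^sub>R f i"] show ?thesis using assms unfolding seminorm_def by simp
qed

text \<open>Equivalence of norms from a finite spanning set alone. In coordinates for a basis,
  \<open>N\<close> is continuous and positive on the compact unit sphere of the sum norm; its
  minimum there bounds the coordinates of any vector by \<open>N\<close>.\<close>

lemma finite_dim_dominated:
  fixes G N :: "'v::real_vector \<Rightarrow> real"
  assumes fd: "\<exists>B::'v set. finite B \<and> span B = UNIV" and N: "norm_like N" and G: "seminorm G"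
  obtains C where "C \<ge> 0" "\<And>x. G x \<le> C * N x"
proof -
  obtain B0 :: "'v set" where B0: "finite B0" "span B0 = UNIV" using fd by blast
  obtain B where B: "B \<subseteq> B0" "independent B" "B0 \<subseteq> span B"
    using real_vector.maximal_independent_subset[of B0] by blast
  have fB: "finite B" using B(1) B0(1) by (rule finite_subset)
  have sB: "span B = UNIV" using B(3) B0(2) by (metis span_mono span_span top.extremum_uniqueI)
  define \<Phi> where "\<Phi> c = (\<Sum>b\<in>B. c b *\<^sub>R b)" for c :: "'v \<Rightarrow> real"
  have sN: "seminorm N" by (simp add: seminorm_def norm_likeD(1,2)[OF N])
  \<comment> \<open>Coordinates off the basis are forced to be \<open>0\<close>, which makes
    \<open>K\<close> a closed subset of a compact box.\<close>
  define K where "K = {c::'v \<Rightarrow> real. \<forall>b. \<bar>c b\<bar> \<le> (if b \<in> B then 1 else 0)} \<inter> {c. (\<Sum>b\<in>B. \<bar>c b\<bar>) = 1}"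
  have "closed {c::'v \<Rightarrow> real. (\<Sum>b\<in>B. \<bar>c b\<bar>) = 1}"
    by (rule closed_Collect_eq) (intro continuous_intros)+
  then have K: "compact K" unfolding K_def by (intro compact_Int_closed compact_box)
  have cont: "continuous_on UNIV (\<lambda>c. N (\<Phi> c))"
    unfolding continuous_on_def
  proof
    fix d :: "'v \<Rightarrow> real"
    have le: "\<bar>N (\<Phi> c) - N (\<Phi> d)\<bar> \<le> (\<Sum>b\<in>B. \<bar>c b - d b\<bar> * N b)" for c
    proof -
      have "\<Phi> c - \<Phi> d = (\<Sum>b\<in>B. (c b - d b) *\<^sub>R b)" by (simp add: \<Phi>_def scaleR_diff_left sum_subtractf)
      then have "N (\<Phi> c - \<Phi> d) \<le> (\<Sum>b\<in>B. \<bar>c b - d b\<bar> * N b)"        using seminorm_sum_le[OF sN, of "\<lambda>b. c b - d b" "\<lambda>b. b" B] by simp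
      moreover have "N (\<Phi> c) \<le> N (\<Phi> c - \<Phi> d) + N (\<Phi> d)" "N (\<Phi> d) \<le> N (\<Phi> d - \<Phi> c) + N (\<Phi> c)"
        using norm_likeD(1)[OF N, of "\<Phi> c - \<Phi> d" "\<Phi> d"] norm_likeD(1)[OF N, of "\<Phi> d - \<Phi> c" "\<Phi> c"] by simp_all
      ultimately show ?thesis using norm_likeD(7)[OF N, of "\<Phi> c" "\<Phi> d"] by (simp add: abs_le_iff)
    qed
    have "continuous_on UNIV (\<lambda>c. \<Sum>b\<in>B. \<bar>c b - d b\<bar> * N b)" by (intro continuous_intros)
    from bspec[OF iffD1[OF continuous_on_def this], of d]
    have "((\<lambda>c. \<Sum>b\<in>B. \<bar>c b - d b\<bar> * N b) \<longlongrightarrow> 0) (at d)" by simp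
    then have "((\<lambda>c. N (\<Phi> c) - N (\<Phi> d)) \<longlongrightarrow> 0) (at d)"
      by (rule Lim_null_comparison[rotated]) (simp add: le)
    then show "((\<lambda>c. N (\<Phi> c)) \<longlongrightarrow> N (\<Phi> d)) (at d within UNIV)" by (simp add: LIM_zero_iff)
  qed
  have pos: "N (\<Phi> c) > 0" if c: "c \<in> K" for c
  proof -
    have "\<exists>b\<in>B. c b \<noteq> 0"
    proof (rule ccontr)
      assume "\<not> (\<exists>b\<in>B. c b \<noteq> 0)"
      then have "(\<Sum>b\<in>B. \<bar>c b\<bar>) = 0" by simp
      then show False using c by (simp add: K_def)
    qed
    then have "\<Phi> c \<noteq> 0" using independentD[OF B(2) fB subset_refl, of c] unfolding \<Phi>_def by blast
    then show ?thesis using norm_likeD(5)[OF N] by blast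
  qed
  \<comment> \<open>In dimension zero \<open>K\<close> is empty, and any positive number
    serves.\<close>
  obtain m where m: "m > 0" "\<And>c. c \<in> K \<Longrightarrow> m \<le> N (\<Phi> c)"
  proof (cases "K = {}")
    case False
    obtain c0 where "c0 \<in> K" "\<forall>c\<in>K. N (\<Phi> c0) \<le> N (\<Phi> c)"
      using continuous_attains_inf[OF K False continuous_on_subset[OF cont]] by auto
    then show ?thesis using that[of "N (\<Phi> c0)"] pos by blast
  qed (use that[of 1] in auto)
  have coord: "m * (\<Sum>b\<in>B. \<bar>c b\<bar>) \<le> N (\<Phi> c)" for c
  proof (cases "(\<Sum>b\<in>B. \<bar>c b\<bar>) = 0")
    case True then show ?thesis using norm_likeD(4)[OF N] by simp
  next
    case False
    define s where "s = (\<Sum>b\<in>B. \<bar>c b\<bar>)"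
    have "s \<ge> 0" by (simp add: s_def sum_nonneg)
    then have s: "s > 0" using False unfolding s_def[symmetric] by simp
    have le: "\<bar>c b\<bar> \<le> s" if "b \<in> B" for b
      unfolding s_def using member_le_sum[of b B "\<lambda>b. \<bar>c b\<bar>"] that fB by simp
    define e where "e b = (if b \<in> B then c b / s else 0)" for b
    have "(\<Sum>b\<in>B. \<bar>e b\<bar>) = (\<Sum>b\<in>B. \<bar>c b\<bar> / s)" using s by (intro sum.cong) (auto simp: e_def)
    also have "\<dots> = 1" unfolding sum_divide_distrib[symmetric] s_def[symmetric] using s by simp
    finally have "e \<in> K" using le s by (auto simp: K_def e_def)
    moreover have "\<Phi> c = s *\<^sub>R \<Phi> e" using s by (simp add: \<Phi>_def e_def scaleR_sum_right)
    ultimately show ?thesis using m(2)[of e] norm_likeD(2)[OF N, of s "\<Phi> e"] s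
      unfolding s_def[symmetric] by (simp add: mult.commute[of s])
  qed
  define C where "C = (\<Sum>b\<in>B. \<bar>G b\<bar>) / m"
  show ?thesis
  proof (rule that[of C])
    show "C \<ge> 0" using m by (simp add: C_def sum_nonneg)
    fix x
    have "x \<in> span B" using sB by simp
    then obtain c where x: "x = \<Phi> c" unfolding span_finite[OF fB] \<Phi>_def by blast
    have "G x \<le> (\<Sum>b\<in>B. \<bar>c b\<bar> * G b)" unfolding x \<Phi>_def by (rule seminorm_sum_le[OF G])
    also have "\<dots> \<le> (\<Sum>b\<in>B. \<bar>c b\<bar> * (\<Sum>b\<in>B. \<bar>G b\<bar>))"
    proof (intro sum_mono mult_left_mono)
      fix b assume "b \<in> B"
      then show "G b \<le> (\<Sum>b\<in>B. \<bar>G b\<bar>)" using member_le_sum[of b B "\<lambda>b. \<bar>G b\<bar>"] fB by (simp add: abs_le_iff)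
    qed simp
    also have "\<dots> = C * (m * (\<Sum>b\<in>B. \<bar>c b\<bar>))" using m by (simp add: C_def sum_distrib_right[symmetric])
    also have "\<dots> \<le> C * N x" unfolding x by (intro mult_left_mono coord) (use m in \<open>simp add: C_def sum_nonneg\<close>)
    finally show "G x \<le> C * N x" .
  qed
qed

lemma finite_dim_bounded_linear:
  fixes f :: "'v::real_normed_vector \<Rightarrow> real"
  assumes fd: "\<exists>B::'v set. finite B \<and> span B = UNIV" and f: "linear f"
  shows "bounded_linear f"
proof -
  have "seminorm (\<lambda>x. \<bar>f x\<bar>)"
    unfolding seminorm_def using linear_add[OF f] linear_cmul[OF f] by (auto simp: abs_mult)
  from finite_dim_dominated[OF fd norm_like_norm this] obtain C where "\<And>x. \<bar>f x\<bar> \<le> C * norm x" by blast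
  then show ?thesis using f by (intro bounded_linear_intro[where K = C]) (auto simp: linear_add linear_cmul mult.commute)
qed

lemma finite_dim_functionals_separate:
  fixes x :: "'v::real_normed_vector"
  assumes fd: "\<exists>B::'v set. finite B \<and> span B = UNIV" and x: "\<And>\<phi> :: 'v \<Rightarrow>\<^sub>L real. blinfun_apply \<phi> x = 0"
  shows "x = 0"
proof (rule ccontr)
  assume "x \<noteq> 0"
  then have "independent {x}" by simp
  then obtain f :: "'v \<Rightarrow> real" where f: "linear f" "f x = 1"
    using linear_independent_extend[of "{x}" "\<lambda>_. 1::real"] by auto
  then have "blinfun_apply (Blinfun f) x = 1"
    using bounded_linear_Blinfun_apply[OF finite_dim_bounded_linear[OF fd f(1)]] by simp
  then show False using x by simp
qed

section \<open>Polynomial functions of the signature\<close>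

definition pairing :: "(real \<times> ('v::real_normed_vector \<Rightarrow>\<^sub>L real) list) list \<Rightarrow> 'v tensor_series \<Rightarrow> real"
  where "pairing cs x = (\<Sum>(c, w)\<leftarrow>cs. c * x w)"

text \<open>Prepending \<open>\<phi>\<close> is integration of the functional against the
  \<open>\<phi>\<close>-component of the path, see \<open>pairing_differential\<close>. The result
  has no constant term, so it vanishes on trivial signatures.\<close>

definition prepend :: "'a \<Rightarrow> (real \<times> 'a list) list \<Rightarrow> (real \<times> 'a list) list"
  where "prepend \<phi> cs = map (\<lambda>(c, w). (c, \<phi> # w)) cs"

lemma pairing_simps [simp]:
  "pairing [] x = 0" "pairing ((c, w) # cs) x = c * x w + pairing cs x" "pairing (cs @ ds) x = pairing cs x + pairing ds x"
  by (simp_all add: pairing_def)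

lemma prepend_simps [simp]:
  "prepend \<phi> [] = []" "prepend \<phi> ((c, w) # cs) = (c, \<phi> # w) # prepend \<phi> cs"
  by (simp_all add: prepend_def)

lemma pairing_prepend_one: "pairing (prepend \<phi> cs) tensor_one = 0"
  by (induction cs) auto

lemma pairing_scale: "pairing (map (\<lambda>(c, w). (a * c, w)) cs) x = a * pairing cs x"
  by (induction cs) (auto simp: algebra_simps)

text \<open>The characters of the shuffle algebra with geometric growth form a compact set, on which the
  coordinate functionals span an algebra.\<close>

definition characters :: "real \<Rightarrow> 'v::real_normed_vector tensor_series set"
  where "characters M = {x. (\<forall>w. \<bar>x w\<bar> \<le> M ^ length w * word_norm w) \<and> x [] = 1 \<and>
    (\<forall>v w. x v * x w = (\<Sum>u\<leftarrow>shuffle_words v w. x u))}"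

lemma continuous_on_sum_list [continuous_intros]:
  fixes f :: "'i \<Rightarrow> 'a::topological_space \<Rightarrow> real"
  assumes "\<And>i. i \<in> set is \<Longrightarrow> continuous_on S (f i)"
  shows "continuous_on S (\<lambda>x. \<Sum>i\<leftarrow>is. f i x)"
  using assms by (induction "is") (auto intro!: continuous_intros)

lemma compact_characters: "compact (characters M)"
proof -
  have "closed {x :: 'v tensor_series. x [] = 1 \<and> (\<forall>v w. x v * x w = (\<Sum>u\<leftarrow>shuffle_words v w. x u))}"
    by (intro closed_Collect_conj closed_Collect_all; rule closed_Collect_eq; intro continuous_intros)
  from compact_Int_closed[OF compact_box this] show ?thesis
    unfolding characters_def by (rule back_subst[where P = compact]) auto
qed

text \<open>By the shuffle identity a product of coordinates is a sum of coordinates, with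
  coefficients that are the same for all characters.\<close>

lemma pairing_mult:
  assumes "x \<in> characters M"
  shows "\<exists>es. \<forall>x\<in>characters M. pairing cs x * pairing ds x = pairing es x"
proof -
  have one: "\<exists>es. \<forall>x\<in>characters M. (c * x w) * pairing ds x = pairing es x" for c w ds
  proof (induction ds)
    case Nil then show ?case by (intro exI[of _ "[]"]) simp
  next
    case (Cons p ds)
    obtain d v where p: "p = (d, v)" by force
    obtain es where es: "\<And>x. x \<in> characters M \<Longrightarrow> (c * x w) * pairing ds x = pairing es x" using Cons by blast
    have "pairing (map (\<lambda>u. (c * d, u)) us) x = c * d * (\<Sum>u\<leftarrow>us. x u)" for us x
      by (induction us) (auto simp: algebra_simps)
    then have "(c * x w) * pairing (p # ds) x = pairing (map (\<lambda>u. (c * d, u)) (shuffle_words w v) @ es) x"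
      if x: "x \<in> characters M" for x
    proof -
      have "x w * x v = (\<Sum>u\<leftarrow>shuffle_words w v. x u)" using x unfolding characters_def by blast
      moreover have "(c * x w) * (d * x v) = c * d * (x w * x v)" by simp
      ultimately have "(c * x w) * (d * x v) = pairing (map (\<lambda>u. (c * d, u)) (shuffle_words w v)) x"
        unfolding \<open>\<And>us x. pairing (map (\<lambda>u. (c * d, u)) us) x = c * d * (\<Sum>u\<leftarrow>us. x u)\<close> by simp
      then show ?thesis using es[OF x] unfolding p pairing_simps distrib_left by linarith
    qed
    then show ?case by blast
  qed
  show ?thesis
  proof (induction cs)
    case Nil then show ?case by (intro exI[of _ "[]"]) simp
  next
    case (Cons p cs)
    obtain c w where p: "p = (c, w)" by force
    obtain es where es: "\<And>x. x \<in> characters M \<Longrightarrow> pairing cs x * pairing ds x = pairing es x" using Cons by blast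
    obtain es' where es': "\<And>x. x \<in> characters M \<Longrightarrow> (c * x w) * pairing ds x = pairing es' x" using one by blast
    have "pairing (p # cs) x * pairing ds x = pairing (es' @ es) x" if "x \<in> characters M" for x
      using es[OF that] es'[OF that] by (simp add: p algebra_simps)
    then show ?case by blast
  qed
qed

interpretation characters: function_ring_on "{f. \<exists>cs. \<forall>x\<in>characters M. f x = pairing cs x}" "characters M" for M
proof
  show "compact (characters M)" by (rule compact_characters)
next
  fix f :: "'a tensor_series \<Rightarrow> real" assume "f \<in> {f. \<exists>cs. \<forall>x\<in>characters M. f x = pairing cs x}"
  then obtain cs where cs: "\<And>x. x \<in> characters M \<Longrightarrow> f x = pairing cs x" by blast
  have "continuous_on (characters M) (pairing cs)"
    unfolding pairing_def case_prod_unfold by (intro continuous_intros)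
  then show "continuous_on (characters M) f" using cs continuous_on_cong by metis
next
  fix f g :: "'a tensor_series \<Rightarrow> real"
  assume "f \<in> {f. \<exists>cs. \<forall>x\<in>characters M. f x = pairing cs x}" "g \<in> {f. \<exists>cs. \<forall>x\<in>characters M. f x = pairing cs x}"
  then obtain cs ds where cs: "\<And>x. x \<in> characters M \<Longrightarrow> f x = pairing cs x" "\<And>x. x \<in> characters M \<Longrightarrow> g x = pairing ds x" by blast
  then have "\<forall>x\<in>characters M. f x + g x = pairing (cs @ ds) x" by simp
  then show "(\<lambda>x. f x + g x) \<in> {f. \<exists>cs. \<forall>x\<in>characters M. f x = pairing cs x}" by blast
  show "(\<lambda>x. f x * g x) \<in> {f. \<exists>cs. \<forall>x\<in>characters M. f x = pairing cs x}"
  proof (cases "characters M = ({} :: 'a tensor_series set)")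
    case False
    then obtain es where "\<forall>x\<in>characters M. pairing cs x * pairing ds x = pairing es x" using pairing_mult by blast
    then show ?thesis using cs by auto
  qed simp
next
  fix c
  have "\<forall>x\<in>characters M. c = pairing [(c, [])] x" by (simp add: characters_def)
  then show "(\<lambda>x :: 'a tensor_series. c) \<in> {f. \<exists>cs. \<forall>x\<in>characters M. f x = pairing cs x}" by blast
next
  fix x y :: "'a tensor_series" assume "x \<noteq> y"
  then obtain w where "x w \<noteq> y w" by auto
  moreover have "(\<lambda>x. x w) \<in> {f. \<exists>cs. \<forall>x\<in>characters M. f x = pairing cs x}"
    by (auto intro!: exI[of _ "[(1, w)]"])
  ultimately show "\<exists>f\<in>{f. \<exists>cs. \<forall>x\<in>characters M. f x = pairing cs x}. f x \<noteq> f y"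
    by (intro bexI[of _ "\<lambda>x. x w"])
qed

text \<open>A polynomial Urysohn function. Its values lie between \<open>0\<close> and
  \<open>1\<close> on all characters, not only on \<open>A\<close> and \<open>B\<close>; this
  controls integrals over the transitional arcs and, later, along competing paths.\<close>

lemma pairing_separates:
  fixes A :: "'v::real_normed_vector tensor_series set"
  assumes "closed A" "A \<subseteq> characters M" "closed B" "B \<subseteq> characters M" "A \<inter> B = {}" "0 < e" "e < 1"
  obtains cs where "\<And>x. x \<in> characters M \<Longrightarrow> 0 \<le> pairing cs x \<and> pairing cs x \<le> 1"
    "\<And>x. x \<in> A \<Longrightarrow> pairing cs x < e" "\<And>x. x \<in> B \<Longrightarrow> pairing cs x > 1 - e"
proof -
  obtain f cs where f: "f ` characters M \<subseteq> {0..1}" "\<forall>x\<in>A. f x < e" "\<forall>x\<in>B. f x > 1 - e"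
    and cs: "\<forall>x\<in>characters M. f x = pairing cs x"
    using characters.two[OF assms] by blast
  show ?thesis
  proof (rule that[of cs])
    fix x :: "'v tensor_series" assume "x \<in> characters M"
    then show "0 \<le> pairing cs x \<and> pairing cs x \<le> 1" using f(1) cs by force
  next
    fix x assume "x \<in> A" then show "pairing cs x < e" using f(2) cs assms(2) by force
  next
    fix x assume "x \<in> B" then show "pairing cs x > 1 - e" using f(3) cs assms(4) by force
  qed
qed

lemma signature_in_characters:
  assumes c: "controlled a b \<omega> \<gamma>" and st: "a \<le> s" "s \<le> t" "t \<le> b"
    and \<Omega>: "\<And>s t. a \<le> s \<Longrightarrow> s \<le> t \<Longrightarrow> t \<le> b \<Longrightarrow> norm (\<gamma> t - \<gamma> s) \<le> \<Omega> t - \<Omega> s"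
    and M: "\<Omega> t - \<Omega> s \<le> M"
  shows "signature s t \<gamma> \<in> characters M"
proof -
  have "\<bar>signature s t \<gamma> w\<bar> \<le> M ^ length w * word_norm w" for w
  proof -
    have "0 \<le> \<Omega> t - \<Omega> s" using \<Omega>[OF st] norm_ge_zero[of "\<gamma> t - \<gamma> s"] by linarith
    then have "word_norm w * (\<Omega> t - \<Omega> s) ^ length w \<le> word_norm w * M ^ length w"
      by (intro mult_left_mono power_mono M word_norm_nonneg)
    then show ?thesis using signature_bound[OF c st \<Omega>, of w] by (simp add: mult.commute)
  qed
  then show ?thesis unfolding characters_def using signature_shuffle[OF c st] by simp
qed

lemma continuous_signature_path:
  assumes "controlled a b \<omega> \<gamma>" "a \<le> t" "t \<le> b"
  shows "continuous_on {a..t} (\<lambda>s. signature s t \<gamma>)"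
  by (rule continuous_on_coordinatewise_then_product) (rule continuous_signature_left[OF assms])

lemma pairing_differential:
  assumes c: "controlled a b \<omega> \<gamma>" and t: "a \<le> t" "t \<le> b"
  shows "has_differential a t \<omega> (\<lambda>x p q. pairing cs (signature x t \<gamma>) * (blinfun_apply \<phi> (\<gamma> q) - blinfun_apply \<phi> (\<gamma> p)))
       (\<lambda>s. - pairing (prepend \<phi> cs) (signature s t \<gamma>))"
proof -
  have ct: "control a t \<omega>" using control_subinterval[OF controlled_imp_control[OF c] _ t(2), of a] by simp
  show ?thesis
  proof (induction cs)
    case Nil then show ?case using has_differential_const[OF ct, of 0] by simp
  next
    case (Cons p cs)
    obtain k w where p: "p = (k, w)" by force
    from has_differential_add[OF has_differential_cmult[OF signature_differential[OF c t] ct] Cons ct, of k w \<phi>]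
    show ?case by (rule has_differential_cong) (auto simp: p algebra_simps simp del: signature.simps)
  qed
qed

text \<open>The hypothesis speaks of prefixes and the functionals of tails; in a loop each
  determines the other. The integral of the weight against the \<open>\<phi>\<close>-component is
  nearly the increment over the arc, yet it is exactly zero, because its antiderivative has no
  constant term.\<close>

theorem excursion_closes:
  fixes \<eta> :: "real \<Rightarrow> 'v::real_normed_vector" and \<phi> :: "'v \<Rightarrow>\<^sub>L real"
  assumes c: "controlled c d \<omega> \<eta>" and st: "c \<le> s" "s \<le> t" "t \<le> d"
    and triv: "signature c d \<eta> = tensor_one"
    and sep: "\<And>u w. s < u \<Longrightarrow> u < t \<Longrightarrow> c \<le> w \<Longrightarrow> w \<le> d \<Longrightarrow> w \<le> s \<or> t \<le> w \<Longrightarrow> signature c u \<eta> \<noteq> signature c w \<eta>"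
  shows "blinfun_apply \<phi> (\<eta> t) = blinfun_apply \<phi> (\<eta> s)"
proof (cases "s = t")
  case False
  then have "s < t" using st by simp
  have ctl: "control c d \<omega>" by (rule controlled_imp_control[OF c])
  have cd: "c \<le> d" using st by simp
  define Y where "Y u = signature u d \<eta>" for u
  define W where "W = \<omega> d - \<omega> c"
  have W0: "0 \<le> W" unfolding W_def using controlled_mono[OF c order_refl cd order_refl] by simp
  have YK: "Y u \<in> characters W" if "c \<le> u" "u \<le> d" for u
    unfolding Y_def W_def
    by (rule signature_in_characters[OF c that order_refl controlled_increment[OF c]])
      (use controlled_mono[OF c, of c u] that in auto)
  \<comment> \<open>Prefix times tail is the signature of the loop at every splitting point, so
    equal tails come with equal prefixes.\<close>
  have Yne: "Y u \<noteq> Y w" if u: "s < u" "u < t" and w: "c \<le> w" "w \<le> d" "w \<le> s \<or> t \<le> w" for u w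
  proof
    assume eq: "Y u = Y w"
    have "tensor_mult (signature c u \<eta>) (Y u) = tensor_mult (signature c w \<eta>) (Y w)"
      using chen[OF c, of c u d] chen[OF c, of c w d] u w st unfolding Y_def by simp
    then have "signature c u \<eta> = signature c w \<eta>"
      unfolding eq by (rule tensor_mult_right_cancel[rotated]) (simp add: Y_def)
    then show False using sep[OF u w] by simp
  qed
  have cY: "continuous_on {c..d} Y" unfolding Y_def by (rule continuous_signature_path[OF c cd order_refl])
  have clY: "closed (Y ` S)" if "compact S" "S \<subseteq> {c..d}" for S
    by (intro compact_imp_closed compact_continuous_image continuous_on_subset[OF cY] that)
  have est: "\<bar>blinfun_apply \<phi> (\<eta> t) - blinfun_apply \<phi> (\<eta> s)\<bar> \<le> 0 + e" if e: "e > 0" for e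
  proof -
    \<comment> \<open>\<open>2 * W\<close> collects the small weight off the arc and the deviation
      from \<open>1\<close> on it, \<open>4\<close> the two margins, both for the integral and for
      \<open>\<phi>\<close> itself; the last \<open>1\<close> keeps \<open>N\<close>
      positive.\<close>
    define N where "N = norm \<phi> * (2 * W + 4) + 1"
    have N: "N > 0" using W0 by (simp add: N_def add_nonneg_pos)
    define \<epsilon> where "\<epsilon> = min (e / N) (1/2)"
    have \<epsilon>: "0 < \<epsilon>" "\<epsilon> < 1" "\<epsilon> * N \<le> e" using e N by (auto simp: \<epsilon>_def min_def field_simps)
    obtain \<delta> where \<delta>: "\<delta> > 0" "\<And>p q. c \<le> p \<Longrightarrow> p \<le> q \<Longrightarrow> q \<le> d \<Longrightarrow> q - p < \<delta> \<Longrightarrow> \<omega> q - \<omega> p < \<epsilon>"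
      using control_uniform[OF ctl \<epsilon>(1)] by blast
    \<comment> \<open>The ends of the arc belong to the rest of the loop, so the compact sets become
      disjoint only after margins of length \<open>r\<close> are cut off;
      \<open>r < \<delta>\<close> makes their contribution small.\<close>
    define r where "r = min \<delta> (t - s) / 3"
    have "3 * r \<le> \<delta>" "3 * r \<le> t - s" by (simp_all add: r_def)
    moreover have "r > 0" using \<delta>(1) \<open>s < t\<close> by (simp add: r_def)
    ultimately have r: "r > 0" "r < \<delta>" "2 * r < t - s" by linarith+
    define s' where "s' = s + r"
    define t' where "t' = t - r"
    have o: "c \<le> s" "s < s'" "s' < t'" "t' < t" "t \<le> d" using r st by (auto simp: s'_def t'_def)
    have ws: "\<omega> s' - \<omega> s < \<epsilon>" using \<delta>(2)[of s s'] o r by (simp add: s'_def)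
    have wt: "\<omega> t - \<omega> t' < \<epsilon>" using \<delta>(2)[of t' t] o r by (simp add: t'_def)
    have "Y ` {s'..t'} \<inter> Y ` ({c..s} \<union> {t..d}) = {}"
    proof (rule ccontr)
      assume "Y ` {s'..t'} \<inter> Y ` ({c..s} \<union> {t..d}) \<noteq> {}"
      then obtain u w where "u \<in> {s'..t'}" "w \<in> {c..s} \<union> {t..d}" "Y u = Y w" by blast
      then show False using Yne[of u w] o by auto
    qed
    then have dj: "Y ` ({c..s} \<union> {t..d}) \<inter> Y ` {s'..t'} = {}" by blast
    have sub: "{c..s} \<union> {t..d} \<subseteq> {c..d}" "{s'..t'} \<subseteq> {c..d}" using o by auto
    have "Y ` ({c..s} \<union> {t..d}) \<subseteq> characters W" "Y ` {s'..t'} \<subseteq> characters W" using sub YK by auto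
    moreover have "closed (Y ` ({c..s} \<union> {t..d}))" "closed (Y ` {s'..t'})"
      using sub by (intro clY compact_Un compact_Icc; simp)+
    ultimately obtain cs where cs: "\<And>x. x \<in> characters W \<Longrightarrow> 0 \<le> pairing cs x \<and> pairing cs x \<le> 1"
      "\<And>x. x \<in> Y ` ({c..s} \<union> {t..d}) \<Longrightarrow> pairing cs x < \<epsilon>" "\<And>x. x \<in> Y ` {s'..t'} \<Longrightarrow> pairing cs x > 1 - \<epsilon>"
      using pairing_separates[of "Y ` ({c..s} \<union> {t..d})" W "Y ` {s'..t'}" \<epsilon>] dj \<epsilon>(1,2) by blast
    define F where "F u = - pairing (prepend \<phi> cs) (Y u)" for u
    let ?h = "\<lambda>u. blinfun_apply \<phi> (\<eta> u)"
    have DF: "has_differential c d \<omega> (\<lambda>x p q. pairing cs (Y x) * (?h q - ?h p)) F"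
      unfolding F_def[abs_def] Y_def by (rule pairing_differential[OF c cd order_refl])
    \<comment> \<open>At both ends the tail is trivial, and a functional without constant term
      vanishes there.\<close>
    have "F d = 0" "F c = 0" unfolding F_def Y_def triv signature_degenerate pairing_prepend_one by simp_all
    have hb: "\<bar>?h q - ?h p\<bar> \<le> norm \<phi> * (\<omega> q - \<omega> p)" if "c \<le> p" "p \<le> q" "q \<le> d" for p q
      by (rule blinfun_increment_bound[OF c that])
    have piece: "\<bar>F q - F p\<bar> \<le> \<kappa> * norm \<phi> * (\<omega> q - \<omega> p)"
      if pq: "c \<le> p" "p \<le> q" "q \<le> d" and k: "\<And>x. p \<le> x \<Longrightarrow> x \<le> q \<Longrightarrow> \<bar>pairing cs (Y x)\<bar> \<le> \<kappa>" for p q \<kappa>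
    proof -
      have k0: "0 \<le> \<kappa>" using k[of p] pq by simp
      have "\<bar>F q - F p\<bar> \<le> (\<lambda>u. \<kappa> * norm \<phi> * \<omega> u) q - (\<lambda>u. \<kappa> * norm \<phi> * \<omega> u) p"
      proof (rule has_differential_bound[OF DF ctl pq])
        fix p' x q' assume h: "p \<le> p'" "p' \<le> x" "x \<le> q'" "q' \<le> q"
        have "\<bar>pairing cs (Y x)\<bar> * \<bar>?h q' - ?h p'\<bar> \<le> \<kappa> * (norm \<phi> * (\<omega> q' - \<omega> p'))"
          by (intro mult_mono k hb k0) (use h pq in auto)
        then show "\<bar>pairing cs (Y x) * (?h q' - ?h p')\<bar> \<le> \<kappa> * norm \<phi> * \<omega> q' - \<kappa> * norm \<phi> * \<omega> p'"
          unfolding abs_mult by (simp add: algebra_simps)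
      qed
      then show ?thesis by (simp add: algebra_simps)
    qed
    have small: "\<bar>pairing cs (Y x)\<bar> \<le> \<epsilon>" if "c \<le> x" "x \<le> d" "x \<le> s \<or> t \<le> x" for x
      using cs(1)[OF YK, of x] cs(2)[of "Y x"] that by (auto simp: abs_le_iff less_imp_le)
    have le1: "\<bar>pairing cs (Y x)\<bar> \<le> 1" if "c \<le> x" "x \<le> d" for x
      using cs(1)[OF YK, of x] that by auto
    have \<phi>0: "0 \<le> norm \<phi>" by simp
    have mon: "\<omega> p \<le> \<omega> q" if "c \<le> p" "p \<le> q" "q \<le> d" for p q by (rule controlled_mono[OF c that])
    have p1: "\<bar>F s - F c\<bar> \<le> \<epsilon> * norm \<phi> * (\<omega> s - \<omega> c)" by (rule piece) (use o small in auto)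
    have "\<bar>F s' - F s\<bar> \<le> 1 * norm \<phi> * (\<omega> s' - \<omega> s)" by (rule piece) (use o le1 in auto)
    also have "\<dots> \<le> norm \<phi> * \<epsilon>" using mult_left_mono[OF less_imp_le[OF ws] \<phi>0] by simp
    finally have p2: "\<bar>F s' - F s\<bar> \<le> norm \<phi> * \<epsilon>" .
    have "\<bar>F t - F t'\<bar> \<le> 1 * norm \<phi> * (\<omega> t - \<omega> t')" by (rule piece) (use o le1 in auto)
    also have "\<dots> \<le> norm \<phi> * \<epsilon>" using mult_left_mono[OF less_imp_le[OF wt] \<phi>0] by simp
    finally have p3: "\<bar>F t - F t'\<bar> \<le> norm \<phi> * \<epsilon>" .
    have p4: "\<bar>F d - F t\<bar> \<le> \<epsilon> * norm \<phi> * (\<omega> d - \<omega> t)" by (rule piece) (use o small in auto)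
    \<comment> \<open>On the core of the arc the weight is within \<open>\<epsilon>\<close> of
      \<open>1\<close>, so \<open>F\<close> moves almost like \<open>?h\<close>.\<close>
    have p5: "\<bar>(F t' - ?h t') - (F s' - ?h s')\<bar> \<le> \<epsilon> * norm \<phi> * W"
    proof -
      have ct': "control s' t' \<omega>" by (rule control_subinterval[OF ctl]) (use o in auto)
      have Dh: "has_differential s' t' \<omega> (\<lambda>x p q. ?h q - ?h p) ?h"
        by (rule has_differentialI[OF order_refl _ ct']) (auto intro: exI[of _ "1::real"])
      have DF': "has_differential s' t' \<omega> (\<lambda>x p q. pairing cs (Y x) * (?h q - ?h p)) F"
        by (rule has_differential_subinterval[OF DF]) (use o in auto)
      have D: "has_differential s' t' \<omega> (\<lambda>x p q. (pairing cs (Y x) - 1) * (?h q - ?h p)) (\<lambda>u. F u - ?h u)"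
        by (rule has_differential_cong[OF has_differential_add[OF DF' has_differential_cmult[OF Dh ct', of "- 1"] ct']])
          (auto simp: algebra_simps)
      have "\<bar>(F t' - ?h t') - (F s' - ?h s')\<bar> \<le> (\<lambda>u. \<epsilon> * norm \<phi> * \<omega> u) t' - (\<lambda>u. \<epsilon> * norm \<phi> * \<omega> u) s'"
      proof (rule has_differential_bound[OF D ct' order_refl less_imp_le[OF o(3)] order_refl])
        fix p x q assume h: "s' \<le> p" "p \<le> x" "x \<le> q" "q \<le> t'"
        have "\<bar>pairing cs (Y x) - 1\<bar> \<le> \<epsilon>"
          using cs(1)[OF YK, of x] cs(3)[of "Y x"] h o by (auto simp: abs_le_iff less_imp_le)
        then have "\<bar>pairing cs (Y x) - 1\<bar> * \<bar>?h q - ?h p\<bar> \<le> \<epsilon> * (norm \<phi> * (\<omega> q - \<omega> p))"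
          by (intro mult_mono hb) (use h o \<epsilon> in auto)
        then show "\<bar>(pairing cs (Y x) - 1) * (?h q - ?h p)\<bar> \<le> \<epsilon> * norm \<phi> * \<omega> q - \<epsilon> * norm \<phi> * \<omega> p"
          unfolding abs_mult by (simp add: algebra_simps)
      qed
      also have "\<dots> = \<epsilon> * norm \<phi> * (\<omega> t' - \<omega> s')" by (simp add: algebra_simps)
      also have "\<dots> \<le> \<epsilon> * norm \<phi> * W"
        unfolding W_def by (intro mult_left_mono) (use \<epsilon> mon[of c s'] mon[of t' d] o in auto)
      finally show ?thesis .
    qed
    have p6: "\<bar>?h s' - ?h s\<bar> \<le> norm \<phi> * \<epsilon>"
      using hb[of s s'] mult_left_mono[OF less_imp_le[OF ws] \<phi>0] o by simp
    have p7: "\<bar>?h t - ?h t'\<bar> \<le> norm \<phi> * \<epsilon>"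
      using hb[of t' t] mult_left_mono[OF less_imp_le[OF wt] \<phi>0] o by simp
    have p14: "\<epsilon> * norm \<phi> * (\<omega> s - \<omega> c) + \<epsilon> * norm \<phi> * (\<omega> d - \<omega> t) \<le> \<epsilon> * norm \<phi> * W"
      unfolding distrib_left[symmetric] W_def by (intro mult_left_mono) (use \<epsilon> mon[of s t] o in auto)
    have "\<bar>?h t - ?h s\<bar> \<le> 2 * (\<epsilon> * norm \<phi> * W) + 4 * (norm \<phi> * \<epsilon>)"
      using p1 p2 p3 p4 p5 p6 p7 p14 \<open>F d = 0\<close> \<open>F c = 0\<close> by (smt (verit))
    also have "\<dots> \<le> \<epsilon> * N" using \<epsilon> by (simp add: N_def algebra_simps)
    also have "\<dots> \<le> e" by (rule \<epsilon>(3))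
    finally show ?thesis by simp
  qed
  have "\<bar>blinfun_apply \<phi> (\<eta> t) - blinfun_apply \<phi> (\<eta> s)\<bar> \<le> 0" by (rule field_le_epsilon) (rule est)
  then show ?thesis by simp
qed simp

section \<open>Uniqueness of tree-reduced paths\<close>

text \<open>The recursion of \<open>signature\<close> moves the left end point. For the right one,
  Chen's identity writes the difference as a sum over splittings with nonempty second word, each of
  which supplies a factor \<open>\<omega> t - \<omega> s\<close>.\<close>

lemma signature_lipschitz_right:
  assumes c: "controlled a b \<omega> \<gamma>" and st: "a \<le> s" "s \<le> t" "t \<le> b"
  shows "\<bar>signature a t \<gamma> w - signature a s \<gamma> w\<bar> \<le>
    (\<Sum>k<length w. word_norm (take k w) * word_norm (drop k w) * (\<omega> b - \<omega> a) ^ (length w - 1)) * (\<omega> t - \<omega> s)"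
proof -
  define W where "W = \<omega> b - \<omega> a"
  have mon: "\<omega> p \<le> \<omega> q" if "a \<le> p" "p \<le> q" "q \<le> b" for p q by (rule controlled_mono[OF c that])
  have W: "0 \<le> \<omega> s - \<omega> a" "\<omega> s - \<omega> a \<le> W" "0 \<le> \<omega> t - \<omega> s" "\<omega> t - \<omega> s \<le> W"
    using mon[of a s] mon[of s b] mon[of a b] mon[of s t] mon[of t b] st by (auto simp: W_def)
  have "signature a t \<gamma> w = (\<Sum>k<length w. signature a s \<gamma> (take k w) * signature s t \<gamma> (drop k w)) + signature a s \<gamma> w"
    unfolding chen[OF c order_refl st] tensor_mult_def by (simp add: lessThan_Suc_atMost[symmetric])
  then have "\<bar>signature a t \<gamma> w - signature a s \<gamma> w\<bar> \<le> (\<Sum>k<length w. \<bar>signature a s \<gamma> (take k w)\<bar> * \<bar>signature s t \<gamma> (drop k w)\<bar>)"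
    unfolding abs_mult[symmetric] by simp
  also have "\<dots> \<le> (\<Sum>k<length w. word_norm (take k w) * word_norm (drop k w) * W ^ (length w - 1) * (\<omega> t - \<omega> s))"
  proof (rule sum_mono)
    fix k assume k: "k \<in> {..<length w}"
    obtain m where m: "length w - k = Suc m" using k by (cases "length w - k") auto
    have 1: "\<bar>signature a s \<gamma> (take k w)\<bar> \<le> word_norm (take k w) * W ^ k"
    proof -
      have "\<bar>signature a s \<gamma> (take k w)\<bar> \<le> word_norm (take k w) * (\<omega> s - \<omega> a) ^ length (take k w)"
        by (rule signature_bound_control[OF c]) (use st in auto)
      also have "length (take k w) = k" using k by simp
      also have "word_norm (take k w) * (\<omega> s - \<omega> a) ^ k \<le> word_norm (take k w) * W ^ k"
        by (intro mult_left_mono power_mono word_norm_nonneg W)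
      finally show ?thesis .
    qed
    have 2: "\<bar>signature s t \<gamma> (drop k w)\<bar> \<le> word_norm (drop k w) * (W ^ m * (\<omega> t - \<omega> s))"
    proof -
      have "\<bar>signature s t \<gamma> (drop k w)\<bar> \<le> word_norm (drop k w) * (\<omega> t - \<omega> s) ^ length (drop k w)"
        by (rule signature_bound_control[OF c]) (use st in auto)
      also have "length (drop k w) = Suc m" using m by simp
      also have "(\<omega> t - \<omega> s) ^ Suc m = (\<omega> t - \<omega> s) ^ m * (\<omega> t - \<omega> s)" by simp
      also have "word_norm (drop k w) * \<dots> \<le> word_norm (drop k w) * (W ^ m * (\<omega> t - \<omega> s))"
        by (intro mult_left_mono mult_right_mono power_mono word_norm_nonneg W)
      finally show ?thesis .
    qed
    have "\<bar>signature a s \<gamma> (take k w)\<bar> * \<bar>signature s t \<gamma> (drop k w)\<bar> \<le>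
        (word_norm (take k w) * W ^ k) * (word_norm (drop k w) * (W ^ m * (\<omega> t - \<omega> s)))"
      by (intro mult_mono[OF 1 2] mult_nonneg_nonneg zero_le_power word_norm_nonneg)
        (use order_trans[OF W(1,2)] in auto)
    also have "length w - 1 = k + m" using m by simp
    then have "(word_norm (take k w) * W ^ k) * (word_norm (drop k w) * (W ^ m * (\<omega> t - \<omega> s))) =
        word_norm (take k w) * word_norm (drop k w) * W ^ (length w - 1) * (\<omega> t - \<omega> s)"
      by (simp add: power_add)
    finally show "\<bar>signature a s \<gamma> (take k w)\<bar> * \<bar>signature s t \<gamma> (drop k w)\<bar> \<le>
      word_norm (take k w) * word_norm (drop k w) * W ^ (length w - 1) * (\<omega> t - \<omega> s)" .
  qed
  finally show ?thesis unfolding sum_distrib_right[symmetric] W_def .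
qed

lemma continuous_signature_prefix:
  assumes "controlled a b \<omega> \<gamma>"
  shows "continuous_on {a..b} (\<lambda>t. signature a t \<gamma>)"
  by (rule continuous_on_coordinatewise_then_product)
    (rule continuous_on_if_increments[OF controlled_imp_control[OF assms] signature_lipschitz_right[OF assms]])

lemma signature_constant:
  assumes "\<gamma> constant_on {s..t}" "s \<le> t"
  shows "signature s t \<gamma> = tensor_one"
proof -
  obtain y where y: "\<And>u. s \<le> u \<Longrightarrow> u \<le> t \<Longrightarrow> \<gamma> u = y" using assms(1) by (auto simp: constant_on_def)
  have "signature s t \<gamma> = signature s t (\<lambda>u. u *\<^sub>R 0)"
    by (rule signature_cong(2)[OF controlled_linear[of s t 0]]) (use y assms in auto)
  then show ?thesis using signature_linear[OF assms(2), of 0] by (simp add: tensor_exp_zero)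
qed

lemma signature_prefix_eq_iff:
  assumes c: "controlled a b \<omega> \<gamma>" and st: "a \<le> s" "s \<le> t" "t \<le> b"
  shows "signature a s \<gamma> = signature a t \<gamma> \<longleftrightarrow> signature s t \<gamma> = tensor_one"
proof
  assume "signature a s \<gamma> = signature a t \<gamma>"
  then have "tensor_mult (signature a s \<gamma>) (signature s t \<gamma>) = tensor_mult (signature a s \<gamma>) tensor_one"
    using chen[OF c order_refl st] by simp
  then show "signature s t \<gamma> = tensor_one" by (rule tensor_mult_left_cancel[rotated]) simp
qed (use chen[OF c order_refl st] in simp)

lemma bv_path_restrict: "bv_path T \<gamma> \<Longrightarrow> 0 \<le> u \<Longrightarrow> u \<le> T \<Longrightarrow> bv_path u \<gamma>"
  unfolding bv_path_iff_controlled using controlled_subinterval by (metis order_refl)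

lemma tree_reduced_restrict: "tree_reduced T \<gamma> \<Longrightarrow> u \<le> T \<Longrightarrow> tree_reduced u \<gamma>"
  unfolding tree_reduced_def by (meson order_trans)

lemma tree_reduced_prefixD:
  assumes p: "bv_path T \<gamma>" and r: "tree_reduced T \<gamma>" and st: "0 \<le> s" "s \<le> u" "u \<le> t" "t \<le> T"
    and eq: "signature 0 s \<gamma> = signature 0 t \<gamma>"
  shows "\<gamma> u = \<gamma> s" "signature 0 u \<gamma> = signature 0 s \<gamma>"
proof -
  obtain \<omega> where c: "controlled 0 T \<omega> \<gamma>" using p by (rule bv_path_controlled)
  have "signature s t \<gamma> = tensor_one" using signature_prefix_eq_iff[OF c, of s t] st eq by simp
  then have k: "\<gamma> constant_on {s..t}" using r st unfolding tree_reduced_def by simp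
  then show "\<gamma> u = \<gamma> s" using st by (auto simp: constant_on_def)
  have "\<gamma> constant_on {s..u}" using k by (rule constant_on_subset) (use st in auto)
  from signature_constant[OF this st(2)] show "signature 0 u \<gamma> = signature 0 s \<gamma>"
    using signature_prefix_eq_iff[OF c, of s u] st by simp
qed

lemma signature_degree_one_eq:
  fixes \<gamma> \<delta> :: "real \<Rightarrow> 'v::real_normed_vector"
  assumes fd: "\<exists>B::'v set. finite B \<and> span B = UNIV" and "s \<le> t" "u \<le> w" "signature s t \<gamma> = signature u w \<delta>"
  shows "\<gamma> t - \<gamma> s = \<delta> w - \<delta> u"
proof -
  have "blinfun_apply \<phi> ((\<gamma> t - \<gamma> s) - (\<delta> w - \<delta> u)) = 0" for \<phi> :: "'v \<Rightarrow>\<^sub>L real"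
    using signature_degree_one[OF assms(2), of \<gamma> \<phi>] signature_degree_one[OF assms(3), of \<delta> \<phi>] assms(4)
    by (simp add: blinfun.diff_right)
  from finite_dim_functionals_separate[OF fd this] show ?thesis by simp
qed

text \<open>The part of \<open>\<delta>\<close> already retraced cancels and leaves a prefix of
  \<open>\<delta>\<close>. Hence every coincidence within the loop is one between prefixes of the
  two given paths.\<close>

lemma path_loop:
  assumes \<gamma>: "bv_path T \<gamma>" and \<delta>: "bv_path L \<delta>" and eq: "signature 0 T \<gamma> = signature 0 L \<delta>"
  shows "bv_path (T + L) (path_concat T \<gamma> (path_reverse L \<delta>))"
    and "0 \<le> u \<Longrightarrow> u \<le> T \<Longrightarrow> signature 0 u (path_concat T \<gamma> (path_reverse L \<delta>)) = signature 0 u \<gamma>"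
    and "T \<le> u \<Longrightarrow> u \<le> T + L \<Longrightarrow> signature 0 u (path_concat T \<gamma> (path_reverse L \<delta>)) = signature 0 (T + L - u) \<delta>"
proof -
  note rv = bv_path_reverse[OF \<delta>]
  note cc = bv_path_concat[OF \<gamma> rv(1)]
  show "bv_path (T + L) (path_concat T \<gamma> (path_reverse L \<delta>))" by (rule cc(1))
  show "0 \<le> u \<Longrightarrow> u \<le> T \<Longrightarrow> signature 0 u (path_concat T \<gamma> (path_reverse L \<delta>)) = signature 0 u \<gamma>"
    by (rule cc(2)) auto
  assume u: "T \<le> u" "u \<le> T + L"
  obtain \<omega> where c: "controlled 0 L \<omega> \<delta>" using \<delta> by (rule bv_path_controlled)
  have "signature 0 u (path_concat T \<gamma> (path_reverse L \<delta>)) =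
      tensor_mult (signature 0 L \<delta>) (tensor_inv (signature (T + L - u) L \<delta>))"
    using cc(4)[of "u - T"] rv(2)[of 0 "u - T"] u eq by (simp add: algebra_simps)
  also have "signature 0 L \<delta> = tensor_mult (signature 0 (T + L - u) \<delta>) (signature (T + L - u) L \<delta>)"
    by (rule chen[OF c]) (use u in auto)
  also have "tensor_mult \<dots> (tensor_inv (signature (T + L - u) L \<delta>)) = signature 0 (T + L - u) \<delta>"
    by (simp add: tensor_mult_assoc tensor_inv_right)
  finally show "signature 0 u (path_concat T \<gamma> (path_reverse L \<delta>)) = signature 0 (T + L - u) \<delta>" .
qed

text \<open>The loop closes \<open>\<gamma>\<close> up by the reverse of \<open>\<delta>\<close>; a missed part of \<open>\<gamma>\<close> would be an excursion of it.\<close>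

theorem tree_reduced_prefixes_covered:
  fixes \<gamma> \<delta> :: "real \<Rightarrow> 'v::real_normed_vector"
  assumes fd: "\<exists>B::'v set. finite B \<and> span B = UNIV"
    and \<gamma>: "bv_path T \<gamma>" and red: "tree_reduced T \<gamma>" and \<delta>: "bv_path L \<delta>"
    and eq: "signature 0 T \<gamma> = signature 0 L \<delta>" and u: "0 \<le> u" "u \<le> T"
  shows "\<exists>w\<in>{0..L}. signature 0 u \<gamma> = signature 0 w \<delta>"
proof (rule ccontr)
  assume not: "\<not> (\<exists>w\<in>{0..L}. signature 0 u \<gamma> = signature 0 w \<delta>)"
  define X where "X t = signature 0 t \<gamma>" for t
  define Z where "Z t = signature 0 t \<delta>" for t
  obtain \<omega>1 where T: "0 \<le> T" and c1: "controlled 0 T \<omega>1 \<gamma>" using \<gamma> by (rule bv_path_controlled)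
  obtain \<omega>2 where L: "0 \<le> L" and c2: "controlled 0 L \<omega>2 \<delta>" using \<delta> by (rule bv_path_controlled)
  have cX: "continuous_on {0..T} X" unfolding X_def by (rule continuous_signature_prefix[OF c1])
  have cZ: "continuous_on {0..L} Z" unfolding Z_def by (rule continuous_signature_prefix[OF c2])
  have clZ: "closed (Z ` {0..L})" by (intro compact_imp_closed compact_continuous_image cZ compact_Icc)
  let ?\<eta> = "path_concat T \<gamma> (path_reverse L \<delta>)"
  note loop = path_loop[OF \<gamma> \<delta> eq]
  obtain \<omega> where c: "controlled 0 (T + L) \<omega> ?\<eta>" using loop(1) by (rule bv_path_controlled)
  have triv: "signature 0 (T + L) ?\<eta> = tensor_one" using loop(3)[of "T + L"] L by (simp add: signature_degenerate)
  \<comment> \<open>\<open>Inf C\<close> is the first time from \<open>u\<close> on at which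
    \<open>\<gamma>\<close> is back among the prefixes of \<open>\<delta>\<close>; the end time
    \<open>T\<close> is such a time.\<close>
  define C where "C = {x \<in> {u..T}. X x \<in> Z ` {0..L}}"
  have "closed C" unfolding C_def
    using continuous_closed_preimage[OF continuous_on_subset[OF cX, of "{u..T}"] closed_atLeastAtMost clZ] u
    by (simp add: Int_def vimage_def)
  moreover have TC: "T \<in> C" using u L eq by (auto simp: C_def X_def Z_def)
  moreover have bdd: "bdd_below C" by (auto simp: C_def bdd_below_def)
  ultimately have tC: "Inf C \<in> C" by (intro closed_contains_Inf) auto
  define t where "t = Inf C"
  have t: "u \<le> t" "t \<le> T" "X t \<in> Z ` {0..L}" using tC by (auto simp: C_def t_def)
  have before: "X x \<notin> Z ` {0..L}" if "u \<le> x" "x < t" for x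
  proof
    assume "X x \<in> Z ` {0..L}"
    then have "x \<in> C" using that t by (simp add: C_def)
    then show False using cInf_lower[OF _ bdd, of x] that by (simp add: t_def)
  qed
  have const: "\<gamma> x = \<gamma> t" if x: "u \<le> x" "x < t" for x
  proof -
    \<comment> \<open>After the last return to the prefix at \<open>x\<close> an excursion up to
      \<open>t\<close> begins. A coincidence with an earlier time would, by tree-reducedness, put
      \<open>y\<close> into \<open>D\<close>; one with a later time would give
      \<open>X t = X y\<close>; one with \<open>\<delta>\<close> is excluded by the choice of
      \<open>t\<close>.\<close>
    define D where "D = {y \<in> {x..t}. X y = X x}"
    have "closed D" unfolding D_def
      using continuous_closed_preimage_constant[OF continuous_on_subset[OF cX, of "{x..t}"] closed_atLeastAtMost] u x t by simp
    moreover have xD: "x \<in> D" using x by (simp add: D_def)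
    moreover have bD: "bdd_above D" by (auto simp: D_def bdd_above_def)
    ultimately have dD: "Sup D \<in> D" by (intro closed_contains_Sup) auto
    define d where "d = Sup D"
    have d: "x \<le> d" "d \<le> t" "X d = X x" using dD by (auto simp: D_def d_def)
    have dne: "d \<noteq> t" using d(3) t(3) before[OF x] by metis
    have "\<gamma> d = \<gamma> x"
      using tree_reduced_prefixD(1)[OF \<gamma> red, of x d d] d x u t by (simp add: X_def)
    moreover have "blinfun_apply \<phi> (?\<eta> t) = blinfun_apply \<phi> (?\<eta> d)" for \<phi> :: "'v \<Rightarrow>\<^sub>L real"
    proof (rule excursion_closes[OF c _ _ _ triv])
      show "0 \<le> d" "d \<le> t" "t \<le> T + L" using d x u t L by auto
      fix y w assume y: "d < y" "y < t" and w: "0 \<le> w" "w \<le> T + L" "w \<le> d \<or> t \<le> w"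
      have yZ: "X y \<notin> Z ` {0..L}" using before[of y] y d x by simp
      show "signature 0 y ?\<eta> \<noteq> signature 0 w ?\<eta>"
      proof
        assume e: "signature 0 y ?\<eta> = signature 0 w ?\<eta>"
        have e1: "signature 0 y ?\<eta> = X y" unfolding X_def using loop(2)[of y] y d x u t by simp
        show False
        proof (cases "w \<le> T")
          case False
          then have "X y = Z (T + L - w)" using loop(3)[of w] e e1 w by (simp add: Z_def)
          then show False using yZ w False by auto
        next
          case True
          then have e2: "X y = X w" using loop(2)[of w] e e1 w by (simp add: X_def)
          show False
          proof (cases "w \<le> d")
            case True
            then have "X y = X d" using tree_reduced_prefixD(2)[OF \<gamma> red, of w d y] e2 y w t by (simp add: X_def)
            then have "y \<in> D" using y d by (simp add: D_def)
            then show False using cSup_upper[OF _ bD, of y] y by (simp add: d_def)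
          next
            case False
            then have "X t = X y"
              using tree_reduced_prefixD(2)[OF \<gamma> red, of y t w] e2 y w t u d x \<open>w \<le> T\<close> by (simp add: X_def)
            then show False using yZ t(3) by simp
          qed
        qed
      qed
    qed
    then have "blinfun_apply \<phi> (\<gamma> t - \<gamma> d) = 0" for \<phi> :: "'v \<Rightarrow>\<^sub>L real"
      using t d by (simp add: path_concat_def blinfun.diff_right)
    from finite_dim_functionals_separate[OF fd this] have "\<gamma> t = \<gamma> d" by simp
    ultimately show ?thesis by simp
  qed
  \<comment> \<open>So \<open>\<gamma>\<close> rests on \<open>{u..t}\<close>, and the prefix
    supposed to be missed is the one at \<open>t\<close>.\<close>
  have "\<gamma> x = \<gamma> t" if "u \<le> x" "x \<le> t" for x using const[of x] that by (cases "x = t") auto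
  then have "\<gamma> constant_on {u..t}" unfolding constant_on_def by (meson atLeastAtMost_iff)
  from signature_constant[OF this t(1)] have "X u = X t"
    using signature_prefix_eq_iff[OF c1, of u t] u t by (simp add: X_def)
  then show False using t(3) not by (auto simp: X_def Z_def)
qed

text \<open>Let \<open>\<theta> r\<close> be the first time at which \<open>\<delta>\<close> has the
  prefix signature of \<open>\<gamma>\<close> at \<open>r\<close>. Degree one makes
  \<open>\<gamma>\<close> a translate of \<open>\<delta> \<circ> \<theta>\<close>; jumps of the
  monotone \<open>\<theta>\<close> only skip parts of \<open>\<delta>\<close>.\<close>

lemma tree_reduced_length_le:
  fixes \<gamma> \<delta> :: "real \<Rightarrow> 'v::real_normed_vector"
  assumes fd: "\<exists>B::'v set. finite B \<and> span B = UNIV"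
    and \<gamma>: "bv_path T \<gamma>" and red: "tree_reduced T \<gamma>" and \<delta>: "bv_path L \<delta>"
    and eq: "signature 0 T \<gamma> = signature 0 L \<delta>"
  shows "path_length norm 0 T \<gamma> \<le> path_length norm 0 L \<delta>"
proof -
  interpret g: length_bounded norm 1 T \<gamma> by unfold_locales (use \<gamma> norm_like_norm in auto)
  interpret d: length_bounded norm 1 L \<delta> by unfold_locales (use \<delta> norm_like_norm in auto)
  obtain \<omega>2 where c2: "controlled 0 L \<omega>2 \<delta>" using \<delta> by (rule bv_path_controlled)
  have cZ: "continuous_on {0..L} (\<lambda>t. signature 0 t \<delta>)" by (rule continuous_signature_prefix[OF c2])
  define P where "P r = {w \<in> {0..L}. signature 0 w \<delta> = signature 0 r \<gamma>}" for r
  define \<theta> where "\<theta> r = Inf (P r)" for r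
  have cP: "closed (P r)" for r
    unfolding P_def by (rule continuous_closed_preimage_constant[OF cZ closed_atLeastAtMost])
  have bP: "bdd_below (P r)" for r by (auto simp: P_def bdd_below_def)
  have \<theta>P: "\<theta> r \<in> P r" if r: "0 \<le> r" "r \<le> T" for r
  proof -
    have "P r \<noteq> {}"
      using tree_reduced_prefixes_covered[OF fd \<gamma> red \<delta> eq r] by (auto simp: P_def)
    then show ?thesis unfolding \<theta>_def by (rule closed_contains_Inf[OF _ bP cP])
  qed
  have \<theta>mono: "\<theta> r \<le> \<theta> r'" if r: "0 \<le> r" "r \<le> r'" "r' \<le> T" for r r'
  proof -
    have h: "0 \<le> \<theta> r'" "\<theta> r' \<le> L" "signature 0 r' \<gamma> = signature 0 (\<theta> r') \<delta>"
      using \<theta>P[of r'] r by (auto simp: P_def)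
    \<comment> \<open>The restrictions up to \<open>r'\<close> and \<open>\<theta> r'\<close> have
      equal signatures, so coverage applies to them and finds the prefix at \<open>r\<close> no
      later than \<open>\<theta> r'\<close>.\<close>
    obtain w where w: "0 \<le> w" "w \<le> \<theta> r'" "signature 0 r \<gamma> = signature 0 w \<delta>"
      using tree_reduced_prefixes_covered[OF fd bv_path_restrict[OF \<gamma>] tree_reduced_restrict[OF red]
          bv_path_restrict[OF \<delta> h(1,2)] h(3), of r] r by auto
    then have "w \<in> P r" using h by (auto simp: P_def)
    then have "\<theta> r \<le> w" unfolding \<theta>_def by (rule cInf_lower[OF _ bP])
    then show ?thesis using w by simp
  qed
  show ?thesis
  proof (rule g.length_leI[OF g.A])
    fix D assume D: "D division_of {0..T}"
    note b = division_interval_bounds[OF D]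
    have "(\<Sum>K\<in>D. norm (\<gamma> (Sup K) - \<gamma> (Inf K))) \<le>
        (\<Sum>K\<in>D. path_length norm 0 (\<theta> (Sup K)) \<delta> - path_length norm 0 (\<theta> (Inf K)) \<delta>)"
    proof (rule sum_mono)
      fix K assume K: "K \<in> D"
      have o: "0 \<le> Inf K" "Inf K \<le> Sup K" "Sup K \<le> T" "Inf K \<le> T" "0 \<le> Sup K"
        using b[OF K] by auto
      have i: "\<theta> (Inf K) \<in> P (Inf K)" "\<theta> (Sup K) \<in> P (Sup K)" using \<theta>P o by auto
      have "\<gamma> (Sup K) - \<gamma> 0 = \<delta> (\<theta> (Sup K)) - \<delta> 0"
        by (rule signature_degree_one_eq[OF fd]) (use i o in \<open>auto simp: P_def\<close>)
      moreover have "\<gamma> (Inf K) - \<gamma> 0 = \<delta> (\<theta> (Inf K)) - \<delta> 0"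
        by (rule signature_degree_one_eq[OF fd]) (use i o in \<open>auto simp: P_def\<close>)
      ultimately have "\<gamma> (Sup K) - \<gamma> (Inf K) = \<delta> (\<theta> (Sup K)) - \<delta> (\<theta> (Inf K))"
        by (metis add_diff_cancel diff_add_cancel diff_diff_eq2)
      then show "norm (\<gamma> (Sup K) - \<gamma> (Inf K)) \<le> path_length norm 0 (\<theta> (Sup K)) \<delta> - path_length norm 0 (\<theta> (Inf K)) \<delta>"
        using d.length_increment[of "\<theta> (Inf K)" "\<theta> (Sup K)"] \<theta>mono[of "Inf K" "Sup K"] i o by (simp add: P_def)
    qed
    also have "\<dots> = path_length norm 0 (\<theta> T) \<delta> - path_length norm 0 (\<theta> 0) \<delta>"
      using sum_division_increments[OF g.A D, of "\<lambda>r. path_length norm 0 (\<theta> r) \<delta>"] by simp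
    also have "\<dots> \<le> path_length norm 0 L \<delta>"
      using d.length_nonneg[of "\<theta> 0"] d.length_mono[of "\<theta> T" L] \<theta>P[of 0] \<theta>P[of T] g.A by (simp add: P_def)
    finally show "(\<Sum>K\<in>D. norm (\<gamma> (Sup K) - \<gamma> (Inf K))) \<le> path_length norm 0 L \<delta>" .
  qed
qed

text \<open>The fibre product of two monotone functions is parametrised by \<open>s \<mapsto> (\<sigma> s, s - \<sigma> s)\<close>, where
  \<open>\<sigma> s\<close> is the least \<open>u\<close> with \<open>f u = h (s - u)\<close>.\<close>

lemma monotone_fibre_product:
  fixes f h :: "real \<Rightarrow> real"
  assumes T: "0 \<le> T" and L: "0 \<le> L"
    and f: "continuous_on {0..T} f" "\<And>s t. 0 \<le> s \<Longrightarrow> s \<le> t \<Longrightarrow> t \<le> T \<Longrightarrow> f s \<le> f t"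
    and h: "continuous_on {0..L} h" "\<And>s t. 0 \<le> s \<Longrightarrow> s \<le> t \<Longrightarrow> t \<le> L \<Longrightarrow> h s \<le> h t"
    and start: "f 0 = h 0" and finish: "f T = h L"
  obtains \<sigma> \<sigma>' :: "real \<Rightarrow> real" where
    "continuous_on {0..1} \<sigma>" "mono_on {0..1} \<sigma>" "\<sigma> ` {0..1} = {0..T}"
    "continuous_on {0..1} \<sigma>'" "mono_on {0..1} \<sigma>'" "\<sigma>' ` {0..1} = {0..L}"
    "\<forall>u\<in>{0..1}. f (\<sigma> u) = h (\<sigma>' u)"
proof -
  define S where "S s = {u \<in> {max 0 (s - L)..min T s}. f u - h (s - u) = 0}" for s
  have cg: "continuous_on {max 0 (s - L)..min T s} (\<lambda>u. f u - h (s - u))" for s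
    by (intro continuous_intros continuous_on_subset[OF f(1)] continuous_on_compose2[OF h(1)]) auto
  have clS: "closed (S s)" for s
    unfolding S_def by (rule continuous_closed_preimage_constant[OF cg closed_atLeastAtMost])
  have bS: "bdd_below (S s)" for s by (auto simp: S_def bdd_below_def)
  \<comment> \<open>At the left end of the admissible interval the difference is nonpositive, by
    monotonicity and the common end values; so a point with nonnegative difference has a zero at or
    before it.\<close>
  have zero: "\<exists>u\<in>S s. u \<le> u0"
    if u0: "max 0 (s - L) \<le> u0" "u0 \<le> min T s" "h (s - u0) \<le> f u0" for s u0
  proof -
    define l where "l = max 0 (s - L)"
    have "f l - h (s - l) \<le> 0"
    proof (cases "s \<le> L")
      case True then show ?thesis using h(2)[of 0 s] u0 start by (simp add: l_def)
    next
      case False then show ?thesis using f(2)[of "s - L" T] u0 finish by (simp add: l_def)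
    qed
    moreover have "continuous_on {l..u0} (\<lambda>u. f u - h (s - u))"
      by (rule continuous_on_subset[OF cg[of s]]) (use u0 in \<open>auto simp: l_def\<close>)
    ultimately obtain x where "l \<le> x" "x \<le> u0" "f x - h (s - x) = 0"
      using IVT'[of "\<lambda>u. f u - h (s - u)" l 0 u0] u0 by (auto simp: l_def)
    then show ?thesis using u0 by (intro bexI[of _ x]) (auto simp: S_def l_def)
  qed
  define \<sigma> where "\<sigma> s = Inf (S s)" for s
  have \<sigma>S: "\<sigma> s \<in> S s" if s: "0 \<le> s" "s \<le> T + L" for s
  proof -
    have "S s \<noteq> {}"
    proof (cases "s \<le> T")
      case True
      then show ?thesis using zero[of s s] f(2)[of 0 s] start s T L by auto
    next
      case False
      then show ?thesis using zero[of s T] h(2)[of "s - T" L] finish s T L by auto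
    qed
    then show ?thesis unfolding \<sigma>_def by (rule closed_contains_Inf[OF _ bS clS])
  qed
  have \<sigma>le: "\<sigma> s \<le> u" if "u \<in> S s" for s u
    unfolding \<sigma>_def using that by (rule cInf_lower[OF _ bS])
  \<comment> \<open>Both \<open>\<sigma> s\<close> and \<open>s - \<sigma> s\<close> are
    nondecreasing. This makes \<open>\<sigma>\<close> 1-Lipschitz, hence continuous although it is
    defined by an infimum.\<close>
  have mono: "\<sigma> s \<le> \<sigma> s' \<and> \<sigma> s' - \<sigma> s \<le> s' - s" if s: "0 \<le> s" "s \<le> s'" "s' \<le> T + L" for s s'
  proof
    have a: "\<sigma> s \<in> S s" "\<sigma> s' \<in> S s'" using \<sigma>S s by auto
    then have a1: "0 \<le> \<sigma> s" "\<sigma> s \<le> T" "s - L \<le> \<sigma> s" "\<sigma> s \<le> s" "f (\<sigma> s) = h (s - \<sigma> s)"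
      and a2: "0 \<le> \<sigma> s'" "\<sigma> s' \<le> T" "s' - L \<le> \<sigma> s'" "\<sigma> s' \<le> s'" "f (\<sigma> s') = h (s' - \<sigma> s')"
      by (auto simp: S_def)
    show "\<sigma> s \<le> \<sigma> s'"
    proof (cases "\<sigma> s' \<le> s")
      case True
      have "h (s - \<sigma> s') \<le> f (\<sigma> s')" unfolding a2(5) by (rule h(2)) (use True a2 s in auto)
      then obtain u where "u \<in> S s" "u \<le> \<sigma> s'" using zero[of s "\<sigma> s'"] True a2 s by auto
      then show ?thesis using \<sigma>le[of u s] by simp
    qed (use a1 in auto)
    show "\<sigma> s' - \<sigma> s \<le> s' - s"
    proof (cases "\<sigma> s + (s' - s) \<le> T")
      case True
      have "h (s' - (\<sigma> s + (s' - s))) \<le> f (\<sigma> s + (s' - s))"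
        using f(2)[of "\<sigma> s" "\<sigma> s + (s' - s)"] a1 True s by simp
      then obtain u where "u \<in> S s'" "u \<le> \<sigma> s + (s' - s)" using zero[of s' "\<sigma> s + (s' - s)"] True a1 s by auto
      then show ?thesis using \<sigma>le[of u s'] by simp
    qed (use a2 in auto)
  qed
  have \<sigma>0: "\<sigma> 0 = 0" using \<sigma>S[of 0] T L by (auto simp: S_def)
  have \<sigma>1: "\<sigma> (T + L) = T" using \<sigma>S[of "T + L"] T L by (auto simp: S_def)
  have lip: "\<bar>\<sigma> s' - \<sigma> s\<bar> \<le> \<bar>s' - s\<bar>" if "s \<in> {0..T + L}" "s' \<in> {0..T + L}" for s s'
    using mono[of s s'] mono[of s' s] that by (cases "s \<le> s'") auto
  have c\<sigma>: "continuous_on {0..T + L} \<sigma>"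
  proof (rule continuous_onI)
    fix x e :: real assume "x \<in> {0..T + L}" "e > 0"
    then show "\<exists>d>0. \<forall>x'\<in>{0..T + L}. dist x' x < d \<longrightarrow> dist (\<sigma> x') (\<sigma> x) \<le> e"
      using lip by (intro exI[of _ e]) (fastforce simp: dist_real_def)
  qed
  define M where "M = T + L"
  have M: "0 \<le> M" using T L by (simp add: M_def)
  have sc: "0 \<le> u * M" "u * M \<le> M" if "u \<in> {0..1}" for u using that M by (auto simp: mult_left_le_one_le)
  define \<sigma>1' where "\<sigma>1' u = \<sigma> (u * M)" for u
  define \<sigma>2 where "\<sigma>2 u = u * M - \<sigma> (u * M)" for u
  have c1: "continuous_on {0..1} \<sigma>1'" unfolding \<sigma>1'_def
    by (rule continuous_on_compose2[OF c\<sigma>]) (use sc in \<open>auto simp: M_def intro!: continuous_intros\<close>)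
  then have c2: "continuous_on {0..1} \<sigma>2" unfolding \<sigma>2_def \<sigma>1'_def by (intro continuous_intros)
  have m: "\<sigma> (u * M) \<le> \<sigma> (u' * M) \<and> \<sigma> (u' * M) - \<sigma> (u * M) \<le> u' * M - u * M" if "u \<in> {0..1}" "u' \<in> {0..1}" "u \<le> u'" for u u'
    by (rule mono) (use that sc[of u] sc[of u'] M in \<open>auto simp: mult_right_mono M_def\<close>)
  have m1: "mono_on {0..1} \<sigma>1'" unfolding mono_on_def \<sigma>1'_def using m by auto
  have m2: "mono_on {0..1} \<sigma>2" unfolding mono_on_def \<sigma>2_def using m by fastforce
  have im: "\<tau> ` {0..1} = {0..R}" if "continuous_on {0..1} \<tau>" "mono_on {0..1} \<tau>" "\<tau> 0 = 0" "\<tau> 1 = R" for \<tau> :: "real \<Rightarrow> real" and R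
  proof
    show "\<tau> ` {0..1} \<subseteq> {0..R}" using that by (force simp: mono_on_def)
    show "{0..R} \<subseteq> \<tau> ` {0..1}"
    proof
      fix y assume "y \<in> {0..R}"
      then show "y \<in> \<tau> ` {0..1}" using IVT'[of \<tau> 0 y 1] that by auto
    qed
  qed
  show ?thesis
  proof (rule that[of \<sigma>1' \<sigma>2])
    show "\<sigma>1' ` {0..1} = {0..T}" by (rule im[OF c1 m1]) (simp_all add: \<sigma>1'_def \<sigma>0 \<sigma>1 M_def)
    show "\<sigma>2 ` {0..1} = {0..L}" by (rule im[OF c2 m2]) (simp_all add: \<sigma>2_def \<sigma>0 \<sigma>1 M_def)
    show "\<forall>u\<in>{0..1}. f (\<sigma>1' u) = h (\<sigma>2 u)"
    proof
      fix u :: real assume u: "u \<in> {0..1}"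
      then show "f (\<sigma>1' u) = h (\<sigma>2 u)"
        using \<sigma>S[of "u * M"] sc[OF u] by (auto simp: \<sigma>1'_def \<sigma>2_def S_def M_def)
    qed
  qed (fact c1 m1 c2 m2)+
qed

text \<open>Arc length is the common parameter: the length inequality in both directions gives equal
  lengths to equal prefixes, and the fibre product pairs times of equal length.\<close>

theorem tree_reduced_unique:
  fixes \<gamma> \<delta> :: "real \<Rightarrow> 'v::real_normed_vector"
  assumes fd: "\<exists>B::'v set. finite B \<and> span B = UNIV"
    and \<gamma>: "bv_path T \<gamma>" "tree_reduced T \<gamma>" and \<delta>: "bv_path L \<delta>" "tree_reduced L \<delta>"
    and eq: "signature 0 T \<gamma> = signature 0 L \<delta>" and start: "\<gamma> 0 = \<delta> 0"
  shows "rep_equiv T \<gamma> L \<delta>"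
proof -
  interpret g: length_bounded norm 1 T \<gamma> by unfold_locales (use \<gamma> norm_like_norm in auto)
  interpret d: length_bounded norm 1 L \<delta> by unfold_locales (use \<delta> norm_like_norm in auto)
  let ?f = "\<lambda>t. path_length norm 0 t \<gamma>" and ?h = "\<lambda>t. path_length norm 0 t \<delta>"
  have len: "?f u = ?h w" if "0 \<le> u" "u \<le> T" "0 \<le> w" "w \<le> L" "signature 0 u \<gamma> = signature 0 w \<delta>" for u w
  proof (rule antisym)
    note r = bv_path_restrict[OF \<gamma>(1) that(1,2)] tree_reduced_restrict[OF \<gamma>(2) that(2)]
      bv_path_restrict[OF \<delta>(1) that(3,4)] tree_reduced_restrict[OF \<delta>(2) that(4)]
    show "?f u \<le> ?h w" by (rule tree_reduced_length_le[OF fd r(1-3) that(5)])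
    show "?h w \<le> ?f u" by (rule tree_reduced_length_le[OF fd r(3,4,1) that(5)[symmetric]])
  qed
  \<comment> \<open>Let \<open>w'\<close> be a time with the prefix signature of \<open>u\<close>.
    The lengths at \<open>w'\<close> and \<open>w\<close> agree, so \<open>\<delta>\<close> takes
    the same value at both.\<close>
  have same: "\<gamma> u = \<delta> w" if u: "0 \<le> u" "u \<le> T" and w: "0 \<le> w" "w \<le> L" and e: "?f u = ?h w" for u w
  proof -
    obtain w' where w': "0 \<le> w'" "w' \<le> L" "signature 0 u \<gamma> = signature 0 w' \<delta>"
      using tree_reduced_prefixes_covered[OF fd \<gamma> \<delta>(1) eq u] by auto
    then have "?h w' = ?h w" using len[OF u w'(1,2,3)] e by simp
    then have "norm (\<delta> w' - \<delta> w) \<le> 0"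
      using d.length_increment[of w w'] d.length_increment[of w' w] w w' by (cases "w \<le> w'") (auto simp: norm_minus_commute)
    moreover have "\<gamma> u - \<gamma> 0 = \<delta> w' - \<delta> 0" by (rule signature_degree_one_eq[OF fd u(1) w'(1,3)])
    ultimately show ?thesis using start by simp
  qed
  have start': "?f 0 = ?h 0" by (rule len) (use g.A d.A in \<open>simp_all add: signature_degenerate\<close>)
  have finish': "?f T = ?h L" by (rule len[OF g.A order_refl d.A order_refl eq])
  obtain \<sigma> \<sigma>' :: "real \<Rightarrow> real" where
    \<sigma>: "continuous_on {0..1} \<sigma>" "mono_on {0..1} \<sigma>" "\<sigma> ` {0..1} = {0..T}"
    "continuous_on {0..1} \<sigma>'" "mono_on {0..1} \<sigma>'" "\<sigma>' ` {0..1} = {0..L}"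
    and eqn: "\<forall>u\<in>{0..1}. ?f (\<sigma> u) = ?h (\<sigma>' u)"
    by (rule monotone_fibre_product[OF g.A d.A g.continuous_length g.length_mono d.continuous_length d.length_mono
          start' finish'])
  have "\<gamma> (\<sigma> u) = \<delta> (\<sigma>' u)" if u: "u \<in> {0..1}" for u
  proof (rule same)
    have "\<sigma> u \<in> {0..T}" "\<sigma>' u \<in> {0..L}" using u \<sigma>(3,6) by blast+
    then show "0 \<le> \<sigma> u" "\<sigma> u \<le> T" "0 \<le> \<sigma>' u" "\<sigma>' u \<le> L" by auto
  qed (rule bspec[OF eqn u])
  then show ?thesis unfolding rep_equiv_def
    by (intro exI[of _ \<sigma>] exI[of _ \<sigma>'] conjI ballI \<sigma>)
qed

section \<open>Axes and palindromes\<close>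

text \<open>Both are the signature of the common path on the unit interval; a nondecreasing
  surjection maps end points to end points.\<close>

lemma rep_equiv_signature:
  assumes \<eta>: "bv_path A \<eta>" and \<eta>': "bv_path B \<eta>'" and r: "rep_equiv A \<eta> B \<eta>'"
  shows "signature 0 A \<eta> = signature 0 B \<eta>'"
proof -
  obtain \<sigma> \<sigma>' :: "real \<Rightarrow> real" where \<sigma>: "continuous_on {0..1} \<sigma>" "mono_on {0..1} \<sigma>" "\<sigma> ` {0..1} = {0..A}"
    and \<sigma>': "continuous_on {0..1} \<sigma>'" "mono_on {0..1} \<sigma>'" "\<sigma>' ` {0..1} = {0..B}"
    and eq: "\<And>u. u \<in> {0..1} \<Longrightarrow> \<eta> (\<sigma> u) = \<eta>' (\<sigma>' u)"
    using r unfolding rep_equiv_def by blast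
  have ends: "\<tau> 0 = 0 \<and> \<tau> 1 = R" if m: "mono_on {0..1} \<tau>" and im: "\<tau> ` {0..1} = {0..R}" and R: "0 \<le> R"
    for \<tau> :: "real \<Rightarrow> real" and R
  proof -
    have mm: "\<tau> x \<le> \<tau> y" if "0 \<le> x" "x \<le> y" "y \<le> 1" for x y using m that by (auto simp: mono_on_def)
    have "0 \<in> \<tau> ` {0..1}" "R \<in> \<tau> ` {0..1}" using im R by auto
    then obtain x y where "0 \<le> x" "x \<le> 1" "\<tau> x = 0" "0 \<le> y" "y \<le> 1" "\<tau> y = R" by auto
    moreover have "\<tau> 0 \<in> {0..R}" "\<tau> 1 \<in> {0..R}" using im by auto
    ultimately show ?thesis using mm[of 0 x] mm[of y 1] by auto
  qed
  have sig: "controlled 0 1 (\<lambda>t. \<omega> (\<tau> t) + t) (\<lambda>t. \<zeta> (\<tau> t)) \<and> signature 0 1 (\<lambda>t. \<zeta> (\<tau> t)) = signature 0 R \<zeta>"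
    if c: "controlled 0 R \<omega> \<zeta>" and R: "0 \<le> R" and \<tau>: "continuous_on {0..1} \<tau>" "mono_on {0..1} \<tau>" "\<tau> ` {0..1} = {0..R}"
    for \<tau> :: "real \<Rightarrow> real" and R \<omega> and \<zeta> :: "real \<Rightarrow> 'a"
  proof -
    have rng: "0 \<le> \<tau> t \<and> \<tau> t \<le> R" if "0 \<le> t" "t \<le> 1" for t
      using \<tau>(3) that by (metis atLeastAtMost_iff image_eqI)
    show ?thesis
      using signature_time_change[OF c \<tau>(1,2) rng, of "\<lambda>t. \<zeta> (\<tau> t)"] ends[OF \<tau>(2,3) R] by auto
  qed
  obtain \<omega> where A: "0 \<le> A" and c: "controlled 0 A \<omega> \<eta>" using \<eta> by (rule bv_path_controlled)
  obtain \<omega>' where B: "0 \<le> B" and c': "controlled 0 B \<omega>' \<eta>'" using \<eta>' by (rule bv_path_controlled)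
  note s = sig[OF c A \<sigma>] and s' = sig[OF c' B \<sigma>']
  have "signature 0 1 (\<lambda>t. \<eta>' (\<sigma>' t)) = signature 0 1 (\<lambda>t. \<eta> (\<sigma> t))"
    by (rule signature_cong(2)[OF conjunct1[OF s]]) (use eq in auto)
  then show ?thesis using s s' by simp
qed

definition axis_point :: "'v::real_normed_vector tensor_series \<Rightarrow> 'v \<Rightarrow> real \<Rightarrow> 'v tensor_series"
  where "axis_point p v t = tensor_mult p (tensor_exp (t *\<^sub>R v))"

lemma axis_point_zero [simp]: "axis_point p v 0 = p"
  by (simp add: axis_point_def tensor_exp_zero)

lemma axis_point_Nil [simp]: "p [] = 1 \<Longrightarrow> axis_point p v t [] = 1"
  by (simp add: axis_point_def)

lemma axis_point_axis_point: "axis_point (axis_point p v s) v t = axis_point p v (s + t)"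
  by (simp add: axis_point_def tensor_mult_assoc tensor_exp_add)

lemma axis_point_inj:
  fixes v :: "'v::real_normed_vector"
  assumes fd: "\<exists>B::'v set. finite B \<and> span B = UNIV" and "v \<noteq> 0" "p [] = 1"
    and eq: "axis_point p v s = axis_point p v t"
  shows "s = t"
proof -
  obtain \<phi> :: "'v \<Rightarrow>\<^sub>L real" where \<phi>: "blinfun_apply \<phi> v \<noteq> 0"
    using finite_dim_functionals_separate[OF fd, of v] assms(2) by blast
  have "tensor_exp (s *\<^sub>R v) = tensor_exp (t *\<^sub>R v)"
    using tensor_mult_left_cancel[of p, OF assms(3)] eq unfolding axis_point_def by blast
  from fun_cong[OF this, of "[\<phi>]"] show ?thesis using \<phi> by (simp add: tensor_exp_def blinfun.scaleR_right)
qed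

text \<open>The conjugate of \<open>tensor_exp v\<close> by \<open>p\<close>. Left multiplication by
  it shifts the axis through \<open>p\<close> by one unit, so it depends on the axis only and not on
  the point chosen on it.\<close>

definition axis_translation :: "'v::real_normed_vector tensor_series \<Rightarrow> 'v \<Rightarrow> 'v tensor_series"
  where "axis_translation p v = tensor_mult (tensor_mult p (tensor_exp v)) (tensor_inv p)"

lemma axis_translation_Nil [simp]: "p [] = 1 \<Longrightarrow> axis_translation p v [] = 1"
  by (simp add: axis_translation_def)

lemma axis_translation_point:
  assumes "p [] = 1"
  shows "tensor_mult (axis_translation p v) (axis_point p v t) = axis_point p v (1 + t)"
proof -
  have "tensor_mult (axis_translation p v) (axis_point p v t) =
      tensor_mult (tensor_mult p (tensor_exp v)) (tensor_mult (tensor_mult (tensor_inv p) p) (tensor_exp (t *\<^sub>R v)))"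
    by (simp add: axis_translation_def axis_point_def tensor_mult_assoc)
  also have "\<dots> = tensor_mult p (tensor_mult (tensor_exp (1 *\<^sub>R v)) (tensor_exp (t *\<^sub>R v)))"
    using tensor_inv_left[of p, OF assms] by (simp add: tensor_mult_assoc)
  finally show ?thesis unfolding tensor_exp_add by (simp add: axis_point_def)
qed

lemma axis_translation_axis_point:
  assumes "p [] = 1"
  shows "axis_translation (axis_point p v t) v = axis_translation p v"
proof (rule tensor_mult_right_cancel[of "axis_point p v t"])
  have "tensor_mult (axis_translation (axis_point p v t) v) (axis_point p v t) = axis_point p v (t + 1)"
    using axis_translation_point[of "axis_point p v t" v 0] assms by (simp add: axis_point_axis_point)
  then show "tensor_mult (axis_translation (axis_point p v t) v) (axis_point p v t) =
      tensor_mult (axis_translation p v) (axis_point p v t)"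
    using axis_translation_point[of p v t] assms by (simp add: add.commute)
qed (use assms in simp)

definition palindrome :: "real \<Rightarrow> (real \<Rightarrow> 'v::real_normed_vector) \<Rightarrow> 'v \<Rightarrow> real \<Rightarrow> 'v"
  where "palindrome A \<alpha> v = path_concat (A + 1) (path_concat A \<alpha> (\<lambda>t. t *\<^sub>R v)) (path_reverse A \<alpha>)"

text \<open>Chen's identity rewrites the inverse of a tail of \<open>\<alpha>\<close> as
  \<open>tensor_inv p\<close> times a prefix. The last piece is thus the image of
  \<open>\<alpha>\<close> under the axis translation, run backwards.\<close>

lemma palindrome_signature:
  assumes \<alpha>: "bv_path A \<alpha>"
  defines "p \<equiv> signature 0 A \<alpha>"
  shows "bv_path (A + 1 + A) (palindrome A \<alpha> v)"
    and "0 \<le> u \<Longrightarrow> u \<le> A \<Longrightarrow> signature 0 u (palindrome A \<alpha> v) = signature 0 u \<alpha>"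
    and "A \<le> u \<Longrightarrow> u \<le> A + 1 \<Longrightarrow> signature 0 u (palindrome A \<alpha> v) = axis_point p v (u - A)"
    and "A + 1 \<le> u \<Longrightarrow> u \<le> A + 1 + A \<Longrightarrow>
      signature 0 u (palindrome A \<alpha> v) = tensor_mult (axis_translation p v) (signature 0 (A + 1 + A - u) \<alpha>)"
    and "signature 0 (A + 1 + A) (palindrome A \<alpha> v) = axis_translation p v"
proof -
  have A: "0 \<le> A" using \<alpha> by (simp add: bv_path_def)
  have lin: "bv_path 1 (\<lambda>t. t *\<^sub>R v)" by (rule bv_path_linear) simp
  note c1 = bv_path_concat[OF \<alpha> lin]
  note rv = bv_path_reverse[OF \<alpha>]
  note c2 = bv_path_concat[OF c1(1) rv(1), folded palindrome_def]
  show "bv_path (A + 1 + A) (palindrome A \<alpha> v)" by (rule c2(1))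
  show "signature 0 u (palindrome A \<alpha> v) = signature 0 u \<alpha>" if "0 \<le> u" "u \<le> A"
    using c1(2)[of 0 u] c2(2)[of 0 u] that by simp
  have mid: "signature 0 u (palindrome A \<alpha> v) = axis_point p v (u - A)" if "A \<le> u" "u \<le> A + 1" for u
    using c1(4)[of "u - A"] c2(2)[of 0 u] that A signature_linear[of 0 "u - A" v]
    by (simp add: p_def axis_point_def)
  then show "A \<le> u \<Longrightarrow> u \<le> A + 1 \<Longrightarrow> signature 0 u (palindrome A \<alpha> v) = axis_point p v (u - A)" .
  have e1: "signature 0 (A + 1) (path_concat A \<alpha> (\<lambda>t. t *\<^sub>R v)) = tensor_mult p (tensor_exp v)"
    using c1(4)[of 1] signature_linear[of 0 1 v] by (simp add: p_def)
  obtain \<omega> where c: "controlled 0 A \<omega> \<alpha>" using \<alpha> by (rule bv_path_controlled)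
  have last: "signature 0 u (palindrome A \<alpha> v) = tensor_mult (axis_translation p v) (signature 0 (A + 1 + A - u) \<alpha>)"
    if u: "A + 1 \<le> u" "u \<le> A + 1 + A" for u
  proof -
    define w where "w = A + 1 + A - u"
    have w: "0 \<le> w" "w \<le> A" using u by (auto simp: w_def)
    have "signature 0 u (palindrome A \<alpha> v) = tensor_mult (tensor_mult p (tensor_exp v)) (tensor_inv (signature w A \<alpha>))"
      using c2(4)[of "u - (A + 1)"] rv(2)[of 0 "u - (A + 1)"] u e1 by (simp add: w_def algebra_simps)
    also have "tensor_inv (signature w A \<alpha>) = tensor_mult (tensor_inv p) (signature 0 w \<alpha>)"
    proof (rule tensor_mult_right_cancel[of "signature w A \<alpha>"])
      have "tensor_mult (signature 0 w \<alpha>) (signature w A \<alpha>) = p" unfolding p_def by (rule chen[OF c, symmetric]) (use w in auto)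
      then show "tensor_mult (tensor_inv (signature w A \<alpha>)) (signature w A \<alpha>) =
          tensor_mult (tensor_mult (tensor_inv p) (signature 0 w \<alpha>)) (signature w A \<alpha>)"
        by (simp add: tensor_mult_assoc tensor_inv_left p_def)
    qed simp
    finally show ?thesis by (simp add: axis_translation_def tensor_mult_assoc w_def)
  qed
  then show "A + 1 \<le> u \<Longrightarrow> u \<le> A + 1 + A \<Longrightarrow>
      signature 0 u (palindrome A \<alpha> v) = tensor_mult (axis_translation p v) (signature 0 (A + 1 + A - u) \<alpha>)" .
  show "signature 0 (A + 1 + A) (palindrome A \<alpha> v) = axis_translation p v"
    using last[of "A + 1 + A"] A by (simp add: signature_degenerate)
qed

text \<open>The axis is based at the end point of \<open>\<alpha>\<close> itself, so the hit has
  parameter \<open>0\<close>; another base point is exchanged for it by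
  \<open>axis_translation_axis_point\<close>.\<close>

locale axis_hit =
  fixes A :: real and \<alpha> :: "real \<Rightarrow> 'v::real_normed_vector" and v :: 'v
  assumes fd: "\<exists>B::'v set. finite B \<and> span B = UNIV"
    and path: "bv_path A \<alpha>" and v: "v \<noteq> 0"
    and first: "\<And>s t. 0 \<le> s \<Longrightarrow> s < A \<Longrightarrow> signature 0 s \<alpha> \<noteq> axis_point (signature 0 A \<alpha>) v t"
begin

abbreviation "p \<equiv> signature 0 A \<alpha>"
abbreviation "Y u \<equiv> signature 0 u (palindrome A \<alpha> v)"

lemma A: "0 \<le> A" using path by (simp add: bv_path_def)

text \<open>The translation preserves the axis, so the translated copy of \<open>\<alpha>\<close>
  inherits the first-hit property, with the hit now at parameter \<open>1\<close>.\<close>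

lemma translated_on_axis:
  assumes "0 \<le> s" "s \<le> A" "tensor_mult (axis_translation p v) (signature 0 s \<alpha>) = axis_point p v t"
  shows "s = A" "t = 1"
proof -
  have "tensor_mult (axis_translation p v) (signature 0 s \<alpha>) = tensor_mult (axis_translation p v) (axis_point p v (t - 1))"
    using assms(3) axis_translation_point[of p v "t - 1"] by simp
  then have e: "signature 0 s \<alpha> = axis_point p v (t - 1)" by (rule tensor_mult_left_cancel[rotated]) simp
  then show "s = A" using first[of s "t - 1"] assms by (cases "s = A") auto
  then have "axis_point p v 0 = axis_point p v (t - 1)" using e by simp
  then show "t = 1" using axis_point_inj[OF fd v, of p 0 "t - 1"] by simp
qed

lemma on_axis:
  assumes "0 \<le> s" "s \<le> A" "signature 0 s \<alpha> = axis_point p v t"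
  shows "s = A" "t = 0"
proof -
  show "s = A" using first[of s t] assms by (cases "s = A") auto
  then have "axis_point p v 0 = axis_point p v t" using assms(3) by simp
  then show "t = 0" using axis_point_inj[OF fd v, of p 0 t] by simp
qed

lemma Y_on_axis:
  assumes "0 \<le> w" "w \<le> A + 1 + A" "w \<le> A \<or> A + 1 \<le> w" "Y w = axis_point p v t"
  shows "w = A \<and> t = 0 \<or> w = A + 1 \<and> t = 1"
proof (cases "w \<le> A")
  case True
  then show ?thesis using on_axis[of w t] palindrome_signature(2)[OF path, of w v] assms by simp
next
  case False
  then show ?thesis using translated_on_axis[of "A + 1 + A - w" t] palindrome_signature(4)[OF path, of w v] assms by simp
qed

lemma Y_mid: "A < u \<Longrightarrow> u < A + 1 \<Longrightarrow> 0 \<le> w \<Longrightarrow> w \<le> A + 1 + A \<Longrightarrow> w \<le> A \<or> A + 1 \<le> w \<Longrightarrow> Y u \<noteq> Y w"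
  using Y_on_axis[of w "u - A"] palindrome_signature(3)[OF path, of u v] by auto

lemma palindrome_middle_increment: "palindrome A \<alpha> v (A + 1) - palindrome A \<alpha> v A = v"
  using A by (simp add: palindrome_def path_concat_def)

lemma middle_not_excursion:
  assumes "\<And>\<phi> :: 'v \<Rightarrow>\<^sub>L real. blinfun_apply \<phi> (palindrome A \<alpha> v (A + 1)) = blinfun_apply \<phi> (palindrome A \<alpha> v A)"
  shows False
proof -
  have "blinfun_apply \<phi> (palindrome A \<alpha> v (A + 1) - palindrome A \<alpha> v A) = 0" for \<phi> :: "'v \<Rightarrow>\<^sub>L real"
    using assms[of \<phi>] by (simp add: blinfun.diff_right)
  then have "blinfun_apply \<phi> v = 0" for \<phi> :: "'v \<Rightarrow>\<^sub>L real"
    unfolding palindrome_middle_increment .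
  then show False using finite_dim_functionals_separate[OF fd] v by blast
qed

text \<open>If \<open>\<gamma>\<close> avoided the axis, the middle segment would be an excursion of
  the loop that \<open>\<gamma>\<close> forms with the palindrome; but its increment is
  \<open>v\<close>, not \<open>0\<close>.\<close>

theorem path_hits_axis:
  assumes \<gamma>: "bv_path T \<gamma>" and eq: "signature 0 T \<gamma> = axis_translation p v"
  shows "\<exists>u\<in>{0..T}. \<exists>t. signature 0 u \<gamma> = axis_point p v t"
proof (rule ccontr)
  assume not: "\<not> ?thesis"
  have T: "0 \<le> T" using \<gamma> by (simp add: bv_path_def)
  have e: "signature 0 (A + 1 + A) (palindrome A \<alpha> v) = signature 0 T \<gamma>"
    using palindrome_signature(5)[OF path, of v] eq by simp
  note loop = path_loop[OF palindrome_signature(1)[OF path] \<gamma> e]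
  let ?\<eta> = "path_concat (A + 1 + A) (palindrome A \<alpha> v) (path_reverse T \<gamma>)"
  obtain \<omega> where c: "controlled 0 (A + 1 + A + T) \<omega> ?\<eta>" using loop(1) by (rule bv_path_controlled)
  have "blinfun_apply \<phi> (?\<eta> (A + 1)) = blinfun_apply \<phi> (?\<eta> A)" for \<phi> :: "'v \<Rightarrow>\<^sub>L real"
  proof (rule excursion_closes[OF c A _ _ ])
    show "A \<le> A + 1" "A + 1 \<le> A + 1 + A + T" using A T by auto
    show "signature 0 (A + 1 + A + T) ?\<eta> = tensor_one" using loop(3)[of "A + 1 + A + T"] T by (simp add: signature_degenerate)
    fix u w assume u: "A < u" "u < A + 1" and w: "0 \<le> w" "w \<le> A + 1 + A + T" "w \<le> A \<or> A + 1 \<le> w"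
    have eu: "signature 0 u ?\<eta> = Y u" by (rule loop(2)) (use u A in auto)
    show "signature 0 u ?\<eta> \<noteq> signature 0 w ?\<eta>"
    proof (cases "w \<le> A + 1 + A")
      case True
      then show ?thesis using eu loop(2)[of w] Y_mid[OF u, of w] w by simp
    next
      case False
      then have "signature 0 w ?\<eta> = signature 0 (A + 1 + A + T - w) \<gamma>" by (intro loop(3)) (use w in auto)
      moreover have "Y u = axis_point p v (u - A)" by (rule palindrome_signature(3)[OF path]) (use u in auto)
      moreover have "A + 1 + A + T - w \<in> {0..T}" using False w by auto
      ultimately show ?thesis using not eu by metis
    qed
  qed
  then show False using A by (intro middle_not_excursion) (simp add: path_concat_def)
qed

text \<open>Only an interval containing the whole middle segment calls for
  \<open>excursion_closes\<close>. Inside an outer piece the claim is that for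
  \<open>\<alpha>\<close>, on the segment the axis parameter is injective, and an interval from an
  outer piece to a point of the segment would give an additional hit of the axis.\<close>

theorem palindrome_tree_reduced:
  assumes red: "tree_reduced A \<alpha>"
  shows "tree_reduced (A + 1 + A) (palindrome A \<alpha> v)"
  unfolding tree_reduced_def
proof (intro allI impI, elim conjE)
  fix s t assume s: "0 \<le> s" and st: "s \<le> t" and t: "t \<le> A + 1 + A" and triv: "signature s t (palindrome A \<alpha> v) = tensor_one"
  let ?P = "palindrome A \<alpha> v"
  obtain \<omega> where c: "controlled 0 (A + 1 + A) \<omega> ?P" using palindrome_signature(1)[OF path] by (rule bv_path_controlled)
  have Yeq: "Y s = Y t" using signature_prefix_eq_iff[OF c s st t] triv by simp
  have const: "?P constant_on {s..t}" if "\<And>u. s \<le> u \<Longrightarrow> u \<le> t \<Longrightarrow> ?P u = k" for k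
    unfolding constant_on_def using that by auto
  consider "t \<le> A" | "s < A" "A < t" "t \<le> A + 1" | "A \<le> s" "t \<le> A + 1" | "s < A" "A + 1 < t"
    | "A \<le> s" "s < A + 1" "A + 1 < t" | "A + 1 \<le> s" by linarith
  then show "?P constant_on {s..t}"
  proof cases
    case 1
    have "signature 0 s \<alpha> = signature 0 t \<alpha>"
      using Yeq palindrome_signature(2)[OF path, of s v] palindrome_signature(2)[OF path, of t v] 1 s st by simp
    note r = tree_reduced_prefixD(1)[OF path red s _ _ 1 this]
    show ?thesis
    proof (rule const)
      fix u assume "s \<le> u" "u \<le> t"
      then show "?P u = \<alpha> s" using r[of u] 1 by (simp add: palindrome_def path_concat_def)
    qed
  next
    case 2
    then have "Y s = axis_point p v (t - A)" using Yeq palindrome_signature(3)[OF path, of t v] by simp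
    then show ?thesis using Y_on_axis[of s "t - A"] 2 s by auto
  next
    case 3
    then have "axis_point p v (s - A) = axis_point p v (t - A)"
      using Yeq palindrome_signature(3)[OF path, of t v] palindrome_signature(3)[OF path, of s v] st by simp
    then have "s = t" using axis_point_inj[OF fd v, of p "s - A" "t - A"] by simp
    then show ?thesis by (simp add: constant_on_def)
  next
    case 4
    \<comment> \<open>The loop now starts at \<open>s\<close>; its prefixes are those of the
      palindrome up to the left factor \<open>Y s\<close>.\<close>
    have ct: "controlled s t \<omega> ?P" by (rule controlled_subinterval[OF c s t])
    have "blinfun_apply \<phi> (?P (A + 1)) = blinfun_apply \<phi> (?P A)" for \<phi> :: "'v \<Rightarrow>\<^sub>L real"
    proof (rule excursion_closes[OF ct _ _ _ triv])
      show "s \<le> A" "A \<le> A + 1" "A + 1 \<le> t" using 4 by auto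
      fix u w assume u: "A < u" "u < A + 1" and w: "s \<le> w" "w \<le> t" "w \<le> A \<or> A + 1 \<le> w"
      have "Y u \<noteq> Y w" by (rule Y_mid[OF u]) (use w s t in auto)
      moreover have "Y u = tensor_mult (Y s) (signature s u ?P)" by (rule chen[OF c]) (use s u 4 t in auto)
      moreover have "Y w = tensor_mult (Y s) (signature s w ?P)" by (rule chen[OF c]) (use s w t in auto)
      ultimately show "signature s u ?P \<noteq> signature s w ?P" by metis
    qed
    then show ?thesis using middle_not_excursion by blast
  next
    case 5
    then have "Y t = axis_point p v (s - A)" using Yeq palindrome_signature(3)[OF path, of s v] by simp
    then show ?thesis using Y_on_axis[of t "s - A"] 5 s t A by auto
  next
    case 6
    have "tensor_mult (axis_translation p v) (signature 0 (A + 1 + A - s) \<alpha>) =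
        tensor_mult (axis_translation p v) (signature 0 (A + 1 + A - t) \<alpha>)"
      using Yeq palindrome_signature(4)[OF path, of s v] palindrome_signature(4)[OF path, of t v] 6 st t by simp
    then have "signature 0 (A + 1 + A - t) \<alpha> = signature 0 (A + 1 + A - s) \<alpha>"
      using tensor_mult_left_cancel[of "axis_translation p v"] by simp
    note r = tree_reduced_prefixD(1)[OF path red _ _ _ _ this]
    have P: "?P u = ?P (A + 1) + (\<alpha> (A + 1 + A - u) - \<alpha> A)" if "A + 1 \<le> u" for u
      using that by (cases "u = A + 1") (simp_all add: palindrome_def path_concat_def path_reverse_def algebra_simps)
    show ?thesis
    proof (rule const)
      fix u assume "s \<le> u" "u \<le> t"
      then show "?P u = ?P (A + 1) + (\<alpha> (A + 1 + A - t) - \<alpha> A)"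
        using P[of u] r[of "A + 1 + A - u"] 6 t by simp
    qed
  qed
qed

end

text \<open>One functional with \<open>\<phi>0 v \<noteq> 0\<close> recovers the parameter from
  degree one. Lying on the axis is then a system of equations, one for each word, all continuous in
  \<open>u\<close>.\<close>

lemma axis_hits_closed:
  fixes v :: "'v::real_normed_vector"
  assumes fd: "\<exists>B::'v set. finite B \<and> span B = UNIV" and "v \<noteq> 0" and p: "p [] = 1" and c: "controlled 0 T \<omega> \<gamma>"
  shows "closed {u \<in> {0..T}. \<exists>t. signature 0 u \<gamma> = axis_point p v t}"
proof -
  obtain \<phi>0 :: "'v \<Rightarrow>\<^sub>L real" where \<phi>0: "blinfun_apply \<phi>0 v \<noteq> 0"
    using finite_dim_functionals_separate[OF fd, of v] assms(2) by blast
  define b where "b u = tensor_mult (tensor_inv p) (signature 0 u \<gamma>)" for u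
  define \<tau> where "\<tau> u = b u [\<phi>0] / blinfun_apply \<phi>0 v" for u
  have cb: "continuous_on {0..T} (\<lambda>u. b u w)" for w
    unfolding b_def tensor_mult_def
    by (intro continuous_intros continuous_on_product_then_coordinatewise[OF continuous_signature_prefix[OF c]])
  have "(\<exists>t. signature 0 u \<gamma> = axis_point p v t) \<longleftrightarrow> (\<forall>w. b u w - \<tau> u ^ length w * tensor_exp v w = 0)" for u
  proof
    assume "\<exists>t. signature 0 u \<gamma> = axis_point p v t"
    then obtain t where "signature 0 u \<gamma> = axis_point p v t" by blast
    then have "b u = tensor_mult (tensor_mult (tensor_inv p) p) (tensor_exp (t *\<^sub>R v))"
      unfolding b_def axis_point_def by (simp add: tensor_mult_assoc)
    then have bu: "b u = tensor_exp (t *\<^sub>R v)" using tensor_inv_left[of p, OF p] by simp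
    then have "\<tau> u = t" using \<phi>0 by (simp add: \<tau>_def tensor_exp_def blinfun.scaleR_right)
    then show "\<forall>w. b u w - \<tau> u ^ length w * tensor_exp v w = 0" using bu by (simp add: tensor_exp_scaleR)
  next
    assume "\<forall>w. b u w - \<tau> u ^ length w * tensor_exp v w = 0"
    then have "b u = tensor_exp (\<tau> u *\<^sub>R v)" by (auto simp: tensor_exp_scaleR)
    then have "tensor_mult (tensor_mult p (tensor_inv p)) (signature 0 u \<gamma>) = axis_point p v (\<tau> u)"
      unfolding b_def axis_point_def by (simp add: tensor_mult_assoc)
    then show "\<exists>t. signature 0 u \<gamma> = axis_point p v t" using tensor_inv_right[of p, OF p] by auto
  qed
  then have "{u \<in> {0..T}. \<exists>t. signature 0 u \<gamma> = axis_point p v t} =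
      (\<Inter>w. {u \<in> {0..T}. b u w - \<tau> u ^ length w * tensor_exp v w = 0})" by auto
  moreover have "closed {u \<in> {0..T}. b u w - \<tau> u ^ length w * tensor_exp v w = 0}" for w
    unfolding \<tau>_def by (rule continuous_closed_preimage_constant) (intro continuous_intros cb, use \<phi>0 in auto)
  ultimately show ?thesis by (simp add: closed_INT)
qed

lemma axis_first_hit:
  fixes v :: "'v::real_normed_vector"
  assumes fd: "\<exists>B::'v set. finite B \<and> span B = UNIV" and v: "v \<noteq> 0" and p: "p [] = 1" and \<gamma>: "bv_path T \<gamma>"
    and hit: "u \<in> {0..T}" "signature 0 u \<gamma> = axis_point p v t"
  obtains u\<^sub>0 t\<^sub>0 where "0 \<le> u\<^sub>0" "u\<^sub>0 \<le> T" "signature 0 u\<^sub>0 \<gamma> = axis_point p v t\<^sub>0" "axis_hit u\<^sub>0 \<gamma> v"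
proof -
  obtain \<omega> where c: "controlled 0 T \<omega> \<gamma>" using \<gamma> by (rule bv_path_controlled)
  define H where "H = {u \<in> {0..T}. \<exists>t. signature 0 u \<gamma> = axis_point p v t}"
  have "closed H" unfolding H_def by (rule axis_hits_closed[where p = p, OF fd v p c])
  moreover have "H \<noteq> {}" using hit by (auto simp: H_def)
  moreover have bdd: "bdd_below H" by (auto simp: H_def bdd_below_def)
  ultimately have "Inf H \<in> H" by (intro closed_contains_Inf)
  then obtain t\<^sub>0 where h: "0 \<le> Inf H" "Inf H \<le> T" "signature 0 (Inf H) \<gamma> = axis_point p v t\<^sub>0" by (auto simp: H_def)
  have "axis_hit (Inf H) \<gamma> v"
  proof
    show "bv_path (Inf H) \<gamma>" by (rule bv_path_restrict[OF \<gamma> h(1,2)])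
    fix s t assume s: "0 \<le> s" "s < Inf H"
    show "signature 0 s \<gamma> \<noteq> axis_point (signature 0 (Inf H) \<gamma>) v t"
    proof
      assume "signature 0 s \<gamma> = axis_point (signature 0 (Inf H) \<gamma>) v t"
      then have "s \<in> H" using s h by (auto simp: H_def axis_point_axis_point)
      then show False using cInf_lower[OF _ bdd, of s] s by simp
    qed
  qed (fact fd v)+
  then show ?thesis using that h by blast
qed

text \<open>Two first hits are taken. A path representing \<open>a\<close> is cut where it first
  meets the axis, which provides the palindrome for \<open>path_hits_axis\<close>; hence
  \<open>\<gamma>\<close> meets the axis and is cut in turn.\<close>

theorem axis_gate:
  fixes v :: "'v::real_normed_vector"
  assumes fd: "\<exists>B::'v set. finite B \<and> span B = UNIV" and v: "v \<noteq> 0"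
    and \<gamma>: "bv_path T \<gamma>" and a: "a \<in> carrier sig_group" and eq: "signature 0 T \<gamma> = axis_translation a v"
  obtains u\<^sub>0 t\<^sub>0 where "0 \<le> u\<^sub>0" "u\<^sub>0 \<le> T" "signature 0 u\<^sub>0 \<gamma> = axis_point a v t\<^sub>0" "axis_hit u\<^sub>0 \<gamma> v"
proof -
  obtain A \<alpha> where \<alpha>: "bv_path A \<alpha>" "a = signature 0 A \<alpha>" using a by (rule sig_groupE)
  have "A \<in> {0..A}" using \<alpha> by (simp add: bv_path_def)
  moreover have a1: "a [] = 1" by (simp add: \<alpha>)
  moreover have "signature 0 A \<alpha> = axis_point a v 0" by (simp add: \<alpha>)
  ultimately obtain u t where h: "0 \<le> u" "u \<le> A" "signature 0 u \<alpha> = axis_point a v t" "axis_hit u \<alpha> v"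
    using axis_first_hit[where p = a, OF fd v _ \<alpha>(1)] by metis
  have "signature 0 T \<gamma> = axis_translation (signature 0 u \<alpha>) v"
    using eq axis_translation_axis_point[of a, OF a1] h(3) by simp
  from axis_hit.path_hits_axis[OF h(4) \<gamma> this] obtain w r where w: "w \<in> {0..T}" "signature 0 w \<gamma> = axis_point (signature 0 u \<alpha>) v r"
    by blast
  then have "signature 0 w \<gamma> = axis_point a v (t + r)" using h(3) by (simp add: axis_point_axis_point)
  from axis_first_hit[where p = a, OF fd v a1 \<gamma> w(1) this] show ?thesis using that by metis
qed

theorem axis_hit_palindromic:
  assumes hit: "axis_hit u \<gamma> v" and u: "0 \<le> u" "u \<le> T" and \<gamma>: "bv_path T \<gamma>" "tree_reduced T \<gamma>"
    and eq: "signature 0 T \<gamma> = axis_translation (signature 0 u \<gamma>) v"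
  shows "palindromic_at T \<gamma> v u"
proof -
  interpret axis_hit u \<gamma> v by (rule hit)
  have "rep_equiv T \<gamma> (u + 1 + u) (palindrome u \<gamma> v)"
  proof (rule tree_reduced_unique[OF fd \<gamma> palindrome_signature(1)[OF path]])
    show "tree_reduced (u + 1 + u) (palindrome u \<gamma> v)"
      by (rule palindrome_tree_reduced[OF tree_reduced_restrict[OF \<gamma>(2) u(2)]])
    show "signature 0 T \<gamma> = signature 0 (u + 1 + u) (palindrome u \<gamma> v)"
      using palindrome_signature(5)[OF path, of v] eq by simp
    show "\<gamma> 0 = palindrome u \<gamma> v 0" using u by (simp add: palindrome_def path_concat_def)
  qed
  then show ?thesis unfolding palindromic_at_def palindrome_def .
qed

lemma palindromic_signature:
  assumes \<gamma>: "bv_path T \<gamma>" and u: "0 \<le> u" "u \<le> T" and pal: "palindromic_at T \<gamma> v u"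
  shows "signature 0 T \<gamma> = axis_translation (signature 0 u \<gamma>) v"
proof -
  note p = bv_path_restrict[OF \<gamma> u]
  have "signature 0 T \<gamma> = signature 0 (u + 1 + u) (palindrome u \<gamma> v)"
    by (rule rep_equiv_signature[OF \<gamma> palindrome_signature(1)[OF p]])
      (use pal in \<open>simp add: palindromic_at_def palindrome_def\<close>)
  then show ?thesis using palindrome_signature(5)[OF p, of v] by simp
qed

section \<open>Lower bounds for lengths\<close>

text \<open>Inductively, a function \<open>ds\<close> near \<open>1\<close> on the new set and near
  \<open>0\<close> on the old ones is added, and the old functions are multiplied by
  \<open>1 - ds\<close>. This keeps the sum at most \<open>1\<close>, and error \<open>e / 2\<close>
  at both places gives \<open>(1 - e / 2)\<^sup>2 \<ge> 1 - e\<close>.\<close>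

lemma pairing_partition:
  fixes A :: "'i \<Rightarrow> 'v::real_normed_vector tensor_series set"
  assumes "finite I" "\<And>i. i \<in> I \<Longrightarrow> closed (A i)" "\<And>i. i \<in> I \<Longrightarrow> A i \<subseteq> characters M"
    "\<And>i j. i \<in> I \<Longrightarrow> j \<in> I \<Longrightarrow> i \<noteq> j \<Longrightarrow> A i \<inter> A j = {}" "0 < e" "e < 1"
  shows "\<exists>cs. \<forall>x\<in>characters M. (\<forall>i\<in>I. 0 \<le> pairing (cs i) x) \<and> (\<Sum>i\<in>I. pairing (cs i) x) \<le> 1 \<and>
    (\<forall>i\<in>I. x \<in> A i \<longrightarrow> 1 - e < pairing (cs i) x)"
  using assms
proof (induction I arbitrary: e rule: finite_induct)
  case (insert j I)
  have "\<exists>cs. \<forall>x\<in>characters M. (\<forall>i\<in>I. 0 \<le> pairing (cs i) x) \<and> (\<Sum>i\<in>I. pairing (cs i) x) \<le> 1 \<and>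
    (\<forall>i\<in>I. x \<in> A i \<longrightarrow> 1 - e / 2 < pairing (cs i) x)"
    by (rule insert.IH) (use insert.prems in auto)
  then obtain cs where cs: "\<And>x i. x \<in> characters M \<Longrightarrow> i \<in> I \<Longrightarrow> 0 \<le> pairing (cs i) x"
    "\<And>x. x \<in> characters M \<Longrightarrow> (\<Sum>i\<in>I. pairing (cs i) x) \<le> 1"
    "\<And>x i. x \<in> characters M \<Longrightarrow> i \<in> I \<Longrightarrow> x \<in> A i \<Longrightarrow> 1 - e / 2 < pairing (cs i) x" by blast
  have cl: "closed (\<Union>i\<in>I. A i)" by (rule closed_UN[OF insert.hyps(1)]) (use insert.prems in auto)
  have sub: "(\<Union>i\<in>I. A i) \<subseteq> characters M" using insert.prems(2) by blast
  have dj: "(\<Union>i\<in>I. A i) \<inter> A j = {}"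
  proof -
    have "A i \<inter> A j = {}" if "i \<in> I" for i
      by (rule insert.prems(3)) (use that insert.hyps(2) in auto)
    then show ?thesis by blast
  qed
  have Aj: "closed (A j)" "A j \<subseteq> characters M" using insert.prems by auto
  have e2: "0 < e / 2" "e / 2 < 1" using insert.prems by auto
  obtain ds where ds: "\<And>x :: 'v tensor_series. x \<in> characters M \<Longrightarrow> 0 \<le> pairing ds x \<and> pairing ds x \<le> 1"
    "\<And>x. x \<in> (\<Union>i\<in>I. A i) \<Longrightarrow> pairing ds x < e / 2" "\<And>x. x \<in> A j \<Longrightarrow> pairing ds x > 1 - e / 2"
    using pairing_separates[OF cl sub Aj dj e2] by blast
  have "\<exists>es. \<forall>x\<in>characters M. (1 - pairing ds x) * pairing (cs i) x = pairing es x" for i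
  proof (cases "characters M = ({} :: 'v tensor_series set)")
    case False
    then obtain es where es: "\<forall>x\<in>characters M. pairing ([(1, [])] @ map (\<lambda>(c, w). (- 1 * c, w)) ds) x * pairing (cs i) x = pairing es x"
      using pairing_mult by blast
    have "pairing ([(1, [])] @ map (\<lambda>(c, w). (- 1 * c, w)) ds) x = 1 - pairing ds x" if "x \<in> characters M" for x
      using that pairing_scale[of "-1" ds x] by (simp add: characters_def)
    then show ?thesis using es by auto
  qed simp
  then have "\<forall>i. \<exists>es. \<forall>x\<in>characters M. (1 - pairing ds x) * pairing (cs i) x = pairing es x" by blast
  then obtain es where es: "\<And>i x. x \<in> characters M \<Longrightarrow> pairing (es i) x = (1 - pairing ds x) * pairing (cs i) x"
    by (auto dest!: choice)
  define fs where "fs i = (if i = j then ds else es i)" for i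
  have sum_fs: "(\<Sum>i\<in>insert j I. pairing (fs i) x) = pairing ds x + (1 - pairing ds x) * (\<Sum>i\<in>I. pairing (cs i) x)"
    if x: "x \<in> characters M" for x
  proof -
    have "(\<Sum>i\<in>I. pairing (fs i) x) = (\<Sum>i\<in>I. (1 - pairing ds x) * pairing (cs i) x)"
      using insert.hyps(2) es[OF x] by (intro sum.cong) (auto simp: fs_def)
    then show ?thesis using insert.hyps by (simp add: fs_def sum_distrib_left)
  qed
  have "(\<forall>i\<in>insert j I. 0 \<le> pairing (fs i) x) \<and> (\<Sum>i\<in>insert j I. pairing (fs i) x) \<le> 1 \<and>
      (\<forall>i\<in>insert j I. x \<in> A i \<longrightarrow> 1 - e < pairing (fs i) x)" if x: "x \<in> characters M" for x
  proof (intro conjI ballI impI)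
    have d: "0 \<le> pairing ds x" "pairing ds x \<le> 1" using ds(1)[OF x] by auto
    show "(\<Sum>i\<in>insert j I. pairing (fs i) x) \<le> 1"
      unfolding sum_fs[OF x] using mult_left_mono[OF cs(2)[OF x], of "1 - pairing ds x"] d by simp
    fix i assume i: "i \<in> insert j I"
    show "0 \<le> pairing (fs i) x"
      using i d cs(1)[OF x] es[OF x] by (auto simp: fs_def)
    assume xi: "x \<in> A i"
    show "1 - e < pairing (fs i) x"
    proof (cases "i = j")
      case True then show ?thesis using ds(3)[of x] xi insert.prems by (simp add: fs_def)
    next
      case False
      then have iI: "i \<in> I" using i by simp
      have "pairing ds x < e / 2" using ds(2)[of x] iI xi by blast
      moreover have "1 - e / 2 < pairing (cs i) x" by (rule cs(3)[OF x iI xi])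
      ultimately have "(1 - e / 2) * (1 - e / 2) < (1 - pairing ds x) * pairing (cs i) x"
        using insert.prems(4,5) by (intro mult_strict_mono) auto
      moreover have "1 - e \<le> (1 - e / 2) * (1 - e / 2)" by (simp add: algebra_simps power2_eq_square)
      ultimately show ?thesis using es[OF x, of i] False by (simp add: fs_def)
    qed
  qed
  then show ?case by (intro exI[of _ fs] ballI)
qed auto

text \<open>The second claim is the duality of the Euclidean norm: for nonzero \<open>x\<close>, the
  inner product with \<open>x / E x\<close> has norm one and attains \<open>E x\<close> at
  \<open>x\<close>.\<close>

lemma euclidean_norm_norm_like:
  assumes "euclidean_norm E"
  shows "norm_like E"
    and "\<exists>\<psi>. linear \<psi> \<and> \<psi> x = E x \<and> (\<forall>y. \<bar>\<psi> y\<bar> \<le> E y)"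
proof -
  obtain B where B: "bilinear B" "\<And>x y. B x y = B y x" "\<And>x. x \<noteq> 0 \<Longrightarrow> 0 < B x x" "\<And>x. E x = sqrt (B x x)"
    using assms unfolding euclidean_norm_def by blast
  note bl = bilinear_ladd[OF B(1)] bilinear_radd[OF B(1)] bilinear_lmul[OF B(1)] bilinear_rmul[OF B(1)]
    bilinear_lzero[OF B(1)] bilinear_rzero[OF B(1)] bilinear_lsub[OF B(1)] bilinear_rsub[OF B(1)]
  have nn: "0 \<le> B x x" for x using B(3)[of x] by (cases "x = 0") (auto simp: bl)
  have sq: "E x * E x = B x x" for x using nn[of x] by (simp add: B(4))
  have E0: "0 \<le> E x" for x by (simp add: B(4) nn)
  have cs: "\<bar>B x y\<bar> \<le> E x * E y" for x y
  proof (cases "x = 0")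
    case False
    have p: "0 < B x x" by (rule B(3)[OF False])
    \<comment> \<open>The part of \<open>y\<close> orthogonal to \<open>x\<close>, scaled by
      \<open>B x x\<close> to avoid a quotient; that its square is nonnegative is the
      Cauchy--Schwarz inequality.\<close>
    define z where "z = B x x *\<^sub>R y - B x y *\<^sub>R x"
    have "0 \<le> B z z" by (rule nn)
    also have "B z z = B x x * (B x x * B y y - B x y * B x y)"
      using B(2)[of y x] by (simp add: z_def bl algebra_simps)
    finally have "B x y * B x y \<le> B x x * B y y" using p by (simp add: zero_le_mult_iff)
    then have "(B x y)\<^sup>2 \<le> (E x * E y)\<^sup>2"
      by (simp add: power2_eq_square sq[symmetric] mult.commute mult.left_commute)
    then show ?thesis using E0 by (simp add: abs_le_square_iff[symmetric] abs_mult)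
  qed (simp add: bl E0)
  show nl: "norm_like E"
    unfolding norm_like_def
  proof (intro conjI allI impI)
    fix x y
    have "(E (x + y))\<^sup>2 \<le> (E x + E y)\<^sup>2"
      using cs[of x y] B(2)[of y x] by (simp add: power2_eq_square sq bl algebra_simps)
    then show "E (x + y) \<le> E x + E y" using E0 by (simp add: power2_le_iff_abs_le)
  next
    fix c x
    have "sqrt (c * (c * B x x)) = \<bar>c\<bar> * sqrt (B x x)"
      unfolding mult.assoc[symmetric] real_sqrt_mult by simp
    then show "E (c *\<^sub>R x) = \<bar>c\<bar> * E x" by (simp add: B(4) bl)
  next
    fix x :: 'a assume "x \<noteq> 0" then show "0 < E x" by (simp add: B(3,4))
  qed
  show "\<exists>\<psi>. linear \<psi> \<and> \<psi> x = E x \<and> (\<forall>y. \<bar>\<psi> y\<bar> \<le> E y)"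
  proof (cases "x = 0")
    case True
    then show ?thesis using E0 norm_likeD(3)[OF nl] by (intro exI[of _ "\<lambda>_. 0"]) (auto intro: linear_zero)
  next
    case False
    then have p: "0 < E x" using norm_likeD(5)[OF nl] by blast
    show ?thesis
    proof (intro exI[of _ "\<lambda>y. B x y / E x"] conjI allI)
      show "linear (\<lambda>y. B x y / E x)"
        by (rule linearI) (simp_all add: bl add_divide_distrib)
      show "B x x / E x = E x" using sq[of x] p by (simp add: field_simps)
      show "\<bar>B x y / E x\<bar> \<le> E y" for y using cs[of x y] p by (simp add: field_simps)
    qed
  qed
qed

text \<open>A continuous \<open>W\<close> that avoids \<open>{a..b}\<close> and does not decrease
  from \<open>s\<close> to \<open>t\<close> has both end values on one side of it; for
  \<open>b < a\<close> the clipped value is always \<open>b\<close>.\<close>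

lemma clip_increment:
  fixes W :: "real \<Rightarrow> real"
  assumes W: "continuous_on {s..t} W" and st: "s \<le> t" and mono: "W s \<le> W t"
    and none: "\<And>x. s \<le> x \<Longrightarrow> x \<le> t \<Longrightarrow> \<not> (a \<le> W x \<and> W x \<le> b)"
  shows "min (max (W t) a) b = min (max (W s) a) b"
proof -
  consider "b < a" | "a \<le> b" "b < W s" | "a \<le> b" "W s < a" using none[of s] st by linarith
  then show ?thesis
  proof cases
    case 3
    have "W t < a"
    proof (rule ccontr)
      assume "\<not> W t < a"
      then obtain x where "s \<le> x" "x \<le> t" "W x = a" using IVT'[of W s a t] W st 3 by auto
      then show False using none[of x] 3 by simp
    qed
    then show ?thesis using 3 by simp
  qed (use mono in auto)
qed

text \<open>Any bound on the degrees is enough; the sum of the lengths dominates each of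
  them.\<close>

definition word_bound :: "(real \<times> 'a list) list \<Rightarrow> nat"
  where "word_bound cs = (\<Sum>(c, w)\<leftarrow>cs. length w)"

lemma pairing_eq_if_trunc_eq:
  assumes "tensor_trunc N x = tensor_trunc N y" "word_bound cs \<le> N"
  shows "pairing cs x = pairing cs y"
  using assms(2)
proof (induction cs)
  case (Cons p cs)
  obtain c w where p: "p = (c, w)" by force
  have "length w \<le> N" "word_bound cs \<le> N" using Cons.prems by (auto simp: word_bound_def p)
  moreover have "x w = y w" using fun_cong[OF assms(1), of w] \<open>length w \<le> N\<close> by (simp add: tensor_trunc_def)
  ultimately show ?case using Cons.IH by (simp add: p)
qed simp

text \<open>Duality: \<open>\<delta>\<close> is nearly normed by a polynomial one-form that has norm at most \<open>1\<close> on all characters,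
  and the integral of this form over a path depends only on a truncation of its signature.\<close>

theorem length_lower_bound:
  fixes \<delta> :: "real \<Rightarrow> 'v::real_normed_vector"
  assumes fd: "\<exists>B::'v set. finite B \<and> span B = UNIV" and E: "euclidean_norm E"
    and \<delta>: "bv_path L \<delta>" and red: "tree_reduced L \<delta>" and e: "0 < e" and R: "path_length E 0 L \<delta> \<le> R"
  shows "\<exists>N. \<forall>A \<eta>. bv_path A \<eta> \<and> tensor_trunc N (signature 0 A \<eta>) = tensor_trunc N (signature 0 L \<delta>) \<and>
    path_length E 0 A \<eta> \<le> R \<longrightarrow> path_length E 0 L \<delta> - e \<le> path_length E 0 A \<eta>"
proof -
  note Enl = euclidean_norm_norm_like(1)[OF E]
  have sE: "seminorm E" using norm_likeD(1,2)[OF Enl] by (simp add: seminorm_def)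
  have sn: "seminorm (norm :: 'v \<Rightarrow> real)" by (simp add: seminorm_def norm_triangle_ineq)
  obtain C1 where C1: "\<And>x. E x \<le> C1 * norm x" using finite_dim_dominated[OF fd norm_like_norm sE] by blast
  obtain C2 where C2: "C2 \<ge> 0" "\<And>x. norm x \<le> C2 * E x" using finite_dim_dominated[OF fd Enl sn] by blast
  interpret d: length_bounded E C1 L \<delta> by unfold_locales (use Enl C1 \<delta> in auto)
  define W where "W t = path_length E 0 t \<delta>" for t
  define len where "len = W L"
  \<comment> \<open>As the norm is at most \<open>C2 * E\<close>, this growth covers all paths of
    \<open>E\<close>-length at most \<open>R\<close>: one compact set of characters for every
    competitor.\<close>
  define M where "M = C2 * R"
  have W0: "0 \<le> W t" if "0 \<le> t" "t \<le> L" for t unfolding W_def by (rule d.length_nonneg[OF that])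
  have Wm: "W s \<le> W t" if "0 \<le> s" "s \<le> t" "t \<le> L" for s t unfolding W_def by (rule d.length_mono[OF that])
  have Wi: "E (\<delta> t - \<delta> s) \<le> W t - W s" if "0 \<le> s" "s \<le> t" "t \<le> L" for s t unfolding W_def by (rule d.length_increment[OF that])
  have Wc: "continuous_on {0..L} W" unfolding W_def by (rule d.continuous_length)
  have len0: "0 \<le> len" unfolding len_def by (rule W0[OF d.A order_refl])
  have inK: "signature s A \<eta> \<in> characters M"
    if \<eta>: "bv_path A \<eta>" "path_length E 0 A \<eta> \<le> R" and s: "0 \<le> s" "s \<le> A" for A s and \<eta> :: "real \<Rightarrow> 'v"
  proof -
    interpret h: length_bounded E C1 A \<eta> by unfold_locales (use Enl C1 \<eta> in auto)
    obtain \<omega> where c: "controlled 0 A \<omega> \<eta>" using \<eta>(1) by (rule bv_path_controlled)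
    show ?thesis
    proof (rule signature_in_characters[OF c s order_refl, where \<Omega> = "\<lambda>t. C2 * path_length E 0 t \<eta>"])
      fix s t assume o: "0 \<le> s" "s \<le> t" "t \<le> A"
      have "norm (\<eta> t - \<eta> s) \<le> C2 * E (\<eta> t - \<eta> s)" by (rule C2(2))
      also have "\<dots> \<le> C2 * (path_length E 0 t \<eta> - path_length E 0 s \<eta>)"
        by (intro mult_left_mono h.length_increment o C2(1))
      finally show "norm (\<eta> t - \<eta> s) \<le> C2 * path_length E 0 t \<eta> - C2 * path_length E 0 s \<eta>" by (simp add: algebra_simps)
    next
      have "C2 * (path_length E 0 A \<eta> - path_length E 0 s \<eta>) \<le> C2 * R"
        using h.length_nonneg[OF s] \<eta>(2) by (intro mult_left_mono C2(1)) simp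
      then show "C2 * path_length E 0 A \<eta> - C2 * path_length E 0 s \<eta> \<le> M" by (simp add: M_def algebra_simps)
    qed
  qed
  obtain \<omega> where c: "controlled 0 L \<omega> \<delta>" using \<delta> by (rule bv_path_controlled)
  define X where "X t = signature t L \<delta>" for t
  have XK: "X t \<in> characters M" if "0 \<le> t" "t \<le> L" for t unfolding X_def by (rule inK[OF \<delta> R that])
  have cX: "continuous_on {0..L} X" unfolding X_def by (rule continuous_signature_path[OF c d.A order_refl])
  \<comment> \<open>Tree-reducedness enters here: equal tails force the path to rest in between. So
    arcs with disjoint ranges of arc length have disjoint sets of tails.\<close>
  have XW: "W s = W t" if st: "0 \<le> s" "s \<le> t" "t \<le> L" and eq: "X s = X t" for s t
  proof -
    have "tensor_mult (signature s t \<delta>) (X t) = tensor_mult tensor_one (X t)"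
      using chen[OF c st order_refl] eq by (simp add: X_def)
    then have "signature s t \<delta> = tensor_one" by (rule tensor_mult_right_cancel[rotated]) (simp add: X_def)
    then have "\<delta> constant_on {s..t}" using red st unfolding tree_reduced_def by blast
    then show ?thesis unfolding W_def by (rule d.length_eq_if_constant[OF st])
  qed
  have "len - e / 4 < Sup (variation_sums E 0 L \<delta>)" using e by (simp add: len_def W_def path_length_def)
  from less_cSupD[OF d.nonempty[OF d.A] this] obtain D where D: "D division_of {0..L}"
    and DS: "len - e / 4 < (\<Sum>K\<in>D. E (\<delta> (Sup K) - \<delta> (Inf K)))"
    by (auto simp: variation_sums_def)
  note b = division_interval_bounds[OF D]
  have fD: "finite D" using D by auto
  \<comment> \<open>Quarters of the allowed error \<open>e\<close> go to the division
    \<open>D\<close>, to the margins of its pieces (through \<open>\<kappa>\<close>) and to the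
    deviation of the weights from \<open>1\<close> (through \<open>\<epsilon>\<close>).\<close>
  define \<kappa> where "\<kappa> = e / (16 * (real (card D) + 1))"
  have \<kappa>: "0 < \<kappa>" "4 * \<kappa> * real (card D) \<le> e / 4"
    using e by (auto simp: \<kappa>_def field_simps)
  define \<epsilon> where "\<epsilon> = min (e / (8 * (len + 1))) (1 / 2)"
  have \<epsilon>: "0 < \<epsilon>" "\<epsilon> < 1" "2 * \<epsilon> * len \<le> e / 4"
  proof -
    show "0 < \<epsilon>" "\<epsilon> < 1" using e len0 by (auto simp: \<epsilon>_def)
    have "\<epsilon> \<le> e / (8 * (len + 1))" by (simp add: \<epsilon>_def)
    moreover have "0 < 8 * (len + 1)" using len0 by simp
    ultimately have "\<epsilon> * (8 * (len + 1)) \<le> e" using pos_le_divide_eq by blast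
    then show "2 * \<epsilon> * len \<le> e / 4" using \<open>0 < \<epsilon>\<close> by (simp add: algebra_simps)
  qed
  \<comment> \<open>Adjacent pieces of \<open>D\<close> share an end point, so each is shrunk by
    \<open>\<kappa>\<close> on both sides; shrinking in arc length rather than in time lets
    \<open>XW\<close> separate the images.\<close>
  define I where "I K = {x \<in> {Inf K..Sup K}. W (Inf K) + \<kappa> \<le> W x \<and> W x \<le> W (Sup K) - \<kappa>}" for K
  have Isub: "I K \<subseteq> {0..L}" if "K \<in> D" for K using b(1-3)[OF that] by (auto simp: I_def)
  have Icomp: "compact (I K)" if K: "K \<in> D" for K
  proof -
    have "continuous_on {Inf K..Sup K} W" by (rule continuous_on_subset[OF Wc]) (use b(1-3)[OF K] in auto)
    then have "closed ({Inf K..Sup K} \<inter> W -` {W (Inf K) + \<kappa>..W (Sup K) - \<kappa>})"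
      by (intro continuous_closed_preimage) auto
    moreover have "{Inf K..Sup K} \<inter> W -` {W (Inf K) + \<kappa>..W (Sup K) - \<kappa>} = I K" by (auto simp: I_def)
    moreover have "bounded (I K)" by (rule bounded_subset[OF compact_imp_bounded[OF compact_Icc] Isub[OF K]])
    ultimately show ?thesis by (simp add: compact_eq_bounded_closed)
  qed
  have iK: "interior K = {Inf K<..<Sup K}" if "K \<in> D" for K
    using interior_atLeastAtMost_real[of "Inf K" "Sup K"] unfolding b(4)[OF that, symmetric] by simp
  have Idisj: "W x \<noteq> W y" if K: "K \<in> D" "K' \<in> D" "K \<noteq> K'" and x: "x \<in> I K" and y: "y \<in> I K'" for K K' x y
  proof -
    have "W (Inf K) < W (Sup K)" "W (Inf K') < W (Sup K')" using x y \<kappa>(1) by (auto simp: I_def)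
    then have lt: "Inf K < Sup K" "Inf K' < Sup K'" using b(2)[OF K(1)] b(2)[OF K(2)] by (auto simp: less_le)
    have "interior K \<inter> interior K' = {}" by (rule division_ofD(5)[OF D K])
    then have "{Inf K<..<Sup K} \<inter> {Inf K'<..<Sup K'} = {}"
      unfolding iK[OF K(1)] iK[OF K(2)] .
    then have "Sup K \<le> Inf K' \<or> Sup K' \<le> Inf K"
      using lt by (auto simp: Int_greaterThanLessThan max_def min_def split: if_splits)
    then show ?thesis
      using Wm[of "Sup K" "Inf K'"] Wm[of "Sup K'" "Inf K"] b(1-3)[OF K(1)] b(1-3)[OF K(2)] x y \<kappa>(1) by (auto simp: I_def)
  qed
  have dj: "X ` I K \<inter> X ` I K' = {}" if K: "K \<in> D" "K' \<in> D" "K \<noteq> K'" for K K'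
  proof (rule ccontr)
    assume "X ` I K \<inter> X ` I K' \<noteq> {}"
    then obtain x y where xy: "x \<in> I K" "y \<in> I K'" "X x = X y" by blast
    then have "0 \<le> x" "x \<le> L" "0 \<le> y" "y \<le> L"
      using subsetD[OF Isub[OF K(1)] xy(1)] subsetD[OF Isub[OF K(2)] xy(2)] by auto
    then have "W x = W y"
      using XW[of x y] XW[of y x] xy(3) by (metis linear)
    then show False using Idisj[OF K xy(1,2)] by simp
  qed
  have cl: "closed (X ` I K)" if "K \<in> D" for K
    by (intro compact_imp_closed compact_continuous_image continuous_on_subset[OF cX] Icomp Isub that)
  have sub: "X ` I K \<subseteq> characters M" if "K \<in> D" for K
  proof
    fix y assume "y \<in> X ` I K"
    then obtain x where x: "x \<in> I K" "y = X x" by blast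
    then show "y \<in> characters M" using XK[of x] subsetD[OF Isub[OF that] x(1)] by simp
  qed
  have "\<exists>cs. \<forall>x\<in>characters M. (\<forall>K\<in>D. 0 \<le> pairing (cs K) x) \<and> (\<Sum>K\<in>D. pairing (cs K) x) \<le> 1 \<and>
      (\<forall>K\<in>D. x \<in> X ` I K \<longrightarrow> 1 - \<epsilon> < pairing (cs K) x)"
    by (rule pairing_partition[where A = "\<lambda>K. X ` I K", OF fD cl sub dj \<epsilon>(1,2)])
  then obtain cs where cs: "\<And>x K. x \<in> characters M \<Longrightarrow> K \<in> D \<Longrightarrow> 0 \<le> pairing (cs K) x"
    "\<And>x. x \<in> characters M \<Longrightarrow> (\<Sum>K\<in>D. pairing (cs K) x) \<le> 1"
    "\<And>x K. x \<in> characters M \<Longrightarrow> K \<in> D \<Longrightarrow> x \<in> X ` I K \<Longrightarrow> 1 - \<epsilon> < pairing (cs K) x" by blast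
  have "\<forall>K. \<exists>\<psi> :: 'v \<Rightarrow>\<^sub>L real. blinfun_apply \<psi> (\<delta> (Sup K) - \<delta> (Inf K)) = E (\<delta> (Sup K) - \<delta> (Inf K)) \<and> (\<forall>y. \<bar>blinfun_apply \<psi> y\<bar> \<le> E y)"
  proof
    fix K
    obtain f where f: "linear f" "f (\<delta> (Sup K) - \<delta> (Inf K)) = E (\<delta> (Sup K) - \<delta> (Inf K))" "\<And>y. \<bar>f y\<bar> \<le> E y"
      using euclidean_norm_norm_like(2)[OF E] by blast
    then show "\<exists>\<psi> :: 'v \<Rightarrow>\<^sub>L real. blinfun_apply \<psi> (\<delta> (Sup K) - \<delta> (Inf K)) = E (\<delta> (Sup K) - \<delta> (Inf K)) \<and> (\<forall>y. \<bar>blinfun_apply \<psi> y\<bar> \<le> E y)"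
      using bounded_linear_Blinfun_apply[OF finite_dim_bounded_linear[OF fd f(1)]] by (intro exI[of _ "Blinfun f"]) simp
  qed
  then obtain \<psi> :: "real set \<Rightarrow> 'v \<Rightarrow>\<^sub>L real" where
    \<psi>: "\<And>K. blinfun_apply (\<psi> K) (\<delta> (Sup K) - \<delta> (Inf K)) = E (\<delta> (Sup K) - \<delta> (Inf K))" "\<And>K y. \<bar>blinfun_apply (\<psi> K) y\<bar> \<le> E y"
    by (auto dest!: choice)
  \<comment> \<open>The integral of the one-form with weight \<open>pairing (cs K)\<close> in the
    direction \<open>\<psi> K\<close>, summed over \<open>K\<close>. As each \<open>\<psi> K\<close>
    is bounded by \<open>E\<close> and the weights add up to at most \<open>1\<close>, the form has
    dual norm at most \<open>1\<close> on \<open>characters M\<close>.\<close>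
  define \<Lambda> where "\<Lambda> x = (\<Sum>K\<in>D. pairing (prepend (\<psi> K) (cs K)) x)" for x
  have \<Lambda>1: "\<Lambda> tensor_one = 0" by (simp add: \<Lambda>_def pairing_prepend_one)
  define G where "G \<eta> A x p q = (\<Sum>K\<in>D. pairing (cs K) (signature x A \<eta>) * blinfun_apply (\<psi> K) (\<eta> q - \<eta> p))"
    for \<eta> :: "real \<Rightarrow> 'v" and A x p q
  have diff: "has_differential 0 A \<omega> (G \<eta> A) (\<lambda>s. - \<Lambda> (signature s A \<eta>))"
    if c: "controlled 0 A \<omega> \<eta>" and A: "0 \<le> A" for A \<omega> and \<eta> :: "real \<Rightarrow> 'v"
  proof -
    have "has_differential 0 A \<omega> (\<lambda>x p q. \<Sum>K\<in>D. pairing (cs K) (signature x A \<eta>) * (blinfun_apply (\<psi> K) (\<eta> q) - blinfun_apply (\<psi> K) (\<eta> p)))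
        (\<lambda>s. \<Sum>K\<in>D. - pairing (prepend (\<psi> K) (cs K)) (signature s A \<eta>))"
      by (intro has_differential_sum controlled_imp_control[OF c] pairing_differential[OF c A order_refl])
    then show ?thesis
      by (rule has_differential_cong) (auto simp: G_def \<Lambda>_def sum_negf blinfun.diff_right)
  qed
  have upper: "\<Lambda> (signature 0 A \<eta>) \<le> path_length E 0 A \<eta>"
    if \<eta>: "bv_path A \<eta>" and le: "path_length E 0 A \<eta> \<le> R" for A and \<eta> :: "real \<Rightarrow> 'v"
  proof -
    interpret h: length_bounded E C1 A \<eta> by unfold_locales (use Enl C1 \<eta> in auto)
    obtain \<omega> where c: "controlled 0 A \<omega> \<eta>" using \<eta>(1) by (rule bv_path_controlled)
    have "- \<Lambda> (signature A A \<eta>) - - \<Lambda> (signature 0 A \<eta>) \<le> path_length E 0 A \<eta> - path_length E 0 0 \<eta>"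
    proof (rule has_differential_upper[where \<Omega> = "\<lambda>t. path_length E 0 t \<eta>", OF diff[OF c h.A] h.A controlled_imp_control[OF c]],
        rule exI[of _ "1::real"], intro conjI allI impI)
      fix p q assume o: "0 \<le> p \<and> p \<le> q \<and> q \<le> A \<and> q - p < 1"
      have K: "signature p A \<eta> \<in> characters M" by (rule inK[OF \<eta> le]) (use o in auto)
      have "G \<eta> A p p q \<le> (\<Sum>K\<in>D. pairing (cs K) (signature p A \<eta>) * E (\<eta> q - \<eta> p))"
        unfolding G_def by (intro sum_mono mult_left_mono order_trans[OF abs_ge_self \<psi>(2)] cs(1)[OF K])
      also have "\<dots> = (\<Sum>K\<in>D. pairing (cs K) (signature p A \<eta>)) * E (\<eta> q - \<eta> p)" by (simp add: sum_distrib_right)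
      also have "\<dots> \<le> 1 * E (\<eta> q - \<eta> p)" by (intro mult_right_mono cs(2)[OF K] norm_likeD(4)[OF Enl])
      also have "\<dots> \<le> path_length E 0 q \<eta> - path_length E 0 p \<eta>" using h.length_increment[of p q] o by simp
      finally show "\<exists>x\<ge>p. x \<le> q \<and> G \<eta> A x p q \<le> path_length E 0 q \<eta> - path_length E 0 p \<eta>" using o by blast
    qed simp
    then show ?thesis using h.length_nonneg[of 0] h.A by (simp add: signature_degenerate \<Lambda>1)
  qed
  have lower: "len - e \<le> \<Lambda> (signature 0 L \<delta>)"
  proof -
    define H where "H s = - \<Lambda> (X s)" for s
    have DH: "has_differential 0 L \<omega> (G \<delta> L) H" unfolding H_def X_def by (rule diff[OF c d.A])
    have ctl: "control 0 L \<omega>" by (rule controlled_imp_control[OF c])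
    have piece: "E (\<delta> (Sup K) - \<delta> (Inf K)) - (H (Sup K) - H (Inf K)) \<le> 2 * \<epsilon> * (W (Sup K) - W (Inf K)) + 4 * \<kappa>"
      if K: "K \<in> D" for K
    proof -
      define k1 where "k1 = Inf K"
      define k2 where "k2 = Sup K"
      have k: "0 \<le> k1" "k1 \<le> k2" "k2 \<le> L" using b(1-3)[OF K] by (auto simp: k1_def k2_def)
      \<comment> \<open>Arc length clipped to the shrunk range, so that \<open>W - m\<close> grows
        only in the margins. \<open>\<Omega>\<close> charges the rate \<open>2 * \<epsilon>\<close>
        everywhere and the rate \<open>2\<close> in the margins, whose total length is at most
        \<open>2 * \<kappa>\<close>.\<close>
      define m where "m t = min (max (W t) (W k1 + \<kappa>)) (W k2 - \<kappa>)" for t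
      define \<Omega> where "\<Omega> t = 2 * \<epsilon> * W t + 2 * (W t - m t)" for t
      have ck: "control k1 k2 \<omega>" by (rule control_subinterval[OF ctl k(1,3)])
      let ?h = "\<lambda>t. blinfun_apply (\<psi> K) (\<delta> t)"
      have Dh: "has_differential k1 k2 \<omega> (\<lambda>x p q. blinfun_apply (\<psi> K) (\<delta> q - \<delta> p)) ?h"
        by (rule has_differentialI[OF order_refl _ ck]) (auto intro: exI[of _ "1::real"] simp: blinfun.diff_right)
      have DH': "has_differential k1 k2 \<omega> (\<lambda>x p q. - 1 * G \<delta> L x p q) (\<lambda>t. - 1 * H t)"
        by (rule has_differential_cmult[OF has_differential_subinterval[OF DH k(1,3)] ck])
      have "(?h k2 + - 1 * H k2) - (?h k1 + - 1 * H k1) \<le> \<Omega> k2 - \<Omega> k1"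
      proof (rule has_differential_upper[where \<Omega> = \<Omega>, OF has_differential_add[OF Dh DH' ck] k(2) ck],
          rule exI[of _ "1::real"], intro conjI allI impI)
        fix p q assume o': "k1 \<le> p \<and> p \<le> q \<and> q \<le> k2 \<and> q - p < 1"
        then have o: "0 \<le> p" "p \<le> q" "q \<le> L" "k1 \<le> p" "q \<le> k2" using k by auto
        define y where "y = \<delta> q - \<delta> p"
        have y: "E y \<le> W q - W p" "0 \<le> E y" unfolding y_def by (rule Wi[OF o(1-3)]) (rule norm_likeD(4)[OF Enl])
        have wpq: "W p \<le> W q" by (rule Wm[OF o(1-3)])
        have mm: "W p - m p \<le> W q - m q" using wpq by (auto simp: m_def)
        \<comment> \<open>The factor \<open>2\<close> has two sources: the weight missing on
          \<open>K\<close> itself, and the weights of all other pieces, which together are at most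
          the missing weight.\<close>
        have gen: "blinfun_apply (\<psi> K) y + - 1 * G \<delta> L x p q \<le> 2 * (1 - pairing (cs K) (X x)) * E y" if x: "p \<le> x" "x \<le> q" for x
        proof -
          have Kx: "X x \<in> characters M" by (rule XK) (use x o in auto)
          have "G \<delta> L x p q = pairing (cs K) (X x) * blinfun_apply (\<psi> K) y + (\<Sum>J\<in>D - {K}. pairing (cs J) (X x) * blinfun_apply (\<psi> J) y)"
            unfolding G_def X_def[symmetric] y_def[symmetric] by (rule sum.remove[OF fD K])
          moreover have "- (\<Sum>J\<in>D - {K}. pairing (cs J) (X x) * blinfun_apply (\<psi> J) y) \<le> (\<Sum>J\<in>D - {K}. pairing (cs J) (X x)) * E y"
            unfolding sum_negf[symmetric] sum_distrib_right
          proof (rule sum_mono)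
            fix J assume J: "J \<in> D - {K}"
            have "pairing (cs J) (X x) * - blinfun_apply (\<psi> J) y \<le> pairing (cs J) (X x) * E y"
              using \<psi>(2)[of J y] cs(1)[OF Kx, of J] J by (intro mult_left_mono) (auto simp: abs_le_iff)
            then show "- (pairing (cs J) (X x) * blinfun_apply (\<psi> J) y) \<le> pairing (cs J) (X x) * E y" by simp
          qed
          moreover have "(\<Sum>J\<in>D - {K}. pairing (cs J) (X x)) \<le> 1 - pairing (cs K) (X x)"
            using cs(2)[OF Kx] sum.remove[OF fD K, of "\<lambda>J. pairing (cs J) (X x)"] by simp
          then have "(\<Sum>J\<in>D - {K}. pairing (cs J) (X x)) * E y \<le> (1 - pairing (cs K) (X x)) * E y"
            by (rule mult_right_mono[OF _ y(2)])
          moreover have "0 \<le> (\<Sum>J\<in>D - {K}. pairing (cs J) (X x))" by (intro sum_nonneg cs(1)[OF Kx]) auto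
          then have "pairing (cs K) (X x) \<le> 1" using \<open>(\<Sum>J\<in>D - {K}. pairing (cs J) (X x)) \<le> 1 - pairing (cs K) (X x)\<close> by simp
          then have "(1 - pairing (cs K) (X x)) * blinfun_apply (\<psi> K) y \<le> (1 - pairing (cs K) (X x)) * E y"
            using \<psi>(2)[of K y] by (intro mult_left_mono) (auto simp: abs_le_iff)
          ultimately show ?thesis by (simp add: algebra_simps)
        qed
        show "\<exists>x\<ge>p. x \<le> q \<and> blinfun_apply (\<psi> K) (\<delta> q - \<delta> p) + - 1 * G \<delta> L x p q \<le> \<Omega> q - \<Omega> p"
        \<comment> \<open>Either the short interval contains a point of \<open>I K\<close>, at which
          the form is then evaluated, or the clipped arc length does not change on it.\<close>
        proof (cases "\<exists>x. p \<le> x \<and> x \<le> q \<and> W k1 + \<kappa> \<le> W x \<and> W x \<le> W k2 - \<kappa>")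
          case True
          then obtain x where x: "p \<le> x" "x \<le> q" "W k1 + \<kappa> \<le> W x" "W x \<le> W k2 - \<kappa>" by blast
          then have "x \<in> I K" using o by (auto simp: I_def k1_def k2_def)
          moreover have "X x \<in> characters M" by (rule XK) (use x o in auto)
          ultimately have "1 - pairing (cs K) (X x) \<le> \<epsilon>" using cs(3)[of "X x" K] K by fastforce
          then have "2 * (1 - pairing (cs K) (X x)) * E y \<le> 2 * \<epsilon> * E y" using y(2) by (intro mult_right_mono) auto
          also have "\<dots> \<le> 2 * \<epsilon> * (W q - W p)" using y(1) \<epsilon>(1) by (intro mult_left_mono) auto
          also have "\<dots> \<le> \<Omega> q - \<Omega> p" using mm by (simp add: \<Omega>_def algebra_simps)
          finally show ?thesis using gen[OF x(1,2)] x(1,2) unfolding y_def by (meson order_trans)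
        next
          case False
          have "m q = m p" unfolding m_def
            by (rule clip_increment[OF continuous_on_subset[OF Wc] o(2) wpq]) (use False o in auto)
          have "0 \<le> pairing (cs K) (X p)" by (intro cs(1) XK K) (use o in auto)
          then have "2 * (1 - pairing (cs K) (X p)) * E y \<le> 2 * E y" using y(2) by (simp add: mult_left_le_one_le mult_right_le_one_le algebra_simps)
          also have "\<dots> \<le> \<Omega> q - \<Omega> p"
          proof -
            have "\<epsilon> * W p \<le> \<epsilon> * W q" using \<epsilon>(1) wpq by simp
            then show ?thesis using y(1) \<open>m q = m p\<close> by (simp add: \<Omega>_def algebra_simps)
          qed
          finally show ?thesis using gen[of p] o(2) unfolding y_def by (meson order_refl order_trans)
        qed
      qed simp
      moreover have "\<Omega> k2 - \<Omega> k1 \<le> 2 * \<epsilon> * (W k2 - W k1) + 4 * \<kappa>"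
      proof -
        have "W k1 \<le> W k2" by (rule Wm[OF k])
        then have "(W k2 - m k2) - (W k1 - m k1) \<le> 2 * \<kappa>" using \<kappa>(1) by (auto simp: m_def min_def max_def)
        then show ?thesis by (simp add: \<Omega>_def algebra_simps)
      qed
      ultimately show ?thesis using \<psi>(1)[of K] by (simp add: k1_def k2_def blinfun.diff_right)
    qed
    have "(\<Sum>K\<in>D. E (\<delta> (Sup K) - \<delta> (Inf K))) - (\<Sum>K\<in>D. H (Sup K) - H (Inf K)) \<le>
        (\<Sum>K\<in>D. 2 * \<epsilon> * (W (Sup K) - W (Inf K)) + 4 * \<kappa>)"
      unfolding sum_subtractf[symmetric, of "\<lambda>K. E (\<delta> (Sup K) - \<delta> (Inf K))"] by (intro sum_mono piece)
    also have "\<dots> = 2 * \<epsilon> * (\<Sum>K\<in>D. W (Sup K) - W (Inf K)) + 4 * \<kappa> * real (card D)"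
      by (simp add: sum.distrib sum_distrib_left)
    also have "(\<Sum>K\<in>D. W (Sup K) - W (Inf K)) = W L - W 0" by (rule sum_division_increments[OF d.A D])
    also have "2 * \<epsilon> * (W L - W 0) \<le> 2 * \<epsilon> * len"
      using W0[of 0] d.A \<epsilon>(1) by (intro mult_left_mono) (auto simp: len_def)
    finally have "(\<Sum>K\<in>D. E (\<delta> (Sup K) - \<delta> (Inf K))) - (\<Sum>K\<in>D. H (Sup K) - H (Inf K)) \<le> e / 4 + e / 4"
      using \<kappa>(2) \<epsilon>(3) by simp
    moreover have "(\<Sum>K\<in>D. H (Sup K) - H (Inf K)) = H L - H 0" by (rule sum_division_increments[OF d.A D])
    moreover have "H L - H 0 = \<Lambda> (signature 0 L \<delta>)" by (simp add: H_def X_def signature_degenerate \<Lambda>1)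
    ultimately show ?thesis using DS e by simp
  qed
  define N where "N = (\<Sum>K\<in>D. word_bound (prepend (\<psi> K) (cs K)))"
  show ?thesis
  proof (intro exI[of _ N] allI impI, elim conjE)
    fix A and \<eta> :: "real \<Rightarrow> 'v"
    assume \<eta>: "bv_path A \<eta>" and tr: "tensor_trunc N (signature 0 A \<eta>) = tensor_trunc N (signature 0 L \<delta>)"
      and le: "path_length E 0 A \<eta> \<le> R"
    have "\<Lambda> (signature 0 A \<eta>) = \<Lambda> (signature 0 L \<delta>)"
      unfolding \<Lambda>_def
    proof (rule sum.cong[OF refl], rule pairing_eq_if_trunc_eq[OF tr])
      show "word_bound (prepend (\<psi> K) (cs K)) \<le> N" if "K \<in> D" for K
        unfolding N_def by (rule member_le_sum[OF that]) (use fD in auto)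
    qed
    then show "path_length E 0 L \<delta> - e \<le> path_length E 0 A \<eta>"
      using upper[OF \<eta> le] lower by (simp add: len_def W_def)
  qed
qed

section \<open>Metric projection to an axis\<close>

lemma tensor_trunc_one [simp]: "tensor_trunc N tensor_one = tensor_one"
  by (auto simp: tensor_trunc_def tensor_one_def)

lemma tensor_trunc_trunc [simp]: "tensor_trunc N (tensor_trunc N x) = tensor_trunc N x"
  by (auto simp: tensor_trunc_def)

text \<open>Evaluating the definite description of the inverse at the unit frees the distance from
  the group operations: the competitors are just the paths with the given truncated
  signature.\<close>

lemma cc_dist_one:
  fixes q :: "'a::real_normed_vector tensor_series"
  assumes q: "q \<in> carrier sig_group"
  shows "cc_dist E N tensor_one (tensor_trunc N q) =
    Inf {path_length E 0 A \<eta> |A \<eta>. bv_path A \<eta> \<and> tensor_trunc N (signature 0 A \<eta>) = tensor_trunc N q}"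
proof -
  have "inv\<^bsub>nilp_group N\<^esub> tensor_one = (tensor_one :: 'a tensor_series)"
    unfolding m_inv_def
  proof (rule the_equality)
    have "\<one>\<^bsub>sig_group\<^esub> \<in> carrier (sig_group :: 'a tensor_series monoid)"
      by (rule monoid.one_closed[OF group.is_monoid[OF group_sig_group]])
    then have "tensor_one \<in> carrier (sig_group :: 'a tensor_series monoid)" by simp
    then have "tensor_one \<in> tensor_trunc N ` carrier (sig_group :: 'a tensor_series monoid)"
      by (rule image_eqI[rotated]) simp
    then show "(tensor_one :: 'a tensor_series) \<in> carrier (nilp_group N) \<and>
      tensor_one \<otimes>\<^bsub>nilp_group N\<^esub> tensor_one = (\<one>\<^bsub>nilp_group N\<^esub> :: 'a tensor_series) \<and>
      tensor_one \<otimes>\<^bsub>nilp_group N\<^esub> tensor_one = (\<one>\<^bsub>nilp_group N\<^esub> :: 'a tensor_series)"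
      by (simp add: nilp_group_def)
  next
    fix y :: "'a tensor_series"
    assume "y \<in> carrier (nilp_group N) \<and> tensor_one \<otimes>\<^bsub>nilp_group N\<^esub> y = \<one>\<^bsub>nilp_group N\<^esub> \<and>
      y \<otimes>\<^bsub>nilp_group N\<^esub> tensor_one = \<one>\<^bsub>nilp_group N\<^esub>"
    then show "y = tensor_one" by (auto simp: nilp_group_def)
  qed
  then have "inv\<^bsub>nilp_group N\<^esub> tensor_one \<otimes>\<^bsub>nilp_group N\<^esub> tensor_trunc N q = tensor_trunc N q"
    by (simp add: nilp_group_def)
  then show ?thesis unfolding cc_dist_def by simp
qed

context
  fixes E :: "'v::real_normed_vector \<Rightarrow> real"
  assumes fd: "\<exists>B::'v set. finite B \<and> span B = UNIV" and E: "euclidean_norm E"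
begin

lemma euclidean_length_bounded: "\<exists>C. \<forall>A \<eta>. bv_path A \<eta> \<longrightarrow> length_bounded E C A \<eta>"
proof -
  note nl = euclidean_norm_norm_like(1)[OF E]
  have "seminorm E" using norm_likeD(1,2)[OF nl] by (simp add: seminorm_def)
  then obtain C where "\<And>x. E x \<le> C * norm x" using finite_dim_dominated[OF fd norm_like_norm] by blast
  then show ?thesis using nl unfolding length_bounded_def by blast
qed

lemma path_length_nonneg: "bv_path A \<eta> \<Longrightarrow> 0 \<le> path_length E 0 A \<eta>"
  using euclidean_length_bounded length_bounded.length_nonneg length_bounded.A by (metis order_refl)

lemma path_length_add_increment:
  "bv_path A \<eta> \<Longrightarrow> 0 \<le> s \<Longrightarrow> s \<le> A \<Longrightarrow> path_length E 0 s \<eta> + E (\<eta> A - \<eta> s) \<le> path_length E 0 A \<eta>"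
  using euclidean_length_bounded length_bounded.length_increment[of E _ A \<eta> s A] by fastforce

lemma cc_dist_one_le:
  assumes \<eta>: "bv_path A \<eta>"
  shows "cc_dist E N tensor_one (tensor_trunc N (signature 0 A \<eta>)) \<le> path_length E 0 A \<eta>"
  unfolding cc_dist_one[OF sig_groupI[OF \<eta>]]
proof (rule cInf_lower)
  show "bdd_below {path_length E 0 A' \<eta>' |A' \<eta>'. bv_path A' \<eta>' \<and>
      tensor_trunc N (signature 0 A' \<eta>') = tensor_trunc N (signature 0 A \<eta>)}"
    unfolding bdd_below_def using path_length_nonneg by blast
qed (use \<eta> in blast)

lemma sig_dist_one_le:
  assumes \<eta>: "bv_path A \<eta>"
  shows "sig_dist E tensor_one (signature 0 A \<eta>) \<le> path_length E 0 A \<eta>"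
  unfolding sig_dist_def tensor_trunc_one by (intro cSUP_least cc_dist_one_le[OF \<eta>]) auto

text \<open>Competitors longer than \<open>\<delta>\<close> satisfy the bound trivially; the others
  are covered by \<open>length_lower_bound\<close> with \<open>R\<close> the length of
  \<open>\<delta>\<close>.\<close>

lemma sig_dist_one_ge:
  assumes \<delta>: "bv_path L \<delta>" and red: "tree_reduced L \<delta>"
  shows "path_length E 0 L \<delta> \<le> sig_dist E tensor_one (signature 0 L \<delta>)"
proof (rule field_le_epsilon)
  fix e :: real assume e: "0 < e"
  define q where "q = signature 0 L \<delta>"
  have q: "q \<in> carrier sig_group" unfolding q_def by (rule sig_groupI[OF \<delta>])
  obtain N where N: "\<And>A \<eta>. bv_path A \<eta> \<Longrightarrow> tensor_trunc N (signature 0 A \<eta>) = tensor_trunc N q \<Longrightarrow>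
      path_length E 0 A \<eta> \<le> path_length E 0 L \<delta> \<Longrightarrow> path_length E 0 L \<delta> - e \<le> path_length E 0 A \<eta>"
    using length_lower_bound[OF fd E \<delta> red e order_refl] unfolding q_def by blast
  \<comment> \<open>\<open>Suc N\<close>, because the supremum in \<open>sig_dist\<close> starts at
    level \<open>1\<close>; agreement up to degree \<open>Suc N\<close> includes agreement up to
    \<open>N\<close>.\<close>
  have "path_length E 0 L \<delta> - e \<le> cc_dist E (Suc N) tensor_one (tensor_trunc (Suc N) q)"
    unfolding cc_dist_one[OF q]
  proof (rule cInf_greatest)
    show "{path_length E 0 A \<eta> |A \<eta>. bv_path A \<eta> \<and> tensor_trunc (Suc N) (signature 0 A \<eta>) = tensor_trunc (Suc N) q} \<noteq> {}"
      using \<delta> unfolding q_def by blast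
    fix l assume "l \<in> {path_length E 0 A \<eta> |A \<eta>. bv_path A \<eta> \<and> tensor_trunc (Suc N) (signature 0 A \<eta>) = tensor_trunc (Suc N) q}"
    then obtain A \<eta> where l: "l = path_length E 0 A \<eta>" and \<eta>: "bv_path A \<eta>"
      and tr: "tensor_trunc (Suc N) (signature 0 A \<eta>) = tensor_trunc (Suc N) q" by blast
    have "tensor_trunc N (signature 0 A \<eta>) = tensor_trunc N q"
    proof
      fix w show "tensor_trunc N (signature 0 A \<eta>) w = tensor_trunc N q w"
        using fun_cong[OF tr, of w] by (auto simp: tensor_trunc_def)
    qed
    from N[OF \<eta> this] show "path_length E 0 L \<delta> - e \<le> l" unfolding l using e by linarith
  qed
  also have "\<dots> \<le> sig_dist E tensor_one q"
    unfolding sig_dist_def tensor_trunc_one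
  proof (rule cSUP_upper)
    show "bdd_above ((\<lambda>N. cc_dist E N tensor_one (tensor_trunc N q)) ` {1..})"
      unfolding q_def bdd_above_def using cc_dist_one_le[OF \<delta>] by blast
  qed simp
  finally show "path_length E 0 L \<delta> \<le> sig_dist E tensor_one (signature 0 L \<delta>) + e" by (simp add: q_def)
qed

text \<open>The extended path is an initial part of the palindrome for \<open>t *\<^sub>R v\<close>
  and inherits tree-reducedness from it. The extension adds at least
  \<open>E (t *\<^sub>R v)\<close> to the length, which makes the nearest point unique.\<close>

theorem metric_projection_axis_hit:
  assumes hit: "axis_hit u \<gamma> v" and red: "tree_reduced u \<gamma>"
  shows "metric_projection E tensor_one {axis_point (signature 0 u \<gamma>) v t |t. True} = {signature 0 u \<gamma>}"
proof -
  interpret axis_hit u \<gamma> v by (rule hit)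
  let ?p = "signature 0 u \<gamma>"
  have le: "sig_dist E tensor_one ?p \<le> path_length E 0 u \<gamma>" by (rule sig_dist_one_le[OF path])
  have lt: "path_length E 0 u \<gamma> < sig_dist E tensor_one (axis_point ?p v t)" if t: "t \<noteq> 0" for t
  proof -
    \<comment> \<open>The axes for \<open>v\<close> and for \<open>t *\<^sub>R v\<close> are the
      same set, so the first-hit condition carries over.\<close>
    interpret t: axis_hit u \<gamma> "t *\<^sub>R v"
    proof
      fix s r assume "0 \<le> s" "s < u"
      then show "signature 0 s \<gamma> \<noteq> axis_point ?p (t *\<^sub>R v) r" using first[of s "r * t"] by (simp add: axis_point_def)
    qed (use fd path v t in auto)
    let ?P = "palindrome u \<gamma> (t *\<^sub>R v)"
    have P: "bv_path (u + 1) ?P" by (rule bv_path_restrict[OF palindrome_signature(1)[OF path]]) (use A in auto)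
    have "tree_reduced (u + 1) ?P" by (rule tree_reduced_restrict[OF t.palindrome_tree_reduced[OF red]]) (use A in auto)
    from sig_dist_one_ge[OF P this]
    have "path_length E 0 (u + 1) ?P \<le> sig_dist E tensor_one (axis_point ?p v t)"
      using palindrome_signature(3)[OF path, of "u + 1" "t *\<^sub>R v"] A by (simp add: axis_point_def)
    moreover have "path_length E 0 u ?P + E (t *\<^sub>R v) \<le> path_length E 0 (u + 1) ?P"
      using path_length_add_increment[OF P A] t.palindrome_middle_increment by simp
    moreover have "path_length E 0 u ?P = path_length E 0 u \<gamma>"
    proof -
      have "(\<Sum>K\<in>d. E (?P (Sup K) - ?P (Inf K))) = (\<Sum>K\<in>d. E (\<gamma> (Sup K) - \<gamma> (Inf K)))" if d: "d division_of {0..u}" for d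
      proof (rule sum.cong[OF refl])
        fix K assume K: "K \<in> d"
        show "E (?P (Sup K) - ?P (Inf K)) = E (\<gamma> (Sup K) - \<gamma> (Inf K))"
          using division_interval_bounds(2,3)[OF d K] by (simp add: palindrome_def path_concat_def)
      qed
      then have "variation_sums E 0 u ?P = variation_sums E 0 u \<gamma>" unfolding variation_sums_def by (intro image_cong) auto
      then show ?thesis by (simp add: path_length_def)
    qed
    moreover have "0 < E (t *\<^sub>R v)" using norm_likeD(5)[OF euclidean_norm_norm_like(1)[OF E], of "t *\<^sub>R v"] t v by simp
    ultimately show ?thesis by linarith
  qed
  have cmp: "sig_dist E tensor_one ?p \<le> sig_dist E tensor_one (axis_point ?p v t)" for t
    using le lt[of t] by (cases "t = 0") auto
  have pin: "?p \<in> {axis_point ?p v t |t. True}" using axis_point_zero[of ?p v] by (metis (mono_tags, lifting) mem_Collect_eq)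
  show ?thesis
  proof
    show "{?p} \<subseteq> metric_projection E tensor_one {axis_point ?p v t |t. True}"
      using pin cmp unfolding metric_projection_def by blast
    show "metric_projection E tensor_one {axis_point ?p v t |t. True} \<subseteq> {?p}"
    proof
      fix x assume x: "x \<in> metric_projection E tensor_one {axis_point ?p v t |t. True}"
      then obtain t where t: "x = axis_point ?p v t" by (auto simp: metric_projection_def)
      have "sig_dist E tensor_one x \<le> sig_dist E tensor_one ?p" using x pin unfolding metric_projection_def by blast
      then have "t = 0" using le lt[of t] t by (cases "t = 0") auto
      then show "x \<in> {?p}" by (simp add: t)
    qed
  qed
qed

end

section \<open>The equivalence and the gate\<close>

lemma sig_axis_eq: "sig_axis a v = {axis_point a v t |t. True}"
  by (simp add: sig_axis_def axis_point_def)

lemma axis_points_shift: "{axis_point (axis_point p v s) v t |t. True} = {axis_point p v t |t. True}"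
proof
  show "{axis_point p v t |t. True} \<subseteq> {axis_point (axis_point p v s) v t |t. True}"
  proof
    fix x assume "x \<in> {axis_point p v t |t. True}"
    then obtain t where "x = axis_point p v t" by blast
    then have "x = axis_point (axis_point p v s) v (t - s)" by (simp add: axis_point_axis_point)
    then show "x \<in> {axis_point (axis_point p v s) v t |t. True}" by blast
  qed
qed (auto simp: axis_point_axis_point)

theorem theorem6p8:
  fixes \<gamma> :: "real \<Rightarrow> 'v::real_normed_vector" and T :: real and v :: 'v and g :: "'v tensor_series"
  assumes finite_dim: "\<exists>B::'v set. finite B \<and> span B = UNIV"
    and path: "bv_path T \<gamma>"
    and reduced: "tree_reduced T \<gamma>"
    and based: "\<gamma> 0 = 0"
    and g_eq: "g = signature 0 T \<gamma>"
    and v_eq: "v = \<gamma> T"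
    and v_nz: "v \<noteq> 0"
  shows
    "((\<exists>a\<in>carrier sig_group. g = a \<otimes>\<^bsub>sig_group\<^esub> tensor_exp v \<otimes>\<^bsub>sig_group\<^esub> inv\<^bsub>sig_group\<^esub> a)
        \<longleftrightarrow> (\<exists>t\<^sub>0\<in>{0..T}. palindromic_at T \<gamma> v t\<^sub>0))
     \<and> (\<forall>a\<in>carrier sig_group.
          g = a \<otimes>\<^bsub>sig_group\<^esub> tensor_exp v \<otimes>\<^bsub>sig_group\<^esub> inv\<^bsub>sig_group\<^esub> a \<longrightarrow>
          (\<exists>p. \<forall>E. euclidean_norm E \<longrightarrow>
             metric_projection E \<one>\<^bsub>sig_group\<^esub> (sig_axis a v) = {p} \<and>
             (\<exists>t\<^sub>0\<in>{0..T}. palindromic_at T \<gamma> v t\<^sub>0 \<and> signature 0 t\<^sub>0 \<gamma> = p)))"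
proof -
  have conj: "a \<otimes>\<^bsub>sig_group\<^esub> tensor_exp v \<otimes>\<^bsub>sig_group\<^esub> inv\<^bsub>sig_group\<^esub> a = axis_translation a v"
    if "a \<in> carrier sig_group" for a :: "'v tensor_series"
    using sig_group_inv[OF that] by (simp add: axis_translation_def)
  \<comment> \<open>The time is chosen before \<open>E\<close>: the first hit is defined without a
    norm, so one prefix serves all Euclidean norms at once.\<close>
  have gate: "\<exists>t\<^sub>0\<in>{0..T}. palindromic_at T \<gamma> v t\<^sub>0 \<and>
      (\<forall>E. euclidean_norm E \<longrightarrow> metric_projection E tensor_one (sig_axis a v) = {signature 0 t\<^sub>0 \<gamma>})"
    if a: "a \<in> carrier sig_group" and g: "g = axis_translation a v" for a
  proof -
    have eq: "signature 0 T \<gamma> = axis_translation a v" using g g_eq by simp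
    obtain u t where u: "0 \<le> u" "u \<le> T" and p: "signature 0 u \<gamma> = axis_point a v t" and hit: "axis_hit u \<gamma> v"
      by (rule axis_gate[OF finite_dim v_nz path a eq])
    have "signature 0 T \<gamma> = axis_translation (signature 0 u \<gamma>) v"
      unfolding eq p using axis_translation_axis_point[of a, OF sig_group_Nil[OF a]] by simp
    then have "palindromic_at T \<gamma> v u" by (rule axis_hit_palindromic[OF hit u path reduced])
    moreover have "metric_projection E tensor_one (sig_axis a v) = {signature 0 u \<gamma>}" if "euclidean_norm E" for E
      using metric_projection_axis_hit[OF finite_dim that hit tree_reduced_restrict[OF reduced u(2)]]
      unfolding sig_axis_eq p axis_points_shift .
    ultimately show ?thesis using u by auto
  qed
  have converse: "\<exists>a\<in>carrier sig_group. g = axis_translation a v" if "t\<^sub>0 \<in> {0..T}" "palindromic_at T \<gamma> v t\<^sub>0" for t\<^sub>0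
    using palindromic_signature[OF path _ _ that(2)] sig_groupI[OF bv_path_restrict[OF path, of t\<^sub>0]] that(1) g_eq by auto
  show ?thesis
  proof (intro conjI ballI impI)
    show "(\<exists>a\<in>carrier sig_group. g = a \<otimes>\<^bsub>sig_group\<^esub> tensor_exp v \<otimes>\<^bsub>sig_group\<^esub> inv\<^bsub>sig_group\<^esub> a)
        \<longleftrightarrow> (\<exists>t\<^sub>0\<in>{0..T}. palindromic_at T \<gamma> v t\<^sub>0)"
      using gate converse conj by metis
  next
    fix a assume a: "a \<in> carrier sig_group"
      and "g = a \<otimes>\<^bsub>sig_group\<^esub> tensor_exp v \<otimes>\<^bsub>sig_group\<^esub> inv\<^bsub>sig_group\<^esub> a"
    then obtain t\<^sub>0 where t: "t\<^sub>0 \<in> {0..T}" "palindromic_at T \<gamma> v t\<^sub>0"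
      "\<And>E. euclidean_norm E \<Longrightarrow> metric_projection E tensor_one (sig_axis a v) = {signature 0 t\<^sub>0 \<gamma>}"
      using gate[OF a] conj[OF a] by metis
    show "\<exists>p. \<forall>E. euclidean_norm E \<longrightarrow>
             metric_projection E \<one>\<^bsub>sig_group\<^esub> (sig_axis a v) = {p} \<and>
             (\<exists>t\<^sub>0\<in>{0..T}. palindromic_at T \<gamma> v t\<^sub>0 \<and> signature 0 t\<^sub>0 \<gamma> = p)"
      by (rule exI[of _ "signature 0 t\<^sub>0 \<gamma>"]) (use t in auto)
  qed
qed

end
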